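(* Let $n\ge2$, let $\zeta:\mathcal C_n\to\mathcal C_n$ be the homeomorphism represented by the $n$-ary transducer $T^\zeta$ given in the context, and let $S_i=F_n^{\zeta^i}$ for $i\ge0$. Let $i\ge0$ and let $K$ be a subgroup with $S_i<K\le F_n$ (proper containment on the left). Then $K=S_j$ for some $0\le j<i$.
   Context: $\mathcal C_n=\{0,\dots,n-1\}^{\mathbb N}$ with the lexicographic order. $F_n$ is the group of order-preserving homeomorphisms $f$ of $\mathcal C_n$ for which there are finite complete prefix codes $\{u_1<\dots<u_k\}$, $\{v_1<\dots<v_k\}$ of finite words over $\{0,\dots,n-1\}$ (complete: the cylinders $u_i\mathcal C_n$ partition $\mathcal C_n$) with $f(u_i\omega)=v_i\omega$. Put $m=n-1$. The transducer $T^\zeta$ has initial state $\mathsf L$ and states $\mathsf L,\mathsf R,\mathsf A,\mathsf B$ together with routing states $\mathsf O_1,\dots,\mathsf O_{m-1}$ (none if $m=1$); put $\mathsf O_0=\mathsf R$ and read subscripts of $\mathsf O$ modulo $m$. An entry $i\mid w\to s'$ in the row of $s$ means that in state $s$ on input letter $i$ it outputs the word $w$ ($\varepsilon$ the empty word) and moves to $s'$; $d$ ranges over $1\le d\le m-1$ in the first four rows: $\mathsf L$: $0\mid0\to\mathsf L$, $d\mid d\to\mathsf O_d$, $m\mid m\to\mathsf R$; $\mathsf R$: $0\mid0\to\mathsf A$, $d\mid d\to\mathsf O_d$, $m\mid m\to\mathsf R$; $\mathsf A$: $0\mid00\to\mathsf A$, $d\mid 0d\to\mathsf O_d$, $m\mid\varepsilon\to\mathsf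 B$; $\mathsf B$: $0\mid0m\to\mathsf A$, $d\mid d\to\mathsf O_d$, $m\mid m\to\mathsf R$; $\mathsf O_s$ ($1\le s\le m-1$): $d\mid d\to\mathsf O_{s+d}$ for all $d\in\{0,\dots,n-1\}$. $\zeta(\omega)$ is the infinite output on input $\omega$ from $\mathsf L$; it is an order-preserving homeomorphism. $\zeta^i$ is the $i$-th iterate, and $F_n^{\zeta^i}=\{\zeta^i\circ f\circ\zeta^{-i}:f\in F_n\}$. One has $F_n=S_0\ge S_1\ge S_2\ge\cdots$. *)

theory Defs
  imports
    "HOL-Analysis.Function_Topology"
    "HOL-Algebra.Bij"
    "HOL-Library.Omega_Words_Fun"
    "HOL-Library.Fun_Lexorder"
    "HOL-Library.Sublist"
    "HOL-Library.Disjoint_Sets"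
begin

section \<open>The Cantor space over an alphabet with \<open>n\<close> letters\<close>

definition cantor :: "nat \<Rightarrow> nat word set" where
  "cantor n = {\<omega>. \<forall>k. \<omega> k < n}"

definition cantor_topology :: "nat \<Rightarrow> nat word topology" where
  "cantor_topology n = product_topology (\<lambda>_. discrete_topology {..<n}) UNIV"

lemma topspace_cantor_topology [simp]: "topspace (cantor_topology n) = cantor n"
  by (auto simp: cantor_topology_def cantor_def PiE_def Pi_def)

definition cylinder :: "nat \<Rightarrow> nat list \<Rightarrow> nat word set" where
  "cylinder n u = (\<lambda>\<omega>. u \<frown> \<omega>) ` cantor n"

definition complete_prefix_code :: "nat \<Rightarrow> nat list set \<Rightarrow> bool" where
  "complete_prefix_code n U \<longleftrightarrow>
     U \<subseteq> lists {..<n} \<and> pairwise (\<parallel>) U \<and> partition_on (cantor n) (cylinder n ` U)"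


section \<open>The group of order-preserving prefix-replacement homeomorphisms\<close>

text \<open>Homeomorphisms of the Cantor space are elements of \<^term>\<open>BijGroup (cantor n)\<close>, i.e.
  functions that are \<^const>\<open>undefined\<close> outside \<^term>\<open>cantor n\<close>, multiplied by composition
  (the right factor is applied first). The order \<^const>\<open>less_fun\<close> is the strict
  lexicographic order. The two codes are lists sorted lexicographically.\<close>

definition F :: "nat \<Rightarrow> (nat word \<Rightarrow> nat word) set" where
  "F n = {f \<in> carrier (BijGroup (cantor n)).
     homeomorphic_map (cantor_topology n) (cantor_topology n) f \<and>
     monotone_on (cantor n) less_fun less_fun f \<and>
     (\<exists>us vs. length us = length vs \<and>
        sorted_wrt (\<lambda>u v. (u, v) \<in> lexord less_than) us \<and>
        sorted_wrt (\<lambda>u v. (u, v) \<in> lexord less_than) vs \<and>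
        complete_prefix_code n (set us) \<and> complete_prefix_code n (set vs) \<and>
        (\<forall>k < length us. \<forall>\<omega> \<in> cantor n. f (us ! k \<frown> \<omega>) = vs ! k \<frown> \<omega>))}"


section \<open>Transducers\<close>

type_synonym 's transducer = "'s \<Rightarrow> nat \<Rightarrow> nat list \<times> 's"

fun out_word :: "'s transducer \<Rightarrow> 's \<Rightarrow> nat list \<Rightarrow> nat list" where
  "out_word T s [] = []"
| "out_word T s (d # ds) = (case T s d of (w, s') \<Rightarrow> w @ out_word T s' ds)"

text \<open>Letter \<open>j\<close> of the infinite output is read off as soon as the finite output is long enough;
  longer input prefixes only extend the finite output.\<close>

definition inf_output :: "'s transducer \<Rightarrow> 's \<Rightarrow> nat word \<Rightarrow> nat word" where
  "inf_output T s \<omega> = (\<lambda>j.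
     out_word T s (map \<omega> [0..<(LEAST k. j < length (out_word T s (map \<omega> [0..<k])))]) ! j)"

datatype state = St_L | St_R | St_A | St_B | St_O nat

text \<open>The subscripts of the routing states are taken modulo \<open>m\<close>, with subscript \<open>0\<close> denoting
  the state \<^const>\<open>St_R\<close>; thus \<open>St_O s\<close> is reached only for \<open>1 \<le> s \<le> m - 1\<close>.\<close>

definition routing :: "nat \<Rightarrow> nat \<Rightarrow> state" where
  "routing m s = (if s mod m = 0 then St_R else St_O (s mod m))"

text \<open>Only the letters \<open>d \<le> m = n - 1\<close> matter, so the last case of each of the first four rows
  is \<open>d = m\<close>.\<close>

fun T_zeta :: "nat \<Rightarrow> state transducer" where
  "T_zeta n St_L d = (let m = n - 1 in
     if d = 0 then ([0], St_L) else if d < m then ([d], routing m d) else ([m], St_R))"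
| "T_zeta n St_R d = (let m = n - 1 in
     if d = 0 then ([0], St_A) else if d < m then ([d], routing m d) else ([m], St_R))"
| "T_zeta n St_A d = (let m = n - 1 in
     if d = 0 then ([0, 0], St_A) else if d < m then ([0, d], routing m d) else ([], St_B))"
| "T_zeta n St_B d = (let m = n - 1 in
     if d = 0 then ([0, m], St_A) else if d < m then ([d], routing m d) else ([m], St_R))"
| "T_zeta n (St_O s) d = (let m = n - 1 in ([d], routing m (s + d)))"

definition zeta :: "nat \<Rightarrow> nat word \<Rightarrow> nat word" where
  "zeta n = restrict (inf_output (T_zeta n) St_L) (cantor n)"


section \<open>The conjugates of \<open>F n\<close> by the iterates of \<open>zeta n\<close>\<close>

definition S :: "nat \<Rightarrow> nat \<Rightarrow> (nat word \<Rightarrow> nat word) set" where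
  "S n i = (let G = BijGroup (cantor n); z = zeta n [^]\<^bsub>G\<^esub> i in
     {z \<otimes>\<^bsub>G\<^esub> f \<otimes>\<^bsub>G\<^esub> inv\<^bsub>G\<^esub> z | f. f \<in> F n})"

end

theory Submission
  imports Defs
begin

text \<open>
  The inverse of \<open>\<zeta>\<close> is again given by a transducer, and running it on a finite word \<open>u\<close> assigns
  a state to \<open>u\<close>. An element \<open>f\<close> of \<open>F\<close> lies in \<open>S\<^sub>1\<close> exactly when its local
  prefix replacements \<open>u \<mapsto> v\<close> preserve states, up to refining \<open>u\<close>; since digit sums modulo \<open>m\<close>
  are invariant under \<open>F\<close>, only the states \<open>R\<close>, \<open>A\<close> and \<open>B\<close> of the inverse transducer
  can be confused, and refining leads to a confusion of \<open>R\<close> with \<open>A\<close>.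

  Maximality of \<open>S\<^sub>1\<close>: let \<open>x\<close> be the element of \<open>F\<close> moving a caret from the first to the last
  child, so that \<open>\<zeta>\<^sub>A = x\<^sup>-\<^sup>1 \<circ> \<zeta>\<^sub>R\<close>. An element of \<open>K\<close> with a confusion on \<open>u\<close> can be multiplied
  by an element of \<open>S\<^sub>1\<close> so that it acts as \<open>x\<close> on \<open>u\<close> and trivially just to the left of \<open>u\<close>.
  Commutators with elements of \<open>S\<^sub>1\<close> and the pentagon relation then put copies of \<open>x\<close> into \<open>K\<close>
  that are supported in single cylinders. Multiplying by such copies removes every confusion from an
  element of \<open>F\<close>, so \<open>K = F\<close>.

  For general \<open>i\<close>, a confusion also makes \<open>K \<inter> S\<^sub>1\<close> contain an element outside \<open>S\<^sub>2\<close>: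
  two words whose \<open>\<zeta>\<close>-preimages have states \<open>A\<close> and \<open>B\<close> become equivalent under \<open>K\<close>, although the
  elements of \<open>S\<^sub>i\<close> supported in their cylinders differ. Induction on \<open>i\<close>, applied to the
  conjugates of \<open>K\<close> or \<open>K \<inter> S\<^sub>1\<close> by \<open>\<zeta>\<^sup>-\<^sup>1\<close>, finishes the proof.
\<close>

section \<open>Transducers\<close>

text \<open>The proof is shaped by an asymmetry between \<zeta> and its inverse. In the transducer
  of \<zeta>, two runs outside \<open>St_L\<close> with the same digit sum modulo \<open>m\<close>
  merge after at most two letters, so conjugation by \<zeta> maps \<open>F\<close> into itself. In
  the inverse transducer the input \<open>000...\<close> alternates \<open>St_A\<close> and
  \<open>St_B\<close> for ever, and two runs out of phase never merge on it. This parity keeps a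
  mismatch of states from being repaired by refinement.

  A mismatch only yields an element \<open>t\<close> that agrees with \<open>x\<close> on the
  cylinder of \<open>u\<close>; elsewhere \<open>t\<close> is unknown. To isolate the copy of
  \<open>x\<close>, some \<open>h\<close> in \<open>S n 1\<close> squeezes the cylinder of
  \<open>u\<close> into that of \<open>u m\<close>. The support of such an \<open>h\<close> must
  reach outside \<open>u\<close>, and it is made to reach only into a left neighbour
  \<open>e\<close>. This is why \<open>t\<close> must be trivial on \<open>e\<close>: off
  \<open>e\<close> and \<open>u\<close> the unknown parts of \<open>t\<close> then cancel in the
  pentagon word.

  When \<open>i > 1\<close>, nothing says beforehand that \<open>K\<close> contains
  \<open>S n 1\<close>. By induction \<open>K\<close> \<inter> \<open>S n 1\<close> belongs to the
  chain, and an element of it outside \<open>S n 2\<close> leaves only the possibility that it is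
  \<open>S n 1\<close> itself.\<close>

fun run :: "'s transducer \<Rightarrow> 's \<Rightarrow> nat list \<Rightarrow> 's" where
  "run T s [] = s"
| "run T s (d # ds) = run T (snd (T s d)) ds"

text \<open>No two consecutive transitions are silent. Both transducers used below are silent only
  in \<open>St_A\<close>, so the delay is bounded by the factor 2 of
  \<open>progressive_length\<close>.\<close>

definition progressive :: "'s transducer \<Rightarrow> bool" where
  "progressive T \<longleftrightarrow> (\<forall>s d e. fst (T s d) = [] \<longrightarrow> fst (T (snd (T s d)) e) \<noteq> [])"

lemma out_word_Cons [simp]: "out_word T s (d # ds) = fst (T s d) @ out_word T (snd (T s d)) ds"
  by (simp add: case_prod_beta)

declare out_word.simps(2) [simp del]

lemma run_append [simp]: "run T s (u @ v) = run T (run T s u) v"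
  by (induction u arbitrary: s) auto

lemma out_word_append [simp]: "out_word T s (u @ v) = out_word T s u @ out_word T (run T s u) v"
  by (induction u arbitrary: s) auto

lemma progressive_length:
  assumes T: "progressive T"
  shows "2 * k \<le> length u \<Longrightarrow> k \<le> length (out_word T s u)"
proof (induction k arbitrary: s u)
  case (Suc k)
  obtain d u1 where 1: "u = d # u1" using Suc.prems by (cases u) auto
  obtain e u2 where 2: "u1 = e # u2" using Suc.prems 1 by (cases u1) auto
  let ?s1 = "snd (T s d)" let ?s2 = "snd (T ?s1 e)"
  have "k \<le> length (out_word T ?s2 u2)" using Suc 1 2 by simp
  moreover have "1 \<le> length (fst (T s d) @ fst (T ?s1 e))"
    using T by (auto simp: progressive_def Suc_le_eq)
  ultimately show ?case using 1 2 by simp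
qed simp

lemma inf_output_nth:
  assumes "j < length (out_word T s (map \<omega> [0..<k]))"
  shows "inf_output T s \<omega> j = out_word T s (map \<omega> [0..<k]) ! j"
proof -
  let ?P = "\<lambda>k. j < length (out_word T s (map \<omega> [0..<k]))"
  define l where "l = (LEAST k. ?P k)"
  have l: "?P l" unfolding l_def by (rule LeastI[of ?P k]) (rule assms)
  have "l \<le> k" unfolding l_def by (rule Least_le) (rule assms)
  then have "[0..<k] = [0..<l] @ [l..<k]" by (metis le_add_diff_inverse upt_add_eq_append zero_le)
  then have "out_word T s (map \<omega> [0..<k]) ! j = out_word T s (map \<omega> [0..<l]) ! j"
    using l by (simp add: nth_append)
  then show ?thesis by (simp add: inf_output_def l_def)
qed

text \<open>Replaces the \<open>LEAST\<close> in \<open>inf_output\<close> by a recursion on the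
  first input letter; the definition is not unfolded again afterwards.\<close>

lemma inf_output_build:
  assumes T: "progressive T"
  shows "inf_output T s (d ## \<omega>) = fst (T s d) \<frown> inf_output T (snd (T s d)) \<omega>"
proof
  fix j
  let ?k = "2 * Suc j" let ?s = "snd (T s d)"
  let ?w = "out_word T ?s (map \<omega> [0..<?k])"
  have w: "j < length ?w" using progressive_length[OF T, of "Suc j" "map \<omega> [0..<?k]" ?s] by simp
  have "map (d ## \<omega>) [0..<Suc ?k] = d # map \<omega> [0..<?k]"
    by (rule nth_equalityI) (auto simp: nth_Cons split: nat.split simp del: upt_Suc)
  then have o: "out_word T s (map (d ## \<omega>) [0..<Suc ?k]) = fst (T s d) @ ?w" by (simp del: upt_Suc)
  then have "inf_output T s (d ## \<omega>) j = (fst (T s d) @ ?w) ! j"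
    using inf_output_nth[of j T s "d ## \<omega>" "Suc ?k"] w by (simp del: upt_Suc)
  also have "\<dots> = (fst (T s d) \<frown> inf_output T ?s \<omega>) j"
  proof (cases "j < length (fst (T s d))")
    case False
    then have "j - length (fst (T s d)) < length ?w" using w by simp
    then show ?thesis using False inf_output_nth[of "j - length (fst (T s d))" T ?s \<omega> ?k]
      by (simp add: nth_append)
  qed (simp add: nth_append)
  finally show "inf_output T s (d ## \<omega>) j = (fst (T s d) \<frown> inf_output T ?s \<omega>) j" .
qed

lemma inf_output_conc:
  assumes T: "progressive T"
  shows "inf_output T s (u \<frown> \<omega>) = out_word T s u \<frown> inf_output T (run T s u) \<omega>"
  by (induction u arbitrary: s) (simp_all add: inf_output_build[OF T])

text \<open>Bisimulation with common blocks of variable length. Blocks are nonempty, so each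
  position is reached after finitely many of them.\<close>

lemma word_coinduct:
  assumes "P \<alpha> \<beta>"
    and step: "\<And>\<alpha> \<beta>. P \<alpha> \<beta> \<Longrightarrow> \<exists>w \<alpha>' \<beta>'. w \<noteq> [] \<and> \<alpha> = w \<frown> \<alpha>' \<and> \<beta> = w \<frown> \<beta>' \<and> P \<alpha>' \<beta>'"
  shows "\<alpha> = \<beta>"
proof
  fix j show "\<alpha> j = \<beta> j"
    using assms(1)
  proof (induction j arbitrary: \<alpha> \<beta> rule: less_induct)
    case (less j)
    obtain w \<alpha>' \<beta>' where w: "w \<noteq> []" "\<alpha> = w \<frown> \<alpha>'" "\<beta> = w \<frown> \<beta>'" "P \<alpha>' \<beta>'"
      using step[OF less.prems] by blast
    show ?case
    proof (cases "j < length w")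
      case False
      then have "j - length w < j" using w(1) by (cases w) auto
      then show ?thesis using less.IH[OF _ w(4)] w False by simp
    qed (use w in simp)
  qed
qed

text \<open>The transducer of \<open>\<zeta>\<^sup>-\<^sup>1\<close>. Its fifth kind of state, entered from \<^const>\<open>St_A\<close> on input \<open>0\<close>,
  reuses the name \<^const>\<open>St_B\<close>.\<close>

fun T_inv :: "nat \<Rightarrow> state transducer" where
  "T_inv n St_L d = (if d = 0 then ([0], St_L) else ([d], routing (n - 1) d))"
| "T_inv n St_R d = (if d = 0 then ([0], St_A) else ([d], routing (n - 1) d))"
| "T_inv n St_A d = (if d = 0 then ([], St_B) else ([n - 1, d], routing (n - 1) d))"
| "T_inv n St_B d = (if d = 0 then ([0], St_A) else if d < n - 1 then ([d], routing (n - 1) d)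
     else ([n - 1, 0], St_A))"
| "T_inv n (St_O s) d = ([d], routing (n - 1) (s + d))"

section \<open>Words over a finite alphabet\<close>

declare build_split [rule del]

locale alphabet =
  fixes m :: nat
  assumes m_pos: "0 < m"
begin

abbreviation "n \<equiv> Suc m"
abbreviation (input) "pre k \<omega> \<equiv> subsequence \<omega> 0 k"
abbreviation (input) "suf \<equiv> Omega_Words_Fun.suffix"
abbreviation "C \<equiv> cantor n"
abbreviation "W \<equiv> lists {..<n}"
abbreviation "G \<equiv> BijGroup C"
abbreviation gmult (infixl \<open>\<star>\<close> 70) where "f \<star> g \<equiv> f \<otimes>\<^bsub>G\<^esub> g"
abbreviation "iv f \<equiv> inv\<^bsub>G\<^esub> f"
abbreviation "gone \<equiv> \<one>\<^bsub>G\<^esub>"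
abbreviation lt (infix \<open>\<sqsubset>\<close> 50) where "lt \<equiv> less_fun"
abbreviation "zeros \<equiv> (\<lambda>_::nat. 0::nat)"
abbreviation "tops \<equiv> (\<lambda>_::nat. m)"

lemma bot_C [simp]: "zeros \<in> C" and top_C [simp]: "tops \<in> C"
  by (auto simp: cantor_def)

lemma conc_C [simp]: "u \<frown> \<omega> \<in> C \<longleftrightarrow> u \<in> W \<and> \<omega> \<in> C"
proof
  assume h: "u \<frown> \<omega> \<in> C"
  have "u ! i < n" if "i < length u" for i
  proof -
    have "(u \<frown> \<omega>) i < n" using h by (simp add: cantor_def)
    with that show ?thesis by simp
  qed
  moreover have "\<omega> i < n" for i
  proof -
    have "(u \<frown> \<omega>) (length u + i) < n" using h unfolding cantor_def by blast
    then show ?thesis by simp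
  qed
  ultimately show "u \<in> W \<and> \<omega> \<in> C"
    by (auto simp: in_set_conv_nth cantor_def)
next
  assume "u \<in> W \<and> \<omega> \<in> C"
  then show "u \<frown> \<omega> \<in> C"
    by (auto simp: cantor_def conc_def in_lists_conv_set)
qed

lemma conc_inject [simp]: "u \<frown> \<omega> = u \<frown> \<eta> \<longleftrightarrow> \<omega> = \<eta>"
proof
  assume h: "u \<frown> \<omega> = u \<frown> \<eta>"
  show "\<omega> = \<eta>"
  proof
    fix i show "\<omega> i = \<eta> i" using fun_cong[OF h, of "length u + i"] by simp
  qed
qed simp

lemma conc_eq_iff: "length u = length v \<Longrightarrow> u \<frown> \<omega> = v \<frown> \<eta> \<longleftrightarrow> u = v \<and> \<omega> = \<eta>"
proof (intro iffI)
  assume l: "length u = length v" and h: "u \<frown> \<omega> = v \<frown> \<eta>"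
  have "u = v"
  proof (rule nth_equalityI[OF l])
    fix i assume "i < length u" then show "u ! i = v ! i"
      using fun_cong[OF h, of i] l by simp
  qed
  with h show "u = v \<and> \<omega> = \<eta>" by simp
qed simp

lemma pre_suf [simp]: "pre k \<omega> \<frown> suf k \<omega> = \<omega>"
  by (simp add: conc_def fun_eq_iff subsequence_def suffix_def)

lemma length_pre [simp]: "length (pre k \<omega>) = k"
  by (simp add: subsequence_def)

lemma pre_W [simp]: "\<omega> \<in> C \<Longrightarrow> pre k \<omega> \<in> W"
  by (metis conc_C pre_suf)

lemma suf_C [simp]: "\<omega> \<in> C \<Longrightarrow> suf k \<omega> \<in> C"
  by (metis conc_C pre_suf)

lemma pre_conc_length: "pre (length u) (u \<frown> \<omega>) = u"
  by (metis conc_eq_iff length_pre pre_suf)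

lemma suf_conc_length: "suf (length u) (u \<frown> \<omega>) = \<omega>"
  by (metis conc_eq_iff length_pre pre_suf)

lemma pre_conc_ge: "pre (length u + k) (u \<frown> \<omega>) = u @ pre k \<omega>"
  by (metis conc_conc length_append length_pre pre_conc_length pre_suf)

lemma pre_conc_le: "k \<le> length u \<Longrightarrow> pre k (u \<frown> \<omega>) = take k u"
  by (rule nth_equalityI) (auto simp: subsequence_def)

lemma pre_ge: "k \<le> l \<Longrightarrow> pre l \<omega> = pre k \<omega> @ pre (l - k) (suf k \<omega>)"
  by (metis le_add_diff_inverse length_pre pre_conc_ge pre_suf)

lemma build_C [simp]: "d ## \<omega> \<in> C \<longleftrightarrow> d < n \<and> \<omega> \<in> C"
  using conc_C[of "[d]" \<omega>] by simp

lemma C_cases: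
  assumes "\<omega> \<in> C"
  obtains d \<eta> where "d < n" "\<eta> \<in> C" "\<omega> = d ## \<eta>"
proof -
  have "\<omega> = \<omega> 0 ## suf 1 \<omega>" by (rule build_split)
  moreover have "\<omega> 0 < n" using assms by (simp add: cantor_def)
  ultimately show thesis using that suf_C[OF assms] by blast
qed

lemma bot_conc: "set u \<subseteq> {0} \<Longrightarrow> u \<frown> zeros = zeros"
  using nth_mem by (fastforce simp: conc_def fun_eq_iff)

lemma bot_conc_iff: "u \<frown> \<omega> = zeros \<longleftrightarrow> set u \<subseteq> {0} \<and> \<omega> = zeros"
proof
  assume h: "u \<frown> \<omega> = zeros"
  have "u ! i = 0" if "i < length u" for i using fun_cong[OF h, of i] that by simp
  then have "set u \<subseteq> {0}" by (auto simp: in_set_conv_nth)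
  then show "set u \<subseteq> {0} \<and> \<omega> = zeros" using h bot_conc[of u] by (metis conc_inject)
qed (auto simp: bot_conc)

lemma top_conc: "set u \<subseteq> {m} \<Longrightarrow> u \<frown> tops = tops"
  using nth_mem by (fastforce simp: conc_def fun_eq_iff)

lemma top_conc_iff: "u \<frown> \<omega> = tops \<longleftrightarrow> set u \<subseteq> {m} \<and> \<omega> = tops"
proof
  assume h: "u \<frown> \<omega> = tops"
  have "u ! i = m" if "i < length u" for i using fun_cong[OF h, of i] that by simp
  then have "set u \<subseteq> {m}" by (auto simp: in_set_conv_nth)
  then show "set u \<subseteq> {m} \<and> \<omega> = tops" using h top_conc[of u] by (metis conc_inject)
qed (auto simp: top_conc)

lemma lt_conc [simp]: "u \<frown> \<omega> \<sqsubset> u \<frown> \<eta> \<longleftrightarrow> \<omega> \<sqsubset> \<eta>"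
proof
  assume "u \<frown> \<omega> \<sqsubset> u \<frown> \<eta>"
  then obtain k where k: "(u \<frown> \<omega>) k < (u \<frown> \<eta>) k" "\<And>j. j < k \<Longrightarrow> (u \<frown> \<omega>) j = (u \<frown> \<eta>) j"
    unfolding less_fun_def by blast
  have kl: "length u \<le> k" using k(1) by (cases "k < length u") auto
  have "\<omega> (k - length u) < \<eta> (k - length u)" using k(1) kl by simp
  moreover have "\<omega> j = \<eta> j" if "j < k - length u" for j
    using k(2)[of "length u + j"] that by simp
  ultimately show "\<omega> \<sqsubset> \<eta>" by (auto simp: less_fun_def)
next
  assume "\<omega> \<sqsubset> \<eta>"
  then obtain k where k: "\<omega> k < \<eta> k" "\<And>j. j < k \<Longrightarrow> \<omega> j = \<eta> j"
    unfolding less_fun_def by blast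
  have "(u \<frown> \<omega>) (length u + k) < (u \<frown> \<eta>) (length u + k)" using k by simp
  moreover have "(u \<frown> \<omega>) j = (u \<frown> \<eta>) j" if "j < length u + k" for j
    using k(2)[of "j - length u"] that by (cases "j < length u") auto
  ultimately show "u \<frown> \<omega> \<sqsubset> u \<frown> \<eta>" unfolding less_fun_def by blast
qed

lemma lt_build [simp]: "d ## \<omega> \<sqsubset> e ## \<eta> \<longleftrightarrow> d < e \<or> d = e \<and> \<omega> \<sqsubset> \<eta>"
proof (cases "d = e")
  case True
  then show ?thesis using lt_conc[of "[d]" \<omega> \<eta>] by simp
next
  case False
  show ?thesis
  proof
    assume "d ## \<omega> \<sqsubset> e ## \<eta>"
    then obtain k where k: "(d ## \<omega>) k < (e ## \<eta>) k"
      "\<And>j. j < k \<Longrightarrow> (d ## \<omega>) j = (e ## \<eta>) j" unfolding less_fun_def by blast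
    have "k = 0" using k(2)[of 0] False by (cases k) auto
    then show "d < e \<or> d = e \<and> \<omega> \<sqsubset> \<eta>" using k(1) by simp
  next
    assume "d < e \<or> d = e \<and> \<omega> \<sqsubset> \<eta>"
    then show "d ## \<omega> \<sqsubset> e ## \<eta>" using False by (intro less_funI exI[of _ 0]) auto
  qed
qed

lemma lt_total:
  fixes \<omega> \<eta> :: "nat word"
  shows "\<omega> \<noteq> \<eta> \<Longrightarrow> \<omega> \<sqsubset> \<eta> \<or> \<eta> \<sqsubset> \<omega>"
proof -
  assume "\<omega> \<noteq> \<eta>"
  then have ex: "\<exists>k. \<omega> k \<noteq> \<eta> k" by auto
  define k where "k = (LEAST k. \<omega> k \<noteq> \<eta> k)"
  have "\<omega> k \<noteq> \<eta> k" using ex unfolding k_def by (rule LeastI_ex)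
  moreover have "\<forall>j<k. \<omega> j = \<eta> j" using not_less_Least unfolding k_def by blast
  ultimately show ?thesis unfolding less_fun_def by (metis linorder_neqE_nat)
qed

lemma not_lt_bot: "\<not> \<omega> \<sqsubset> zeros"
  by (auto simp: less_fun_def)

lemma not_top_lt:
  assumes "\<omega> \<in> C" shows "\<not> tops \<sqsubset> \<omega>"
proof
  assume "tops \<sqsubset> \<omega>"
  then obtain k where "m < \<omega> k" by (auto simp: less_fun_def)
  moreover have "\<omega> k < n" using assms by (simp add: cantor_def)
  ultimately show False by simp
qed

subsection \<open>Order-preserving bijections\<close>

definition MonoBij :: "(nat word \<Rightarrow> nat word) set" where
  "MonoBij = {f \<in> Bij C. monotone_on C less_fun less_fun f}"

lemma carrier_G [simp]: "carrier G = Bij C"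
  by (simp add: BijGroup_def)

lemma group_G: "group G" by (rule group_BijGroup)

lemma mult_Bij [simp]: "f \<in> Bij C \<Longrightarrow> g \<in> Bij C \<Longrightarrow> f \<star> g \<in> Bij C"
  using group.is_monoid[OF group_G] monoid.m_closed by fastforce

lemma inv_Bij [simp]: "f \<in> Bij C \<Longrightarrow> iv f \<in> Bij C"
  using group.inv_closed[OF group_G] by simp

lemma Bij_C: "f \<in> Bij C \<Longrightarrow> \<omega> \<in> C \<Longrightarrow> f \<omega> \<in> C"
  using Bij_imp_funcset[of f C] funcset_mem[of f C C \<omega>] by blast

lemma mult_app [simp]: "f \<in> Bij C \<Longrightarrow> g \<in> Bij C \<Longrightarrow> \<omega> \<in> C \<Longrightarrow> (f \<star> g) \<omega> = f (g \<omega>)"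
  by (simp add: BijGroup_def compose_def)

lemma inv_app1 [simp]: "f \<in> Bij C \<Longrightarrow> \<omega> \<in> C \<Longrightarrow> (iv f) (f \<omega>) = \<omega>"
  using Bij_C[of f \<omega>] by (simp add: inv_BijGroup Bij_def bij_betw_def inv_into_f_f)

lemma inv_app2 [simp]: "f \<in> Bij C \<Longrightarrow> \<omega> \<in> C \<Longrightarrow> f ((iv f) \<omega>) = \<omega>"
  by (simp add: inv_BijGroup Bij_def bij_betw_def f_inv_into_f)

lemma Bij_inj: "f \<in> Bij C \<Longrightarrow> \<omega> \<in> C \<Longrightarrow> \<eta> \<in> C \<Longrightarrow> f \<omega> = f \<eta> \<longleftrightarrow> \<omega> = \<eta>"
  using inv_app1[of f \<omega>] inv_app1[of f \<eta>] by metis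

lemma Bij_eqI: "f \<in> Bij C \<Longrightarrow> g \<in> Bij C \<Longrightarrow> (\<And>\<omega>. \<omega> \<in> C \<Longrightarrow> f \<omega> = g \<omega>) \<Longrightarrow> f = g"
  by (meson Bij_imp_extensional extensionalityI)

lemma BijI:
  assumes "f \<in> extensional C" "\<And>\<omega>. \<omega> \<in> C \<Longrightarrow> f \<omega> \<in> C" "\<And>\<omega>. \<omega> \<in> C \<Longrightarrow> g \<omega> \<in> C"
    "\<And>\<omega>. \<omega> \<in> C \<Longrightarrow> g (f \<omega>) = \<omega>" "\<And>\<omega>. \<omega> \<in> C \<Longrightarrow> f (g \<omega>) = \<omega>"
  shows "f \<in> Bij C"
  unfolding Bij_def using assms by (auto intro!: bij_betwI[where g = g])

lemma MonoBij_Bij: "f \<in> MonoBij \<Longrightarrow> f \<in> Bij C"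
  by (simp add: MonoBij_def)

lemma MonoBij_lt:
  assumes "f \<in> MonoBij" "\<omega> \<in> C" "\<eta> \<in> C" shows "f \<omega> \<sqsubset> f \<eta> \<longleftrightarrow> \<omega> \<sqsubset> \<eta>"
proof -
  have mono: "x \<sqsubset> y \<Longrightarrow> f x \<sqsubset> f y" if "x \<in> C" "y \<in> C" for x y
    using assms(1) that by (auto simp: MonoBij_def monotone_on_def)
  show ?thesis
    using mono[OF assms(2,3)] mono[OF assms(3,2)] lt_total[of \<omega> \<eta>]
    by (metis less_fun_asym less_fun_irrefl)
qed

lemma MonoBij_I: "f \<in> Bij C \<Longrightarrow> (\<And>\<omega> \<eta>. \<omega> \<in> C \<Longrightarrow> \<eta> \<in> C \<Longrightarrow> \<omega> \<sqsubset> \<eta> \<Longrightarrow> f \<omega> \<sqsubset> f \<eta>) \<Longrightarrow> f \<in> MonoBij"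
  by (auto simp: MonoBij_def monotone_on_def)

lemma MonoBij_mult: assumes f: "f \<in> MonoBij" and g: "g \<in> MonoBij" shows "f \<star> g \<in> MonoBij"
  using MonoBij_lt[OF f] MonoBij_lt[OF g] Bij_C[OF MonoBij_Bij[OF g]]
  by (intro MonoBij_I) (simp_all add: MonoBij_Bij f g)

lemma MonoBij_inv: assumes f: "f \<in> MonoBij" shows "iv f \<in> MonoBij"
proof (rule MonoBij_I)
  have fB: "f \<in> Bij C" using f by (rule MonoBij_Bij)
  then show "iv f \<in> Bij C" by simp
  fix \<omega> \<eta> assume h: "\<omega> \<in> C" "\<eta> \<in> C" "\<omega> \<sqsubset> \<eta>"
  then show "(iv f) \<omega> \<sqsubset> (iv f) \<eta>"
    using MonoBij_lt[OF f, of "(iv f) \<omega>" "(iv f) \<eta>"] Bij_C[OF inv_Bij[OF fB]] fB by simp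
qed

lemma MonoBij_bot: assumes f: "f \<in> MonoBij" shows "f zeros = zeros"
proof (rule ccontr)
  have fB: "f \<in> Bij C" using f by (rule MonoBij_Bij)
  define \<eta> where "\<eta> = (iv f) zeros"
  have e: "\<eta> \<in> C" "f \<eta> = zeros" using fB Bij_C[OF inv_Bij[OF fB]] by (auto simp: \<eta>_def)
  assume ne: "f zeros \<noteq> zeros"
  then have "zeros \<sqsubset> \<eta>" using e lt_total not_lt_bot by metis
  then have "f zeros \<sqsubset> f \<eta>" using MonoBij_lt[OF f bot_C e(1)] by simp
  then show False using e not_lt_bot by simp
qed

lemma MonoBij_top: assumes f: "f \<in> MonoBij" shows "f tops = tops"
proof (rule ccontr)
  have fB: "f \<in> Bij C" using f by (rule MonoBij_Bij)
  define \<eta> where "\<eta> = (iv f) tops"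
  have e: "\<eta> \<in> C" "f \<eta> = tops" using fB Bij_C[OF inv_Bij[OF fB]] by (auto simp: \<eta>_def)
  assume ne: "f tops \<noteq> tops"
  then have "\<eta> \<sqsubset> tops" using e lt_total not_top_lt by metis
  then have "f \<eta> \<sqsubset> f tops" using MonoBij_lt[OF f e(1) top_C] by simp
  then show False using e not_top_lt Bij_C[OF fB top_C] by simp
qed

subsection \<open>Local prefix replacement\<close>

definition acts :: "(nat word \<Rightarrow> nat word) \<Rightarrow> nat list \<Rightarrow> nat list \<Rightarrow> bool" where
  "acts f u v \<longleftrightarrow> (\<forall>\<omega>\<in>C. f (u \<frown> \<omega>) = v \<frown> \<omega>)"

text \<open>The group \<open>F n\<close> described by germs: prefix replacement near every point,
  without codes. Composition and inversion become local arguments, and compactness recovers the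
  codes when they are wanted.\<close>

definition LocF :: "(nat word \<Rightarrow> nat word) set" where
  "LocF = {f \<in> MonoBij. \<forall>\<omega>\<in>C. \<exists>k v. acts f (pre k \<omega>) v}"

lemma actsD: "acts f u v \<Longrightarrow> \<omega> \<in> C \<Longrightarrow> f (u \<frown> \<omega>) = v \<frown> \<omega>"
  by (simp add: acts_def)

lemma acts_W: "f \<in> Bij C \<Longrightarrow> acts f u v \<Longrightarrow> u \<in> W \<Longrightarrow> v \<in> W"
  using Bij_C[of f "u \<frown> zeros"] by (simp add: acts_def)

lemma acts_append: "acts f u v \<Longrightarrow> w \<in> W \<Longrightarrow> acts f (u @ w) (v @ w)"
  unfolding acts_def by (metis conc_C conc_conc)

lemma acts_mult: "f \<in> Bij C \<Longrightarrow> g \<in> Bij C \<Longrightarrow> acts g u v \<Longrightarrow> acts f v w \<Longrightarrow> u \<in> W \<Longrightarrow> acts (f \<star> g) u w"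
  by (simp add: acts_def)

lemma acts_inv: "f \<in> Bij C \<Longrightarrow> acts f u v \<Longrightarrow> u \<in> W \<Longrightarrow> acts (iv f) v u"
  unfolding acts_def using inv_app1[of f "u \<frown> \<omega>" for \<omega>] by (metis conc_C)

text \<open>If one word were a proper extension of the other by \<open>w\<close>, both
  \<open>zeros\<close> and \<open>tops\<close> would be fixed by prepending \<open>w\<close>, so the
  first letter of \<open>w\<close> would be \<open>0\<close> and \<open>m\<close> at once.\<close>

lemma eq_if_all_conc:
  assumes "\<And>\<omega>. \<omega> \<in> C \<Longrightarrow> u \<frown> \<omega> = v \<frown> \<omega>"
  shows "u = v"
proof -
  have aux: "u = v" if le: "length u \<le> length v" and eq: "\<And>\<omega>. \<omega> \<in> C \<Longrightarrow> u \<frown> \<omega> = v \<frown> \<omega>" for u v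
  proof -
    have v: "v = u @ drop (length u) v"
    proof -
      have "pre (length u) (v \<frown> zeros) = u" using eq[OF bot_C] pre_conc_length by metis
      then show ?thesis using pre_conc_le[OF le] by (metis append_take_drop_id)
    qed
    define w where "w = drop (length u) v"
    have e: "\<omega> = w \<frown> \<omega>" if "\<omega> \<in> C" for \<omega>
      using eq[OF that] v unfolding w_def by (metis conc_conc conc_inject)
    have "w = []"
    proof (cases w)
      case (Cons d w')
      have "zeros = w \<frown> zeros" "tops = w \<frown> tops" using e by auto
      then have "d = 0" "d = m" using Cons
        by (metis conc_fst length_Cons nth_Cons_0 zero_less_Suc)+
      then show ?thesis using m_pos by simp
    qed simp
    then show "u = v" using v w_def by simp
  qed
  show ?thesis using aux[of u v] aux[of v u] assms by (metis nat_le_linear)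
qed

lemma acts_unique: "acts f u v \<Longrightarrow> acts f u v' \<Longrightarrow> v = v'"
  by (rule eq_if_all_conc) (simp add: acts_def)

lemma LocF_MonoBij: "f \<in> LocF \<Longrightarrow> f \<in> MonoBij" by (simp add: LocF_def)
lemma LocF_Bij: "f \<in> LocF \<Longrightarrow> f \<in> Bij C" by (simp add: LocF_def MonoBij_def)

lemma acts_prefix_mono: "acts f (pre k \<omega>) v \<Longrightarrow> k \<le> l \<Longrightarrow> \<omega> \<in> C \<Longrightarrow> \<exists>v'. acts f (pre l \<omega>) v'"
  by (metis acts_append pre_W pre_ge suf_C)

lemma LocF_mult: assumes f: "f \<in> LocF" and g: "g \<in> LocF" shows "f \<star> g \<in> LocF"
proof -
  have "\<exists>k v. acts (f \<star> g) (pre k \<omega>) v" if w: "\<omega> \<in> C" for \<omega>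
  proof -
    obtain k v where k: "acts g (pre k \<omega>) v" using g w by (auto simp: LocF_def)
    have gw: "g \<omega> = v \<frown> suf k \<omega>" by (metis actsD k pre_suf suf_C w)
    obtain l v' where l: "acts f (pre l (g \<omega>)) v'" using f Bij_C[OF LocF_Bij[OF g] w]
      by (auto simp: LocF_def)
    \<comment> \<open>The prefix on which \<open>f\<close> acts must contain all of
      \<open>v\<close>, so that it pulls back to a prefix of \<omega> under
      \<open>g\<close>.\<close>
    define l' where "l' = max l (length v)"
    obtain v'' where l': "acts f (pre l' (g \<omega>)) v''"
      using acts_prefix_mono[OF l, of l'] Bij_C[OF LocF_Bij[OF g] w] by (auto simp: l'_def)
    define j where "j = l' - length v"
    have pj: "pre l' (g \<omega>) = v @ pre j (suf k \<omega>)"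
      unfolding gw j_def l'_def using pre_conc_ge[of v _ "l' - length v"] by (simp add: l'_def)
    have e: "pre (k + j) \<omega> = pre k \<omega> @ pre j (suf k \<omega>)"
      by (metis add_diff_cancel_left' le_add1 pre_ge)
    have "acts g (pre (k + j) \<omega>) (pre l' (g \<omega>))"
      unfolding e pj by (rule acts_append[OF k pre_W[OF suf_C[OF w]]])
    then show ?thesis using acts_mult[OF LocF_Bij[OF f] LocF_Bij[OF g] _ l'] pre_W[OF w] by blast
  qed
  then show ?thesis using f g by (simp add: LocF_def MonoBij_mult)
qed

lemma LocF_inv: assumes f: "f \<in> LocF" shows "iv f \<in> LocF"
proof -
  have fB: "f \<in> Bij C" using f by (rule LocF_Bij)
  have "\<exists>k v. acts (iv f) (pre k \<omega>) v" if w: "\<omega> \<in> C" for \<omega>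
  proof -
    define \<eta> where "\<eta> = (iv f) \<omega>"
    have e: "\<eta> \<in> C" "f \<eta> = \<omega>" using w fB Bij_C[OF inv_Bij[OF fB]] by (auto simp: \<eta>_def)
    obtain k v where k: "acts f (pre k \<eta>) v" using f e by (auto simp: LocF_def)
    have "\<omega> = v \<frown> suf k \<eta>" by (metis actsD k pre_suf suf_C e)
    then have "pre (length v) \<omega> = v" by (simp add: pre_conc_length)
    then show ?thesis using acts_inv[OF fB k] e by (metis pre_W)
  qed
  then show ?thesis using f by (simp add: LocF_def MonoBij_inv)
qed

lemma id_LocF: "gone \<in> LocF"
proof -
  have "gone = (\<lambda>x\<in>C. x)" by (simp add: BijGroup_def)
  then show ?thesis
    by (auto simp: LocF_def id_Bij acts_def subsequence_def
      intro!: MonoBij_I exI[of _ "[]"] exI[of _ 0])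
qed

lemma LocF_subgroup: "subgroup LocF G"
  by (rule subgroup.intro) (auto simp: LocF_mult LocF_inv id_LocF LocF_Bij)

lemma one_app [simp]: "\<omega> \<in> C \<Longrightarrow> gone \<omega> = \<omega>"
  by (simp add: BijGroup_def)

text \<open>Compactness as Koenig's lemma: a word below which no depth works has a child with the
  same defect, and an infinite branch of such words is a point at which \<open>f\<close> would not
  be local.\<close>

lemma LocF_uniform:
  assumes f: "f \<in> LocF"
  obtains N where "\<And>u. u \<in> W \<Longrightarrow> N \<le> length u \<Longrightarrow> \<exists>v. acts f u v"
proof -
  define bad where "bad u \<longleftrightarrow> (\<forall>N. \<exists>w\<in>W. N \<le> length w \<and> \<not> (\<exists>v. acts f (u @ w) v))" for u
  have step: "\<exists>d<n. bad (u @ [d])" if b: "bad u" for u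
  proof (rule ccontr)
    assume "\<not> (\<exists>d<n. bad (u @ [d]))"
    then have "\<forall>d. \<exists>N. d < n \<longrightarrow> (\<forall>w\<in>W. N \<le> length w \<longrightarrow> (\<exists>v. acts f (u @ [d] @ w) v))"
      by (simp add: bad_def)
    then obtain N where N: "\<And>d w. d < n \<Longrightarrow> w \<in> W \<Longrightarrow> N d \<le> length w \<Longrightarrow> \<exists>v. acts f (u @ [d] @ w) v"
      by metis
    define M where "M = Suc (Max (N ` {..<n}))"
    obtain w where w: "w \<in> W" "M \<le> length w" "\<not> (\<exists>v. acts f (u @ w) v)"
      using b unfolding bad_def by blast
    obtain d w' where w': "w = d # w'" using w(2) by (cases w) (auto simp: M_def)
    have d: "d < n" "w' \<in> W" using w(1) w' by auto
    have "N d \<le> Max (N ` {..<n})" using d by (intro Max_ge) auto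
    then have "N d \<le> length w'" using w(2) w' by (simp add: M_def)
    then show False using N[OF d] w(3) w' by simp
  qed
  have "\<not> bad []"
  proof
    assume b0: "bad []"
    have "\<exists>U. \<forall>k. (U k \<in> W \<and> bad (U k) \<and> length (U k) = k) \<and> (\<exists>d. U (Suc k) = U k @ [d])"
    proof (rule dependent_nat_choice)
      show "\<exists>x. x \<in> W \<and> bad x \<and> length x = 0" using b0 by auto
      fix x k assume x: "x \<in> W \<and> bad x \<and> length x = k"
      then obtain d where "d < n" "bad (x @ [d])" using step by blast
      then show "\<exists>y. (y \<in> W \<and> bad y \<and> length y = Suc k) \<and> (\<exists>d. y = x @ [d])"
        using x by (intro exI[of _ "x @ [d]"]) auto
    qed
    then obtain U where U: "\<And>k. U k \<in> W" "\<And>k. bad (U k)" "\<And>k. length (U k) = k"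
      "\<And>k. \<exists>d. U (Suc k) = U k @ [d]" by blast
    define \<omega> where "\<omega> k = last (U (Suc k))" for k
    have pU: "pre k \<omega> = U k" for k
    proof (induction k)
      case 0 then show ?case using U(3)[of 0] by (simp add: subsequence_def)
    next
      case (Suc k)
      obtain d where d: "U (Suc k) = U k @ [d]" using U(4) by blast
      have "pre (Suc k) \<omega> = pre k \<omega> @ [\<omega> k]" by (simp add: subsequence_def)
      then show ?case using Suc d by (simp add: \<omega>_def)
    qed
    have "\<omega> k < n" for k
    proof -
      obtain d where d: "U (Suc k) = U k @ [d]" using U(4) by blast
      then show ?thesis using U(1)[of "Suc k"] by (simp add: \<omega>_def)
    qed
    then have "\<omega> \<in> C" by (simp add: cantor_def)
    then obtain k v where k: "acts f (U k) v" using f by (auto simp: LocF_def pU)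
    obtain w where "w \<in> W" "\<not> (\<exists>v. acts f (U k @ w) v)" using U(2)[of k] unfolding bad_def by blast
    then show False using acts_append[OF k] by blast
  qed
  then show thesis using that unfolding bad_def by auto
qed

subsection \<open>Ordered complete prefix codes\<close>

text \<open>Compares whole cylinders rather than words, and thereby already contains the
  incomparability and disjointness expected of a prefix code.\<close>

definition word_less :: "nat list \<Rightarrow> nat list \<Rightarrow> bool" (infix \<open>\<lless>\<close> 50) where
  "u \<lless> v \<longleftrightarrow> (\<forall>\<omega>\<in>C. \<forall>\<eta>\<in>C. u \<frown> \<omega> \<sqsubset> v \<frown> \<eta>)"

definition pcode :: "nat list list \<Rightarrow> bool" where
  "pcode us \<longleftrightarrow> set us \<subseteq> W \<and> sorted_wrt (\<lless>) us \<and> (\<forall>\<omega>\<in>C. \<exists>u\<in>set us. \<exists>\<eta>\<in>C. \<omega> = u \<frown> \<eta>)"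

text \<open>Compare the greatest point of the first cylinder with the least point of the second.
  Past the ends of the words the letters are \<open>m\<close> and \<open>0\<close>, so the first
  difference, which is an increase, lies inside both words.\<close>

lemma word_less_lexord:
  assumes uv: "u \<lless> v" and v: "v \<in> W" shows "(u, v) \<in> lexord less_than"
proof -
  have "u \<frown> tops \<sqsubset> v \<frown> zeros" using uv by (simp add: word_less_def)
  then obtain k where k: "(u \<frown> tops) k < (v \<frown> zeros) k"
    "\<And>j. j < k \<Longrightarrow> (u \<frown> tops) j = (v \<frown> zeros) j" unfolding less_fun_def by blast
  have kv: "k < length v" using k(1) by (cases "k < length v") auto
  have "v ! k \<le> m" using v kv by (auto simp: in_lists_conv_set less_Suc_eq_le)
  then have ku: "k < length u" using k(1) kv by (cases "k < length u") auto
  have "take k u = take k v"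
  proof (rule nth_equalityI)
    show "length (take k u) = length (take k v)" using ku kv by simp
    fix i assume "i < length (take k u)"
    then show "take k u ! i = take k v ! i" using k(2)[of i] ku kv by simp
  qed
  moreover have "u ! k < v ! k" using k(1) ku kv by simp
  ultimately show ?thesis using ku kv by (auto simp: lexord_take_index_conv)
qed

lemma word_less_parallel: "u \<lless> v \<Longrightarrow> u \<in> W \<Longrightarrow> v \<in> W \<Longrightarrow> u \<parallel> v"
proof (rule parallelI)
  assume uv: "u \<lless> v" and W: "u \<in> W" "v \<in> W"
  show "\<not> Sublist.prefix u v"
  proof
    assume "Sublist.prefix u v"
    then obtain z where z: "v = u @ z" by (auto simp: Sublist.prefix_def)
    then have "u \<frown> (z \<frown> zeros) \<sqsubset> v \<frown> zeros" using uv W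
      by (simp only: word_less_def) (simp del: conc_conc)
    then show False using z by (simp add: less_fun_irrefl)
  qed
  show "\<not> Sublist.prefix v u"
  proof
    assume "Sublist.prefix v u"
    then obtain z where z: "u = v @ z" by (auto simp: Sublist.prefix_def)
    then have "u \<frown> zeros \<sqsubset> v \<frown> (z \<frown> zeros)" using uv W
      by (simp only: word_less_def) (simp del: conc_conc)
    then show False using z by (simp add: less_fun_irrefl)
  qed
qed

lemma pcode_nth_W: "pcode us \<Longrightarrow> i < length us \<Longrightarrow> us ! i \<in> W"
  unfolding pcode_def using nth_mem by blast

lemma pcode_Nil: "pcode [[]]"
  by (auto simp: pcode_def)

abbreviation children :: "nat list \<Rightarrow> nat list list" where
  "children w \<equiv> map (\<lambda>d. w @ [d]) [0..<n]"

lemma word_less_append: "u \<lless> v \<Longrightarrow> x \<in> W \<Longrightarrow> y \<in> W \<Longrightarrow> u @ x \<lless> v @ y"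
  unfolding word_less_def by (metis conc_C conc_conc)

lemma pcode_expand:
  assumes "pcode (A @ w # B)" shows "pcode (A @ children w @ B)"
proof -
  have s: "sorted_wrt (\<lless>) (A @ w # B)" and W: "set (A @ w # B) \<subseteq> W"
    and c: "\<And>\<omega>. \<omega> \<in> C \<Longrightarrow> \<exists>u\<in>set (A @ w # B). \<exists>\<eta>\<in>C. \<omega> = u \<frown> \<eta>"
    using assms by (auto simp: pcode_def)
  have ch: "sorted_wrt (\<lless>) (children w)"
    by (auto simp: sorted_wrt_map sorted_wrt_iff_nth_less word_less_def simp del: upt_Suc)
  have A: "a \<lless> w @ [d]" if "a \<in> set A" "d < n" for a d
    using word_less_append[of a w "[]" "[d]"] s that by (auto simp: sorted_wrt_append)
  have B: "w @ [d] \<lless> b" if "b \<in> set B" "d < n" for b d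
    using word_less_append[of w b "[d]" "[]"] s that by (auto simp: sorted_wrt_append)
  have "sorted_wrt (\<lless>) (A @ children w @ B)"
    using s ch A B by (auto simp: sorted_wrt_append simp del: upt_Suc)
  moreover have "set (A @ children w @ B) \<subseteq> W" using W by (auto simp del: upt_Suc)
  moreover have "\<exists>u\<in>set (A @ children w @ B). \<exists>\<eta>\<in>C. \<omega> = u \<frown> \<eta>" if w: "\<omega> \<in> C" for \<omega>
  proof -
    obtain u \<eta> where u: "u \<in> set (A @ w # B)" "\<eta> \<in> C" "\<omega> = u \<frown> \<eta>" using c w by blast
    show ?thesis
    proof (cases "u = w")
      case True
      obtain d \<xi> where d: "d < n" "\<xi> \<in> C" "\<eta> = d ## \<xi>" using C_cases[OF u(2)] by blast
      then have "\<omega> = (w @ [d]) \<frown> \<xi>" using u True by simp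
      moreover have "w @ [d] \<in> set (A @ children w @ B)" using d by (simp del: upt_Suc)
      ultimately show ?thesis using d by blast
    next
      case False
      then have "u \<in> set (A @ children w @ B)" using u by auto
      then show ?thesis using u by blast
    qed
  qed
  ultimately show ?thesis by (simp add: pcode_def del: upt_Suc)
qed

lemma pcode_unique:
  assumes "pcode us" "i < length us" "j < length us" "\<eta> \<in> C" "\<xi> \<in> C" "us ! i \<frown> \<eta> = us ! j \<frown> \<xi>"
  shows "i = j"
proof (rule ccontr)
  assume "i \<noteq> j"
  have s: "sorted_wrt (\<lless>) us" using assms(1) by (simp add: pcode_def)
  from \<open>i \<noteq> j\<close> consider "i < j" | "j < i" by linarith
  then show False
  proof cases
    case 1
    then have "us ! i \<lless> us ! j" using s assms(3) by (simp add: sorted_wrt_nth_less)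
    then show False using assms(4-6) by (metis less_fun_irrefl word_less_def)
  next
    case 2
    then have "us ! j \<lless> us ! i" using s assms(2) by (simp add: sorted_wrt_nth_less)
    then show False using assms(4-6) by (metis less_fun_irrefl word_less_def)
  qed
qed

lemma pcode_index:
  assumes "pcode us" "\<omega> \<in> C"
  obtains i \<eta> where "i < length us" "\<eta> \<in> C" "\<omega> = us ! i \<frown> \<eta>"
  using assms unfolding pcode_def by (metis in_set_conv_nth)

lemma cylinder_iff: "\<omega> \<in> cylinder n u \<longleftrightarrow> (\<exists>\<eta>\<in>C. \<omega> = u \<frown> \<eta>)"
  by (auto simp: cylinder_def)

lemma pcode_complete:
  assumes "pcode us" shows "complete_prefix_code n (set us)"
    and "sorted_wrt (\<lambda>u v. (u, v) \<in> lexord less_than) us"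
proof -
  have W: "set us \<subseteq> W" and s: "sorted_wrt (\<lless>) us" using assms by (auto simp: pcode_def)
  have nth_W: "us ! i \<in> W" if "i < length us" for i using pcode_nth_W[OF assms that] .
  show "sorted_wrt (\<lambda>u v. (u, v) \<in> lexord less_than) us"
    using s by (rule sorted_wrt_mono_rel[rotated]) (use W in \<open>auto intro!: word_less_lexord\<close>)
  have par: "us ! i \<parallel> us ! j" if ij: "i < length us" "j < length us" "i \<noteq> j" for i j
  proof (cases "i < j")
    case True
    then show ?thesis using ij s nth_W by (simp add: sorted_wrt_nth_less word_less_parallel)
  next
    case False
    then show ?thesis using ij s nth_W
      by (metis linorder_neqE_nat parallel_commute sorted_wrt_nth_less word_less_parallel)
  qed
  have pw: "pairwise (\<parallel>) (set us)"
    unfolding pairwise_def using par by (metis in_set_conv_nth)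
  have "partition_on C (cylinder n ` set us)"
  proof (rule partition_onI)
    show "\<Union> (cylinder n ` set us) = C"
    proof
      show "\<Union> (cylinder n ` set us) \<subseteq> C"
      proof (rule subsetI)
        fix \<omega> assume "\<omega> \<in> \<Union> (cylinder n ` set us)"
        then obtain u \<eta> where "u \<in> set us" "\<eta> \<in> C" "\<omega> = u \<frown> \<eta>" by (auto simp: cylinder_iff)
        then show "\<omega> \<in> C" using W conc_C by blast
      qed
      show "C \<subseteq> \<Union> (cylinder n ` set us)"
        using assms by (auto simp: pcode_def cylinder_iff)
    qed
    show "{} \<notin> cylinder n ` set us" by (metis bot_C cylinder_iff empty_iff imageE)
    fix p p' assume p: "p \<in> cylinder n ` set us" and p': "p' \<in> cylinder n ` set us" and ne: "p \<noteq> p'"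
    obtain i where i: "i < length us" "p = cylinder n (us ! i)" using p
      by (metis imageE in_set_conv_nth)
    obtain j where j: "j < length us" "p' = cylinder n (us ! j)" using p'
      by (metis imageE in_set_conv_nth)
    show "disjnt p p'"
      unfolding disjnt_iff
    proof (intro allI notI)
      fix x assume "x \<in> p \<and> x \<in> p'"
      then have "\<exists>\<eta>\<in>C. x = us ! i \<frown> \<eta>" "\<exists>\<eta>\<in>C. x = us ! j \<frown> \<eta>"
        using i(2) j(2) cylinder_iff by auto
      then have "i = j" using pcode_unique[OF assms i(1) j(1)] by metis
      then show False using ne i j by simp
    qed
  qed
  then show "complete_prefix_code n (set us)" using pw W by (simp add: complete_prefix_code_def)
qed

definition code_map :: "nat list list \<Rightarrow> nat list list \<Rightarrow> nat word \<Rightarrow> nat word" where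
  "code_map us vs = (\<lambda>\<omega>\<in>C. let i = SOME i. i < length us \<and> (\<exists>\<eta>\<in>C. \<omega> = us ! i \<frown> \<eta>)
     in vs ! i \<frown> suf (length (us ! i)) \<omega>)"

lemma code_map_app:
  assumes us: "pcode us" and i: "i < length us" and e: "\<eta> \<in> C"
  shows "code_map us vs (us ! i \<frown> \<eta>) = vs ! i \<frown> \<eta>"
proof -
  have "us ! i \<in> W" using us i by (rule pcode_nth_W)
  moreover have "(SOME j. j < length us \<and> (\<exists>\<xi>\<in>C. us ! i \<frown> \<eta> = us ! j \<frown> \<xi>)) = i"
    using pcode_unique[OF us i] i e by (intro some_equality) auto
  ultimately show ?thesis using e by (simp add: code_map_def suf_conc_length)
qed

lemma code_map_LocF:
  assumes us: "pcode us" and vs: "pcode vs" and l: "length us = length vs"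
  shows "code_map us vs \<in> LocF" and "\<And>i. i < length us \<Longrightarrow> acts (code_map us vs) (us ! i) (vs ! i)"
proof -
  show acts: "acts (code_map us vs) (us ! i) (vs ! i)" if "i < length us" for i
    unfolding acts_def using code_map_app[OF us that] by simp
  have W: "i < length us \<Longrightarrow> us ! i \<in> W" "i < length vs \<Longrightarrow> vs ! i \<in> W" for i
    using us vs pcode_nth_W by blast+
  have B: "code_map us vs \<in> Bij C"
  proof (rule BijI[where g = "code_map vs us"])
    show "code_map us vs \<in> extensional C" by (simp add: code_map_def)
    fix \<omega> assume "\<omega> \<in> C"
    from pcode_index[OF us this] obtain i \<eta> where i: "i < length us" "\<eta> \<in> C" "\<omega> = us ! i \<frown> \<eta>" .
    show "code_map us vs \<omega> \<in> C" using i W l by (simp add: code_map_app[OF us])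
    show "code_map vs us (code_map us vs \<omega>) = \<omega>" using i l
      by (simp add: code_map_app[OF us] code_map_app[OF vs])
  next
    fix \<omega> assume "\<omega> \<in> C"
    from pcode_index[OF vs this] obtain i \<eta> where i: "i < length vs" "\<eta> \<in> C" "\<omega> = vs ! i \<frown> \<eta>" .
    show "code_map vs us \<omega> \<in> C" using i W l by (simp add: code_map_app[OF vs])
    show "code_map us vs (code_map vs us \<omega>) = \<omega>" using i l
      by (simp add: code_map_app[OF us] code_map_app[OF vs])
  qed
  have "code_map us vs \<in> MonoBij"
  proof (rule MonoBij_I[OF B])
    fix \<omega> \<eta> assume w: "\<omega> \<in> C" and e: "\<eta> \<in> C" and lt: "\<omega> \<sqsubset> \<eta>"
    from pcode_index[OF us w] obtain i x where i: "i < length us" "x \<in> C" "\<omega> = us ! i \<frown> x" .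
    from pcode_index[OF us e] obtain j y where j: "j < length us" "y \<in> C" "\<eta> = us ! j \<frown> y" .
    consider "i < j" | "i = j" | "j < i" by linarith
    then show "code_map us vs \<omega> \<sqsubset> code_map us vs \<eta>"
    proof cases
      case 1
      then have "vs ! i \<lless> vs ! j" using vs j(1) l by (simp add: pcode_def sorted_wrt_nth_less)
      then show ?thesis using i j by (simp add: code_map_app[OF us] word_less_def)
    next
      case 2
      then show ?thesis using i j lt by (simp add: code_map_app[OF us])
    next
      case 3
      then have "us ! j \<lless> us ! i" using us i(1) l by (simp add: pcode_def sorted_wrt_nth_less)
      then have "\<eta> \<sqsubset> \<omega>" using i j by (simp add: word_less_def)
      then show ?thesis using lt less_fun_asym by blast
    qed
  qed
  moreover have "\<exists>k v. acts (code_map us vs) (pre k \<omega>) v" if w: "\<omega> \<in> C" for \<omega>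
  proof -
    from pcode_index[OF us w] obtain i x where i: "i < length us" "x \<in> C" "\<omega> = us ! i \<frown> x" .
    then have "pre (length (us ! i)) \<omega> = us ! i" by (simp add: pre_conc_length)
    then show ?thesis using acts[OF i(1)] by metis
  qed
  ultimately show "code_map us vs \<in> LocF" by (simp add: LocF_def)
qed

lemma pcode_level: "\<exists>us. pcode us \<and> set us = {u \<in> W. length u = N}"
proof (induction N)
  case 0
  show ?case by (rule exI[of _ "[[]]"]) (auto simp: pcode_Nil)
next
  case (Suc N)
  then obtain us where us: "pcode us" "set us = {u \<in> W. length u = N}" by blast
  have gen: "pcode (A @ B) \<Longrightarrow> pcode (A @ concat (map children B))" for A B
  proof (induction B arbitrary: A)
    case (Cons w B)
    have "pcode ((A @ children w) @ B)" using pcode_expand[OF Cons.prems] by simp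
    from Cons.IH[OF this] show ?case by (simp del: upt_Suc)
  qed simp
  have "pcode (concat (map children us))" using gen[of "[]" us] us(1) by (simp del: upt_Suc)
  moreover have "set (concat (map children us)) = {u \<in> W. length u = Suc N}"
  proof
    show "set (concat (map children us)) \<subseteq> {u \<in> W. length u = Suc N}"
      using us(2) by (auto simp del: upt_Suc)
    show "{u \<in> W. length u = Suc N} \<subseteq> set (concat (map children us))"
    proof
      fix u assume u: "u \<in> {u \<in> W. length u = Suc N}"
      then have "u \<noteq> []" by auto
      then have e: "u = butlast u @ [last u]" by simp
      have "set (butlast u) \<subseteq> {..<n}" "last u < n"
        using u \<open>u \<noteq> []\<close> by (auto simp: in_lists_conv_set dest!: in_set_butlastD)
      then have "butlast u \<in> set us" using us(2) u by (auto simp: in_lists_conv_set)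
      then show "u \<in> set (concat (map children us))"
        using e \<open>last u < n\<close> by (auto simp del: upt_Suc intro!: bexI[of _ "butlast u"])
    qed
  qed
  ultimately show ?case by blast
qed

lemma LocF_code:
  assumes f: "f \<in> LocF"
  obtains us vs where "pcode us" "pcode vs" "length us = length vs"
    "\<And>i. i < length us \<Longrightarrow> acts f (us ! i) (vs ! i)"
proof -
  obtain N where N: "\<And>u. u \<in> W \<Longrightarrow> N \<le> length u \<Longrightarrow> \<exists>v. acts f u v" using LocF_uniform[OF f] by blast
  obtain us where us: "pcode us" "set us = {u \<in> W. length u = N}" using pcode_level by blast
  obtain img where img: "\<And>u. u \<in> W \<Longrightarrow> N \<le> length u \<Longrightarrow> acts f u (img u)" using N by metis
  define vs where "vs = map img us"
  have usW: "u \<in> W" "length u = N" if "u \<in> set us" for u using that us(2) by auto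
  have a: "acts f (us ! i) (vs ! i)" if i: "i < length us" for i
  proof -
    have "us ! i \<in> W" "length (us ! i) = N" using usW[of "us ! i"] i by auto
    then show ?thesis using img[of "us ! i"] i by (simp add: vs_def)
  qed
  have fM: "f \<in> MonoBij" and fB: "f \<in> Bij C" using f by (auto simp: LocF_MonoBij LocF_Bij)
  have "pcode vs"
    unfolding pcode_def
  proof (intro conjI ballI)
    show "set vs \<subseteq> W"
    proof
      fix v assume "v \<in> set vs"
      then obtain i where i: "i < length us" "v = vs ! i" by (auto simp: in_set_conv_nth vs_def)
      then show "v \<in> W" using acts_W[OF fB a] usW(1)[of "us ! i"] by auto
    qed
    show "sorted_wrt (\<lless>) vs"
      unfolding sorted_wrt_iff_nth_less
    proof (intro allI impI)
      fix i j assume ij: "i < j" "j < length vs"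
      then have l: "i < length us" "j < length us" by (auto simp: vs_def)
      have "us ! i \<lless> us ! j" using us(1) ij(1) l by (simp add: pcode_def sorted_wrt_nth_less)
      moreover have "us ! i \<in> W" "us ! j \<in> W" using usW(1) l by auto
      ultimately show "vs ! i \<lless> vs ! j"
        unfolding word_less_def using MonoBij_lt[OF fM] actsD[OF a[OF l(1)]] actsD[OF a[OF l(2)]]
        by (metis conc_C)
    qed
    fix \<omega> assume w: "\<omega> \<in> C"
    define \<eta> where "\<eta> = (iv f) \<omega>"
    have e: "\<eta> \<in> C" "f \<eta> = \<omega>" using Bij_C[OF inv_Bij[OF fB] w] fB w by (auto simp: \<eta>_def)
    from pcode_index[OF us(1) e(1)] obtain i x where i: "i < length us" "x \<in> C" "\<eta> = us ! i \<frown> x" .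
    have "\<omega> = vs ! i \<frown> x" using actsD[OF a[OF i(1)] i(2)] e i by simp
    moreover have "vs ! i \<in> set vs" using i by (simp add: vs_def)
    ultimately show "\<exists>u\<in>set vs. \<exists>\<eta>\<in>C. \<omega> = u \<frown> \<eta>" using i by blast
  qed
  from that[OF us(1) this _ a] show thesis by (simp add: vs_def)
qed

section \<open>Topology, and the identification of \<open>F n\<close> with the local group\<close>

lemma open_prefix_nbhd: "openin (cantor_topology n) {\<omega> \<in> C. \<forall>i<k. \<omega> i = x i}"
proof (induction k)
  case 0
  have "openin (cantor_topology n) (topspace (cantor_topology n))" by blast
  then show ?case by simp
next
  case (Suc k)
  have cm: "continuous_map (cantor_topology n) (discrete_topology {..<n}) (\<lambda>\<omega>. \<omega> k)"
    unfolding cantor_topology_def by (rule continuous_map_product_projection) simp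
  have "openin (discrete_topology {..<n}) ({x k} \<inter> {..<n})" by simp
  from openin_continuous_map_preimage[OF cm this]
  have "openin (cantor_topology n) {\<omega> \<in> C. \<omega> k \<in> {x k} \<inter> {..<n}}" by simp
  moreover have "{\<omega> \<in> C. \<forall>i<Suc k. \<omega> i = x i} = {\<omega> \<in> C. \<forall>i<k. \<omega> i
    = x i} \<inter> {\<omega> \<in> C. \<omega> k \<in> {x k} \<inter> {..<n}}"
    by (auto simp: less_Suc_eq cantor_def)
  ultimately show ?case using openin_Int[OF Suc] by simp
qed

lemma LocF_continuous:
  assumes f: "f \<in> LocF" shows "continuous_map (cantor_topology n) (cantor_topology n) f"
proof -
  have fB: "f \<in> Bij C" using f by (rule LocF_Bij)
  have "continuous_map (cantor_topology n) (discrete_topology {..<n}) (\<lambda>\<omega>. f \<omega> k)" for k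
    unfolding continuous_map_def
  proof (intro conjI allI impI)
    show "(\<lambda>\<omega>. f \<omega> k) \<in> topspace (cantor_topology n) \<rightarrow> topspace (discrete_topology {..<n})"
      using Bij_C[OF fB] by (auto simp: cantor_def)
    fix U assume "openin (discrete_topology {..<n}) U"
    show "openin (cantor_topology n) {x \<in> topspace (cantor_topology n). f x k \<in> U}"
    proof (subst openin_subopen, intro ballI)
      fix x assume x: "x \<in> {x \<in> topspace (cantor_topology n). f x k \<in> U}"
      then have xC: "x \<in> C" by simp
      obtain j v where j: "acts f (pre j x) v" using f xC by (auto simp: LocF_def)
      \<comment> \<open>The first \<open>j\<close> letters fix the replacement; \<open>Suc k\<close>
        more determine output letter \<open>k\<close> even when \<open>v\<close> is empty.\<close>
      let ?T = "{y \<in> C. \<forall>i<j + Suc k. y i = x i}"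
      have same: "f y k = f x k" if y: "y \<in> ?T" for y
      proof -
        have p: "pre j y = pre j x" using y by (auto simp: subsequence_def)
        have "f x = v \<frown> suf j x" using actsD[OF j suf_C[OF xC, of j]] by (metis pre_suf)
        moreover have "f y = v \<frown> suf j y" using actsD[OF j suf_C[of y j]] y p
          by (metis (no_types, lifting) mem_Collect_eq pre_suf)
        ultimately show ?thesis using y by (cases "k < length v") auto
      qed
      have "?T \<subseteq> {x \<in> topspace (cantor_topology n). f x k \<in> U}"
      proof
        fix y assume y: "y \<in> ?T"
        show "y \<in> {x \<in> topspace (cantor_topology n). f x k \<in> U}"
          using same[OF y] x y by simp
      qed
      moreover have "x \<in> ?T" using xC by simp
      ultimately show "\<exists>T. openin (cantor_topology n) T \<and> x \<in> T \<and>
        T \<subseteq> {x \<in> topspace (cantor_topology n). f x k \<in> U}"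
        using open_prefix_nbhd[of "j + Suc k" x] by blast
    qed
  qed
  then show ?thesis
    by (subst (2) cantor_topology_def) (simp add: continuous_map_componentwise_UNIV)
qed

text \<open>A complete code places every point in a cylinder with a prefix replacement. Conversely,
  a uniform depth turns the local replacements into a pair of ordered codes, and locality of the map
  and its inverse gives continuity.\<close>

theorem F_eq_LocF: "F n = LocF"
proof
  show "F n \<subseteq> LocF"
  proof
    fix f assume "f \<in> F n"
    then have "f \<in> Bij C \<and> homeomorphic_map (cantor_topology n) (cantor_topology n) f \<and>
      monotone_on C less_fun less_fun f \<and>
      (\<exists>us vs. length us = length vs \<and>
        sorted_wrt (\<lambda>u v. (u, v) \<in> lexord less_than) us \<and>
        sorted_wrt (\<lambda>u v. (u, v) \<in> lexord less_than) vs \<and>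
        complete_prefix_code n (set us) \<and> complete_prefix_code n (set vs) \<and>
        (\<forall>k < length us. acts f (us ! k) (vs ! k)))"
      unfolding F_def mem_Collect_eq carrier_G acts_def .
    then obtain us vs where fB: "f \<in> Bij C" and mono: "monotone_on C less_fun less_fun f"
      and us: "complete_prefix_code n (set us)"
      and a: "\<And>k. k < length us \<Longrightarrow> acts f (us ! k) (vs ! k)" by metis
    have "\<exists>k v. acts f (pre k \<omega>) v" if w: "\<omega> \<in> C" for \<omega>
    proof -
      have "\<omega> \<in> \<Union> (cylinder n ` set us)"
        using us w unfolding complete_prefix_code_def partition_on_def by blast
      then obtain i \<eta> where i: "i < length us" "\<omega> = us ! i \<frown> \<eta>"
        by (auto simp: cylinder_iff in_set_conv_nth)
      then have "pre (length (us ! i)) \<omega> = us ! i" by (simp add: pre_conc_length)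
      then show ?thesis using a[OF i(1)] by metis
    qed
    then show "f \<in> LocF" using fB mono by (simp add: LocF_def MonoBij_def)
  qed
  show "LocF \<subseteq> F n"
  proof
    fix f assume f: "f \<in> LocF"
    obtain us vs where c: "pcode us" "pcode vs" "length us = length vs"
      "\<And>i. i < length us \<Longrightarrow> acts f (us ! i) (vs ! i)" using LocF_code[OF f] by blast
    have fB: "f \<in> Bij C" using f by (rule LocF_Bij)
    have "homeomorphic_maps (cantor_topology n) (cantor_topology n) f (iv f)"
      unfolding homeomorphic_maps_def
      using LocF_continuous[OF f] LocF_continuous[OF LocF_inv[OF f]] fB by simp
    then have "homeomorphic_map (cantor_topology n) (cantor_topology n) f"
      using homeomorphic_map_maps by blast
    moreover have "monotone_on C less_fun less_fun f" using f by (simp add: LocF_def MonoBij_def)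
    ultimately show "f \<in> F n"
      using fB c(3,4) pcode_complete[OF c(1)] pcode_complete[OF c(2)]
      unfolding F_def mem_Collect_eq acts_def carrier_G
      by (intro conjI exI[of _ us] exI[of _ vs]) simp_all
  qed
qed

section \<open>Transitivity of \<open>F n\<close> on cylinders\<close>

text \<open>The cylinder contains neither the least nor the greatest point. Every element of
  \<open>LocF\<close> fixes these two points, so only inner words can be moved freely.\<close>

definition inner :: "nat list \<Rightarrow> bool" where
  "inner w \<longleftrightarrow> w \<in> W \<and> \<not> set w \<subseteq> {0} \<and> \<not> set w \<subseteq> {m}"

lemma pcode_children_split:
  assumes "pcode (A @ w # B)" "d < n"
  shows "pcode ((A @ map (\<lambda>e. w @ [e]) [0..<d]) @ (w @ [d]) # (map (\<lambda>e. w @ [e]) [Suc d..<n] @ B))"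
proof -
  have "[0..<n] = [0..<d] @ d # [Suc d..<n]"
    using assms(2) upt_add_eq_append[of 0 d "n - d"] upt_conv_Cons[of d n] by (simp del: upt_Suc)
  then show ?thesis using pcode_expand[OF assms(1)] by (simp del: upt_Suc)
qed

text \<open>Appending the letter \<open>d\<close> to a word of a code creates \<open>d\<close>
  siblings on its left and \<open>m - d\<close> on its right, hence the two digit sums.\<close>

lemma pcode_containing:
  "u \<in> W \<Longrightarrow>
    \<exists>A B. pcode (A @ u # B) \<and> length A = sum_list u \<and> length B = sum_list (map (\<lambda>d. m - d) u)"
proof (induction u rule: rev_induct)
  case Nil
  show ?case using pcode_Nil by (intro exI[of _ "[]"]) simp
next
  case (snoc d u)
  then have d: "d < n" and "u \<in> W" by auto
  then obtain A B where AB: "pcode (A @ u # B)" "length A = sum_list u"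
    "length B = sum_list (map (\<lambda>d. m - d) u)" using snoc.IH by blast
  have l: "length [Suc d..<n] = m - d" and l0: "length [0..<d] = d"
    by (simp_all del: upt_Suc)
  show ?case
  proof (intro exI conjI)
    show "pcode ((A @ map (\<lambda>e. u @ [e]) [0..<d]) @ (u @ [d]) # (map (\<lambda>e. u @ [e]) [Suc d..<n] @ B))"
      using pcode_children_split[OF AB(1) d] .
  qed (simp_all add: l l0 AB(2,3) del: upt_Suc length_upt)
qed

lemma pcode_grow_left:
  "pcode (A @ R) \<Longrightarrow> A \<noteq> [] \<Longrightarrow> \<exists>A'. pcode (A' @ R) \<and> length A' = length A + k * m"
proof (induction k)
  case 0 then show ?case by auto
next
  case (Suc k)
  then obtain A' where A': "pcode (A' @ R)" "length A' = length A + k * m" by blast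
  then obtain a A0 where a: "A' = a # A0" using Suc.prems by (cases A') auto
  have "pcode ([] @ children a @ (A0 @ R))" using A'(1) a by (intro pcode_expand) simp
  then show ?case using A'(2) a by (intro exI[of _ "children a @ A0"]) (simp del: upt_Suc)
qed

lemma pcode_grow_right:
  "pcode (L @ B) \<Longrightarrow> B \<noteq> [] \<Longrightarrow> \<exists>B'. pcode (L @ B') \<and> length B' = length B + k * m"
proof (induction k)
  case 0 then show ?case by auto
next
  case (Suc k)
  then obtain B' where B': "pcode (L @ B')" "length B' = length B + k * m" by blast
  then obtain b B0 where b: "B' = b # B0" using Suc.prems by (cases B') auto
  have "pcode (L @ children b @ B0)" using B'(1) b by (intro pcode_expand) simp
  then show ?case using B'(2) b by (intro exI[of _ "children b @ B0"]) (simp del: upt_Suc)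
qed

lemma mod_eq_balance:
  assumes "a mod m = b mod m" obtains k l where "a + k * m = b + l * m"
proof
  show "a + (b div m) * m = b + (a div m) * m"
    using assms by (metis add.assoc add.commute mod_div_mult_eq)
qed

lemma sum_list_compl: "u \<in> W \<Longrightarrow> sum_list u + sum_list (map (\<lambda>d. m - d) u) = length u * m"
  by (induction u) auto

text \<open>Two words correspond under ordered codes as soon as equally many words precede them and
  equally many follow. Each expansion adds \<open>m\<close> words on the chosen side, so congruent
  digit sums can be balanced; innerness makes both sides nonempty, so there is something to
  expand.\<close>

lemma LocF_transitive:
  assumes u: "inner u" and v: "inner v" and s: "sum_list u mod m = sum_list v mod m"
  obtains f where "f \<in> LocF" "acts f u v"
proof -
  have W: "u \<in> W" "v \<in> W" using u v by (auto simp: inner_def)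
  have nz: "sum_list w \<noteq> 0" "sum_list (map (\<lambda>d. m - d) w) \<noteq> 0" if w: "inner w" for w
  proof -
    obtain d where "d \<in> set w" "d \<noteq> 0" using w by (auto simp: inner_def)
    then show "sum_list w \<noteq> 0" by (auto simp: sum_list_eq_0_iff)
    obtain e where "e \<in> set w" "e \<noteq> m" "e < n" using w unfolding inner_def by blast
    then have "m - e \<in> set (map (\<lambda>d. m - d) w)" "m - e \<noteq> 0" by auto
    then show "sum_list (map (\<lambda>d. m - d) w) \<noteq> 0" by (metis sum_list_eq_0_iff)
  qed
  obtain A B where AB: "pcode (A @ u # B)" "length A = sum_list u"
    "length B = sum_list (map (\<lambda>d. m - d) u)" using pcode_containing[OF W(1)] by blast
  obtain A' B' where AB': "pcode (A' @ v # B')" "length A' = sum_list v"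
    "length B' = sum_list (map (\<lambda>d. m - d) v)" using pcode_containing[OF W(2)] by blast
  have ne: "A \<noteq> []" "B \<noteq> []" "A' \<noteq> []" "B' \<noteq> []"
    using AB(2,3) AB'(2,3) nz[OF u] nz[OF v] by (metis list.size(3))+
  obtain k l where kl: "length A + k * m = length A' + l * m"
    using mod_eq_balance[of "length A" "length A'"] s AB(2) AB'(2) by auto
  have e: "length A + length B = length u * m" "length A' + length B' = length v * m"
    using sum_list_compl[OF W(1)] sum_list_compl[OF W(2)] AB AB' by simp_all
  \<comment> \<open>The multiples on the right are forced: each minimal code has
    \<open>length u * m\<close> (respectively \<open>length v * m\<close>) words besides the chosen
    one, and the left sides are already balanced by \<open>k\<close> and \<open>l\<close>.\<close>
  have "length B + (length v + l) * m = length B' + (length u + k) * m"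
    using e kl by (simp add: algebra_simps)
  moreover obtain A1 where A1: "pcode (A1 @ u # B)" "length A1 = length A + k * m"
    using pcode_grow_left[OF AB(1) ne(1)] by blast
  moreover obtain B1 where "pcode ((A1 @ [u]) @ B1)" "length B1 = length B + (length v + l) * m"
    using pcode_grow_right[of "A1 @ [u]" B "length v + l"] A1(1) ne(2) by auto
  moreover obtain A2 where A2: "pcode (A2 @ v # B')" "length A2 = length A' + l * m"
    using pcode_grow_left[OF AB'(1) ne(3)] by blast
  moreover obtain B2 where "pcode ((A2 @ [v]) @ B2)" "length B2 = length B' + (length u + k) * m"
    using pcode_grow_right[of "A2 @ [v]" B' "length u + k"] A2(1) ne(4) by auto
  ultimately have us: "pcode (A1 @ u # B1)" and vs: "pcode (A2 @ v # B2)"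
    and l: "length A1 = length A2" "length B1 = length B2" using kl by simp_all
  have i: "length A1 < length (A1 @ u # B1)" by simp
  have "acts (code_map (A1 @ u # B1) (A2 @ v # B2)) u v"
    using code_map_LocF(2)[OF us vs _ i] l by (metis length_append length_Cons nth_append_length)
  then show thesis using that code_map_LocF(1)[OF us vs] l by simp
qed

lemma pcode_extend_top:
  "pcode (A @ w # B) \<Longrightarrow> \<exists>A'. pcode (A' @ (w @ replicate c m) # B)"
proof (induction c arbitrary: A w)
  case (Suc c)
  have "pcode ((A @ map (\<lambda>e. w @ [e]) [0..<m]) @ (w @ [m]) # B)"
    using pcode_children_split[OF Suc.prems, of m] by simp
  from Suc.IH[OF this] show ?case by simp
qed auto

lemma pcode_extend_bot:
  "pcode (A @ w # B) \<Longrightarrow> \<exists>B'. pcode (A @ (w @ replicate c 0) # B')"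
proof (induction c arbitrary: B w)
  case (Suc c)
  have "pcode (A @ (w @ [0]) # (map (\<lambda>e. w @ [e]) [Suc 0..<n] @ B))"
    using pcode_children_split[OF Suc.prems, of 0] by (simp del: upt_Suc)
  from Suc.IH[OF this] show ?case by simp
qed auto

text \<open>Moves a caret from \<open>e\<close> to its right neighbour \<open>u\<close>: in order,
  \<open>e 0\<close> goes to \<open>e\<close>, the other children of \<open>e\<close> go to
  \<open>u 0\<close> up to \<open>u (m-1)\<close>, and \<open>u\<close> goes to \<open>u m\<close>.
  Thus \<open>u\<close> is squeezed at the expense of \<open>e\<close> alone.\<close>

lemma LocF_shift_right:
  assumes p: "p \<in> W" and d: "d < m"
    and e: "e = p @ [d] @ replicate c m" and u: "u = p @ [Suc d] @ replicate b 0"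
  obtains h where "h \<in> LocF" "acts h u (u @ [m])"
    "\<And>\<omega>. \<omega> \<in> C \<Longrightarrow> \<omega> \<notin> cylinder n e \<Longrightarrow> \<omega> \<notin> cylinder n u \<Longrightarrow> h \<omega> = \<omega>"
proof -
  obtain A B where "pcode (A @ p # B)" using pcode_containing[OF p] by blast
  moreover have "map (\<lambda>e. p @ [e]) [Suc d..<n]
    = (p @ [Suc d]) # map (\<lambda>e. p @ [e]) [Suc (Suc d)..<n]"
    using d by (simp add: upt_conv_Cons del: upt_Suc)
  moreover define A1 where "A1 = A @ map (\<lambda>e. p @ [e]) [0..<d]"
  moreover define B1 where "B1 = map (\<lambda>e. p @ [e]) [Suc (Suc d)..<n] @ B"
  ultimately have 1: "pcode (A1 @ (p @ [d]) # (p @ [Suc d]) # B1)"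
    using pcode_children_split[of A p B d] d by (simp del: upt_Suc)
  from pcode_extend_top[OF this] obtain A2 where
    "pcode (A2 @ e # (p @ [Suc d]) # B1)" using e by auto
  with pcode_extend_bot[of "A2 @ [e]" "p @ [Suc d]" B1 b] obtain B2 where
    2: "pcode (A2 @ e # u # B2)" using u by auto
  have us: "pcode (A2 @ children e @ u # B2)" using pcode_expand[OF 2] .
  have vs: "pcode (A2 @ e # children u @ B2)" using pcode_expand[of "A2 @ [e]" u B2] 2
    by (simp del: upt_Suc)
  let ?us = "A2 @ children e @ u # B2" let ?vs = "A2 @ e # children u @ B2"
  let ?h = "code_map ?us ?vs"
  have l: "length ?us = length ?vs" by simp
  have acts: "acts ?h (?us ! i) (?vs ! i)" if "i < length ?us" for i
    using code_map_LocF(2)[OF us vs l that] .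
  show thesis
  proof
    show "?h \<in> LocF" using code_map_LocF(1)[OF us vs l] .
    have "?us ! (length A2 + n) = u" by (simp add: nth_append del: upt_Suc)
    moreover have "?vs ! (length A2 + n) = u @ [m]" by (simp add: nth_append nth_Cons' del: upt_Suc)
    ultimately show "acts ?h u (u @ [m])" using acts[of "length A2 + n"] by simp
    fix \<omega> assume w: "\<omega> \<in> C" "\<omega> \<notin> cylinder n e" "\<omega> \<notin> cylinder n u"
    from pcode_index[OF us w(1)] obtain i \<eta> where i: "i < length ?us" "\<eta> \<in> C" "\<omega> = ?us ! i \<frown> \<eta>" .
    have h: "?h \<omega> = ?vs ! i \<frown> \<eta>" using actsD[OF acts[OF i(1)] i(2)] i(3) by simp
    consider "i < length A2" | "length A2 \<le> i" "i < length A2 + n" | "i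
      = length A2 + n" | "length A2 + n < i"
      by linarith
    then show "?h \<omega> = \<omega>"
    proof cases
      case 1
      then show ?thesis using h i by (simp add: nth_append)
    next
      case 2
      then have "?us ! i = e @ [i - length A2]" by (auto simp: nth_append simp del: upt_Suc)
      then have "\<omega> = e \<frown> ([i - length A2] \<frown> \<eta>)" using i by simp
      moreover have "[i - length A2] \<frown> \<eta> \<in> C" using i 2 by simp
      ultimately show ?thesis using w(2) by (metis cylinder_iff)
    next
      case 3
      then have "?us ! i = u" by (simp add: nth_append del: upt_Suc)
      then show ?thesis using w(3) i by (metis cylinder_iff)
    next
      case 4
      then have "?us ! i = ?vs ! i" by (auto simp: nth_append nth_Cons' simp del: upt_Suc)
      then show ?thesis using h i by simp
    qed
  qed
qed

subsection \<open>Adjacent points and gluing\<close>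

text \<open>A jump of the order, such as \<open>d mmm...\<close> followed by
  \<open>(d+1) 000...\<close>. Order-preserving bijections carry jumps to jumps even when they are
  not prefix replacements; this is used both for digit sums and for gluing.\<close>

definition adj :: "nat word \<Rightarrow> nat word \<Rightarrow> bool" where
  "adj a b \<longleftrightarrow> a \<in> C \<and> b \<in> C \<and> a \<sqsubset> b \<and> (\<forall>c\<in>C. \<not> (a \<sqsubset> c \<and> c \<sqsubset> b))"

lemma adj_MonoBij:
  assumes f: "f \<in> MonoBij" and ab: "adj a b" shows "adj (f a) (f b)"
proof -
  have fB: "f \<in> Bij C" using f by (rule MonoBij_Bij)
  have C: "a \<in> C" "b \<in> C" using ab by (auto simp: adj_def)
  have "\<not> (f a \<sqsubset> c \<and> f c' \<sqsubset> f b)" if c': "c' \<in> C" "c = f c'" for c c'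
    using ab MonoBij_lt[OF f] C c' unfolding adj_def by metis
  moreover have "\<exists>c'\<in>C. c = f c'" if "c \<in> C" for c
    using inv_app2[OF fB that] Bij_C[OF inv_Bij[OF fB] that] by metis
  ultimately have "\<forall>c\<in>C. \<not> (f a \<sqsubset> c \<and> c \<sqsubset> f b)" by metis
  then show ?thesis
    using ab MonoBij_lt[OF f C] Bij_C[OF fB] C unfolding adj_def by metis
qed

lemma lt_top: "\<omega> \<in> C \<Longrightarrow> \<omega> \<noteq> tops \<Longrightarrow> \<omega> \<sqsubset> tops"
  using lt_total not_top_lt by blast

lemma bot_lt: "\<omega> \<noteq> zeros \<Longrightarrow> zeros \<sqsubset> \<omega>"
  using lt_total not_lt_bot by blast

lemma adj_build: "d < n \<Longrightarrow> adj (d ## a) (d ## b) \<longleftrightarrow> adj a b"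
proof
  assume d: "d < n" and h: "adj (d ## a) (d ## b)"
  have "\<not> (a \<sqsubset> c \<and> c \<sqsubset> b)" if "c \<in> C" for c
    using h d that unfolding adj_def by (metis build_C lt_build)
  then show "adj a b" using h by (auto simp: adj_def)
next
  assume d: "d < n" and h: "adj a b"
  have "\<not> (d ## a \<sqsubset> c \<and> c \<sqsubset> d ## b)" if c: "c \<in> C" for c
  proof -
    obtain e c' where "e < n" "c' \<in> C" "c = e ## c'" using C_cases[OF c] .
    then show ?thesis using h by (auto simp: adj_def)
  qed
  then show "adj (d ## a) (d ## b)" using h d by (auto simp: adj_def)
qed

lemma adj_conc: "u \<in> W \<Longrightarrow> adj (u \<frown> a) (u \<frown> b) \<longleftrightarrow> adj a b"
  by (induction u) (auto simp: adj_build)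

lemma adj_step: "d < m \<Longrightarrow> adj (d ## tops) (Suc d ## zeros)"
proof -
  assume d: "d < m"
  have "\<not> (d ## tops \<sqsubset> c \<and> c \<sqsubset> Suc d ## zeros)" if c: "c \<in> C" for c
  proof -
    obtain e c' where e: "e < n" "c' \<in> C" "c = e ## c'" using C_cases[OF c] .
    then show ?thesis using not_top_lt[OF e(2)] not_lt_bot[of c'] by auto
  qed
  then show ?thesis using d by (auto simp: adj_def)
qed

text \<open>The two ends of a jump have the form \<open>p d mmm...\<close> and
  \<open>p (d+1) 000...\<close>, and the tails contribute nothing modulo \<open>m\<close>.\<close>

lemma adj_sum:
  "Y \<in> W \<Longrightarrow> V \<in> W \<Longrightarrow> adj (Y \<frown> tops) (V \<frown> zeros) \<Longrightarrow> sum_list V mod m = Suc (sum_list Y) mod m"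
proof (induction Y arbitrary: V)
  case Nil
  then show ?case using not_top_lt by (auto simp: adj_def)
next
  case (Cons d Y)
  note a = Cons.prems(3)
  show ?case
  proof (cases V)
    case Nil
    then show ?thesis using a not_lt_bot by (auto simp: adj_def)
  next
    case (Cons e V')
    have dn: "d < n" "e < n" and W: "Y \<in> W" "V' \<in> W" using Cons.prems Cons by auto
    have lt: "d ## (Y \<frown> tops) \<sqsubset> e ## (V' \<frown> zeros)" using a Cons by (simp add: adj_def)
    show ?thesis
    proof (cases "d = e")
      case True
      then have "adj (Y \<frown> tops) (V' \<frown> zeros)" using a Cons adj_build[OF dn(1)] by simp
      from Cons.IH[OF W this] show ?thesis using True Cons
        by (metis (no_types, lifting) add_Suc_right mod_add_right_eq sum_list.Cons)
    next
      case False
      then have de: "d < e" using lt by simp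
      have no: "\<not> (d ## (Y \<frown> tops) \<sqsubset> c \<and> c \<sqsubset> e ## (V' \<frown> zeros))" if "c \<in> C" for c
        using a Cons that by (simp add: adj_def)
      have "Y \<frown> tops = tops"
        using no[of "d ## tops"] dn de lt_top[of "Y \<frown> tops"] W by auto
      moreover have "V' \<frown> zeros = zeros"
        using no[of "e ## zeros"] dn de bot_lt[of "V' \<frown> zeros"] W by auto
      moreover have "e = Suc d"
      proof (rule ccontr)
        assume "e \<noteq> Suc d"
        then show False using no[of "Suc d ## zeros"] dn de by auto
      qed
      ultimately have Y: "set Y \<subseteq> {m}" and V: "set V' \<subseteq> {0}" and e: "e = Suc d"
        using top_conc_iff bot_conc_iff by auto
      have "sum_list Y = length Y * m" using Y by (induction Y) auto
      moreover have "sum_list V = Suc d" unfolding Cons e using V by (induction V') auto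
      ultimately show ?thesis by simp
    qed
  qed
qed

lemma lt_nbhd:
  fixes \<omega> a :: "nat word"
  assumes "\<omega> \<noteq> a"
  obtains k where "\<And>x. pre k x = pre k \<omega> \<Longrightarrow> a \<sqsubset> x \<longleftrightarrow> a \<sqsubset> \<omega>"
proof -
  obtain k where k: "\<omega> k \<noteq> a k" "\<And>j. j < k \<Longrightarrow> \<omega> j = a j"
    using lt_total[OF assms] unfolding less_fun_def by (metis less_irrefl)
  show thesis
  proof
    fix x assume h: "pre (Suc k) x = pre (Suc k) \<omega>"
    have x: "x j = \<omega> j" if "j < Suc k" for j
      using arg_cong[OF h, of "\<lambda>l. l ! j"] that by (simp add: subsequence_def del: upt_Suc)
    have *: "a \<sqsubset> y \<longleftrightarrow> a k < y k" if "\<And>j. j < k \<Longrightarrow> y j = a j" "y k \<noteq> a k" for y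
    proof
      assume "a \<sqsubset> y"
      then obtain l where "a l < y l" "\<And>j. j < l \<Longrightarrow> a j = y j" unfolding less_fun_def by blast
      then show "a k < y k" using that by (metis less_irrefl linorder_neqE_nat)
    qed (use that in \<open>auto simp: less_fun_def\<close>)
    show "a \<sqsubset> x \<longleftrightarrow> a \<sqsubset> \<omega>" using *[of x] *[of \<omega>] k x by simp
  qed
qed

lemma acts_local:
  assumes f: "f \<in> LocF" and w: "\<omega> \<in> C" and eq: "\<And>x. x \<in> C \<Longrightarrow> pre j x = pre j \<omega> \<Longrightarrow> s x = f x"
  shows "\<exists>k v. acts s (pre k \<omega>) v"
proof -
  obtain k v where "acts f (pre k \<omega>) v" using f w by (auto simp: LocF_def)
  then obtain v' where v': "acts f (pre (max j k) \<omega>) v'"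
    using acts_prefix_mono[OF _ _ w] by (meson max.cobounded2)
  have "acts s (pre (max j k) \<omega>) v'"
    unfolding acts_def
  proof
    fix x assume x: "x \<in> C"
    have c: "pre (max j k) \<omega> \<frown> x \<in> C" using x w by simp
    have "pre j (pre (max j k) \<omega> \<frown> x) = pre j \<omega>"
      by (subst pre_conc_le) (auto simp: subsequence_def take_map)
    then show "s (pre (max j k) \<omega> \<frown> x) = v' \<frown> x" using eq[OF c] actsD[OF v' x] by simp
  qed
  then show ?thesis by blast
qed

text \<open>A jump cuts the space into two clopen pieces. Since the images of its ends form a jump
  again, the image of the left piece under \<open>f\<close> and that of the right piece under
  \<open>g\<close> fit together without gap or overlap.\<close>

lemma LocF_glue:
  assumes f: "f \<in> LocF" and g: "g \<in> LocF" and Y: "Y \<in> W" and V: "V \<in> W"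
    and ab: "adj (Y \<frown> tops) (V \<frown> zeros)"
    and fg: "adj (f (Y \<frown> tops)) (g (V \<frown> zeros))"
  obtains s where "s \<in> LocF" "\<And>\<omega>. \<omega> \<in> C \<Longrightarrow> \<not> Y \<frown> tops \<sqsubset> \<omega> \<Longrightarrow> s \<omega> = f \<omega>"
    "\<And>\<omega>. \<omega> \<in> C \<Longrightarrow> \<not> \<omega> \<sqsubset> V \<frown> zeros \<Longrightarrow> s \<omega> = g \<omega>"
proof -
  define a where "a = Y \<frown> tops"
  define b where "b = V \<frown> zeros"
  have abC: "a \<in> C" "b \<in> C" using Y V by (auto simp: a_def b_def)
  have fM: "f \<in> MonoBij" and gM: "g \<in> MonoBij" and fB: "f \<in> Bij C" and gB: "g \<in> Bij C"
    using f g by (auto simp: LocF_MonoBij LocF_Bij)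
  have split: "a \<sqsubset> \<omega> \<longleftrightarrow> \<not> \<omega> \<sqsubset> b" if "\<omega> \<in> C" for \<omega>
    using ab that lt_total less_fun_trans unfolding adj_def a_def[symmetric] b_def[symmetric]
      by metis
  have split': "f a \<sqsubset> \<omega> \<longleftrightarrow> \<not> \<omega> \<sqsubset> g b" if "\<omega> \<in> C" for \<omega>
    using fg that lt_total less_fun_trans unfolding adj_def a_def[symmetric] b_def[symmetric]
      by metis
  define s where "s = (\<lambda>\<omega>\<in>C. if a \<sqsubset> \<omega> then g \<omega> else f \<omega>)"
  define t where "t = (\<lambda>\<omega>\<in>C. if f a \<sqsubset> \<omega> then (iv g) \<omega> else (iv f) \<omega>)"
  have iB: "iv f \<in> Bij C" "iv g \<in> Bij C" using fB gB by auto
  have sg: "f a \<sqsubset> g \<omega>" if "\<omega> \<in> C" "a \<sqsubset> \<omega>" for \<omega>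
    using split'[OF Bij_C[OF gB that(1)]] MonoBij_lt[OF gM that(1) abC(2)]
      split[OF that(1)] that(2) by blast
  have sf: "\<not> f a \<sqsubset> f \<omega>" if "\<omega> \<in> C" "\<not> a \<sqsubset> \<omega>" for \<omega>
    using MonoBij_lt[OF fM abC(1) that(1)] that(2) by blast
  have sB: "s \<in> Bij C"
  proof (rule BijI[where g = t])
    show "s \<in> extensional C" by (simp add: s_def)
    fix \<omega> assume w: "\<omega> \<in> C"
    show "s \<omega> \<in> C" using w Bij_C[OF fB w] Bij_C[OF gB w] by (simp add: s_def)
    show "t \<omega> \<in> C" using w Bij_C[OF iB(1) w] Bij_C[OF iB(2) w] by (simp add: t_def)
    show "t (s \<omega>) = \<omega>" using w Bij_C[OF fB w] Bij_C[OF gB w] sg[OF w] sf[OF w] fB gB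
      by (simp add: s_def t_def)
    show "s (t \<omega>) = \<omega>"
    proof (cases "f a \<sqsubset> \<omega>")
      case True
      define x where "x = (iv g) \<omega>"
      have x: "x \<in> C" "g x = \<omega>" using w gB Bij_C[OF iB(2) w] by (auto simp: x_def)
      have "\<not> x \<sqsubset> b" using True split'[OF w] MonoBij_lt[OF gM x(1) abC(2)] x(2) by simp
      then have "a \<sqsubset> x" using split[OF x(1)] by simp
      then show ?thesis using True w x by (simp add: s_def t_def x_def[symmetric])
    next
      case False
      define x where "x = (iv f) \<omega>"
      have x: "x \<in> C" "f x = \<omega>" using w fB Bij_C[OF iB(1) w] by (auto simp: x_def)
      have "\<not> a \<sqsubset> x" using False MonoBij_lt[OF fM abC(1) x(1)] x(2) by simp
      then show ?thesis using False w x by (simp add: s_def t_def x_def[symmetric])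
    qed
  qed
  have "s \<in> MonoBij"
  proof (rule MonoBij_I[OF sB])
    fix x y assume x: "x \<in> C" and y: "y \<in> C" and xy: "x \<sqsubset> y"
    consider "a \<sqsubset> x" "a \<sqsubset> y" | "\<not> a \<sqsubset> x" "\<not> a \<sqsubset> y" | "\<not> a \<sqsubset> x" "a \<sqsubset> y"
      using xy less_fun_trans by blast
    then show "s x \<sqsubset> s y"
    proof cases
      case 1 then show ?thesis using x y xy MonoBij_lt[OF gM x y] by (simp add: s_def)
    next
      case 2 then show ?thesis using x y xy MonoBij_lt[OF fM x y] by (simp add: s_def)
    next
      case 3
      have "f a \<sqsubset> g y" using sg[OF y 3(2)] .
      moreover have "\<not> f a \<sqsubset> f x" using sf[OF x 3(1)] .
      ultimately have "f x \<sqsubset> g y" using lt_total less_fun_trans by metis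
      then show ?thesis using 3 x y by (simp add: s_def)
    qed
  qed
  moreover have "\<exists>k v. acts s (pre k \<omega>) v" if w: "\<omega> \<in> C" for \<omega>
  proof -
    have "\<exists>j. \<forall>x\<in>C. pre j x = pre j \<omega> \<longrightarrow> (a \<sqsubset> x \<longleftrightarrow> a \<sqsubset> \<omega>)"
    proof (cases "\<omega> = a")
      \<comment> \<open>At the left end itself the prefix \<open>Y\<close> is enough: no point of
        its cylinder lies above \<open>Y mmm...\<close>.\<close>
      case True
      have "\<not> a \<sqsubset> x" if "x \<in> C" "pre (length Y) x = pre (length Y) \<omega>" for x
      proof -
        have "pre (length Y) x = Y" using that(2) True by (simp add: a_def pre_conc_length)
        then have "x = Y \<frown> suf (length Y) x" by (metis pre_suf)
        then show ?thesis unfolding a_def using not_top_lt[OF suf_C[OF that(1)]] lt_conc by metis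
      qed
      then show ?thesis using True less_fun_irrefl by blast
    next
      case False
      show ?thesis by (rule lt_nbhd[OF False]) blast
    qed
    then obtain j where j: "\<And>x. x \<in> C \<Longrightarrow> pre j x = pre j \<omega> \<Longrightarrow> a \<sqsubset> x \<longleftrightarrow> a \<sqsubset> \<omega>" by blast
    have "(if a \<sqsubset> \<omega> then g else f) \<in> LocF" using f g by simp
    then show ?thesis
    proof (rule acts_local[OF _ w])
      fix x assume "x \<in> C" "pre j x = pre j \<omega>"
      then show "s x = (if a \<sqsubset> \<omega> then g else f) x" using j[of x] by (simp add: s_def)
    qed
  qed
  ultimately have "s \<in> LocF" by (simp add: LocF_def)
  moreover have "s \<omega> = f \<omega>" if "\<omega> \<in> C" "\<not> Y \<frown> tops \<sqsubset> \<omega>" for \<omega>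
    using that by (simp add: s_def a_def)
  moreover have "s \<omega> = g \<omega>" if "\<omega> \<in> C" "\<not> \<omega> \<sqsubset> V \<frown> zeros" for \<omega>
    using that split[OF that(1)] by (simp add: s_def b_def)
  ultimately show thesis using that by blast
qed

subsection \<open>The digit sum modulo \<open>m\<close> is invariant\<close>

lemma replicate_W [simp]: "d < n \<Longrightarrow> replicate k d \<in> W"
  by (simp add: in_lists_conv_set)

lemma replicate_top: "replicate k m \<frown> tops = tops"
  by (rule top_conc) auto

lemma replicate_bot: "replicate k 0 \<frown> zeros = zeros"
  by (rule bot_conc) auto

lemma acts_bot: "f \<in> MonoBij \<Longrightarrow> acts f u v \<Longrightarrow> set u \<subseteq> {0} \<Longrightarrow> set v \<subseteq> {0}"
  using MonoBij_bot[of f] actsD[of f u v zeros] bot_conc[of u] bot_conc_iff[of v zeros] by simp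

lemma acts_top: "f \<in> MonoBij \<Longrightarrow> acts f u v \<Longrightarrow> set u \<subseteq> {m} \<Longrightarrow> set v \<subseteq> {m}"
  using MonoBij_top[of f] actsD[of f u v tops] top_conc[of u] top_conc_iff[of v tops] by simp

lemma acts_inner:
  assumes f: "f \<in> MonoBij" and a: "acts f u v" and u: "inner u" shows "inner v"
proof -
  have fB: "f \<in> Bij C" and uW: "u \<in> W" using MonoBij_Bij[OF f] u by (auto simp: inner_def)
  then have vW: "v \<in> W" and a': "acts (iv f) v u" using acts_W[OF _ a] acts_inv[OF _ a] by auto
  then show ?thesis
    using acts_bot[OF MonoBij_inv[OF f] a'] acts_top[OF MonoBij_inv[OF f] a'] u
      by (auto simp: inner_def)
qed

text \<open>Applying \<open>adj_sum\<close> to the source and to the image of a jump shows that the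
  change of digit sum is the same for neighbouring words of equal length. It is therefore constant
  on a level, and it vanishes on the word of zeros because \<open>zeros\<close> is fixed.\<close>

lemma acts_sum:
  assumes f: "f \<in> LocF" and u: "u \<in> W" and uv: "acts f u v"
  shows "sum_list v mod m = sum_list u mod m"
proof -
  have fM: "f \<in> MonoBij" and fB: "f \<in> Bij C" using f by (auto simp: LocF_MonoBij LocF_Bij)
  obtain N where N: "\<And>u. u \<in> W \<Longrightarrow> N \<le> length u \<Longrightarrow> \<exists>v. acts f u v" using LocF_uniform[OF f] by blast
  then obtain im where im: "\<And>u. u \<in> W \<Longrightarrow> N \<le> length u \<Longrightarrow> acts f u (im u)" by metis
  define c where "c w = (int (sum_list (im w)) - int (sum_list w)) mod int m" for w
  have im_app: "im (w @ z) = im w @ z" if "w \<in> W" "z \<in> W" "N \<le> length w" for w z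
    using acts_unique[OF im acts_append[OF im]] that by simp
  have c_app: "c (w @ z) = c w" if "w \<in> W" "z \<in> W" "N \<le> length w" for w z
    using im_app[OF that] by (simp add: c_def)
  have c_adj: "c (p @ [d] @ replicate k m) = c (p @ [Suc d] @ replicate k 0)"
    if p: "p \<in> W" "d < m" "N \<le> length p + Suc k" for p d k
  proof -
    let ?Y = "p @ [d] @ replicate k m" and ?V = "p @ [Suc d] @ replicate k 0"
    have W: "?Y \<in> W" "?V \<in> W" using p by auto
    have l: "N \<le> length ?Y" "N \<le> length ?V" using p by auto
    have "?Y \<frown> tops = p \<frown> (d ## tops)"
      by (simp add: replicate_top del: conc_conc flip: conc_conc)
    moreover have "?V \<frown> zeros = p \<frown> (Suc d ## zeros)"
      by (simp add: replicate_bot del: conc_conc flip: conc_conc)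
    ultimately have YV: "adj (?Y \<frown> tops) (?V \<frown> zeros)"
      using adj_conc[OF p(1)] adj_step[OF p(2)] by metis
    have "adj (im ?Y \<frown> tops) (im ?V \<frown> zeros)"
      using adj_MonoBij[OF fM YV] actsD[OF im[OF W(1) l(1)] top_C] actsD[OF im[OF W(2) l(2)] bot_C]
        by metis
    then have s1: "sum_list (im ?V) mod m = Suc (sum_list (im ?Y)) mod m"
      using adj_sum acts_W[OF fB im] W l by blast
    have s2: "sum_list ?V mod m = Suc (sum_list ?Y) mod m"
      using adj_sum[OF W YV] .
    have "int (sum_list (im ?V)) mod int m = (int (sum_list (im ?Y)) + 1) mod int m"
      using arg_cong[OF s1, of int] by (simp add: zmod_int add.commute)
    moreover have "int (sum_list ?V) mod int m = (int (sum_list ?Y) + 1) mod int m"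
      using arg_cong[OF s2, of int] by (simp add: zmod_int add.commute)
    ultimately have "c ?V = ((int (sum_list (im ?Y)) + 1) - (int (sum_list ?Y) + 1)) mod int m"
      unfolding c_def by (rule mod_diff_cong)
    then show ?thesis unfolding c_def by simp
  qed
  \<comment> \<open>Induction on the remaining depth; the blocks below \<open>p d\<close> and
    \<open>p (d+1)\<close> are linked through the last word of the one and the first word of the
    other.\<close>
  have const: "\<exists>r. \<forall>w\<in>W. length w = k \<longrightarrow> c (p @ w) = r"
    if "p \<in> W" "N \<le> length p + k" for p k
    using that
  proof (induction k arbitrary: p)
    case 0 then show ?case by auto
  next
    case (Suc k)
    note outer = Suc.prems
    have "\<exists>r. \<forall>w\<in>W. length w = k \<longrightarrow> c ((p @ [d]) @ w) = r" if "d < n" for d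
      using Suc.IH[of "p @ [d]"] Suc.prems that by auto
    then obtain r where r: "\<And>d w. d < n \<Longrightarrow> w \<in> W \<Longrightarrow> length w = k \<Longrightarrow> c (p @ [d] @ w) = r d"
      by (metis append.assoc)
    have "r d = r 0" if "d < n" for d
      using that
    proof (induction d)
      case (Suc d)
      have "r d = c (p @ [d] @ replicate k m)" using r[of d "replicate k m"] Suc.prems by auto
      also have "\<dots> = c (p @ [Suc d] @ replicate k 0)" using c_adj[of p d k] Suc.prems outer by simp
      also have "\<dots> = r (Suc d)" using r[of "Suc d" "replicate k 0"] Suc.prems by auto
      finally show ?case using Suc by simp
    qed simp
    note r0 = this
    have "c (p @ w) = r 0" if w: "w \<in> W" "length w = Suc k" for w
    proof -
      obtain d w' where d: "w = d # w'" using w(2) by (cases w) auto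
      then have "d < n" "w' \<in> W" "length w' = k" using w by auto
      then show ?thesis using r[of d w'] r0[of d] d by simp
    qed
    then show ?case by blast
  qed
  obtain r where r: "\<And>w. w \<in> W \<Longrightarrow> length w = N \<Longrightarrow> c w = r" using const[of "[]" N] by auto
  let ?z = "replicate N (0::nat)"
  have "set ?z \<subseteq> {0}" by auto
  then have "set (im ?z) \<subseteq> {0}" by (rule acts_bot[OF fM im, rotated 2]) auto
  then have s0: "sum_list (im ?z) = 0" unfolding sum_list_eq_0_iff by blast
  have "c ?z = r" by (rule r) simp_all
  then have r0: "r = 0" unfolding c_def s0 by (simp add: sum_list_replicate)
  have zW: "?z \<in> W" by auto
  \<comment> \<open>The word \<open>u\<close> may be shorter than \<open>N\<close>; padding by zeros
    reaches the depth where \<open>im\<close> is meaningful and leaves all digit sums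
    unchanged.\<close>
  have "c (u @ ?z) = c (take N (u @ ?z))"
    using c_app[of "take N (u @ ?z)" "drop N (u @ ?z)"] u zW
    by (metis append_in_lists_conv append_take_drop_id le_add2 length_append length_replicate length_take min.absorb2 order_refl)
  also have "\<dots> = 0" using r[of "take N (u @ ?z)"] r0 u zW
    by (metis append_in_lists_conv append_take_drop_id le_add2 length_append length_replicate length_take min.absorb2)
  finally have "c (u @ ?z) = 0" .
  moreover have "im (u @ ?z) = v @ ?z"
    using acts_unique[OF im acts_append[OF uv zW]] u zW by simp
  ultimately have "(int (sum_list v) - int (sum_list u)) mod int m = 0" by (simp add: c_def)
  then have "int m dvd int (sum_list v) - int (sum_list u)" by (simp add: dvd_eq_mod_eq_0)
  then have "int (sum_list v) mod int m = int (sum_list u) mod int m" by (simp add: mod_eq_dvd_iff)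
  then show ?thesis by (metis of_nat_eq_iff of_nat_mod)
qed

subsection \<open>Copies of a bijection inside a cylinder\<close>

definition cone_map :: "nat list \<Rightarrow> (nat word \<Rightarrow> nat word) \<Rightarrow> nat word \<Rightarrow> nat word" where
  "cone_map u g = (\<lambda>\<omega>\<in>C. if \<omega> \<in> cylinder n u then u \<frown> g (suf (length u) \<omega>) else \<omega>)"

lemma cyl_conc [simp]: "u \<frown> \<omega> \<in> cylinder n u \<longleftrightarrow> \<omega> \<in> C"
  by (auto simp: cylinder_iff)

lemma cone_map_in [simp]: "u \<in> W \<Longrightarrow> \<omega> \<in> C \<Longrightarrow> cone_map u g (u \<frown> \<omega>) = u \<frown> g \<omega>"
  by (simp add: cone_map_def suf_conc_length)

lemma cone_map_out: "\<omega> \<in> C \<Longrightarrow> \<omega> \<notin> cylinder n u \<Longrightarrow> cone_map u g \<omega> = \<omega>"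
  by (simp add: cone_map_def)

lemma cyl_cases:
  assumes "u \<in> W" "\<omega> \<in> C"
  obtains \<eta> where "\<eta> \<in> C" "\<omega> = u \<frown> \<eta>" | "\<omega> \<notin> cylinder n u"
  using cylinder_iff by blast

lemma cone_map_eqI:
  assumes "f \<in> extensional C" "u \<in> W" "\<And>\<eta>. \<eta> \<in> C \<Longrightarrow> f (u \<frown> \<eta>) = u \<frown> g \<eta>"
    "\<And>\<omega>. \<omega> \<in> C \<Longrightarrow> \<omega> \<notin> cylinder n u \<Longrightarrow> f \<omega> = \<omega>"
  shows "f = cone_map u g"
proof (rule extensionalityI[OF assms(1)])
  show "cone_map u g \<in> extensional C" by (simp add: cone_map_def)
  fix \<omega> assume "\<omega> \<in> C"
  with assms(2) show "f \<omega> = cone_map u g \<omega>"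
    by (rule cyl_cases) (auto simp: assms cone_map_out \<open>\<omega> \<in> C\<close>)
qed

lemma cone_map_Bij:
  assumes u: "u \<in> W" and g: "g \<in> Bij C" shows "cone_map u g \<in> Bij C"
proof (rule BijI[where g = "cone_map u (iv g)"])
  show "cone_map u g \<in> extensional C" by (simp add: cone_map_def)
  fix \<omega> assume w: "\<omega> \<in> C"
  note C = Bij_C[OF g] Bij_C[OF inv_Bij[OF g]]
  from u w consider \<eta> where "\<eta> \<in> C" "\<omega> = u \<frown> \<eta>" | "\<omega> \<notin> cylinder n u" by (rule cyl_cases)
  then have "cone_map u g \<omega> \<in> C \<and> cone_map u (iv g) \<omega> \<in> C \<and>
    cone_map u (iv g) (cone_map u g \<omega>) = \<omega> \<and> cone_map u g (cone_map u (iv g) \<omega>) = \<omega>"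
    by cases (use u w g C in \<open>auto simp: cone_map_out\<close>)
  then show "cone_map u g \<omega> \<in> C" "cone_map u (iv g) \<omega> \<in> C"
    "cone_map u (iv g) (cone_map u g \<omega>) = \<omega>" "cone_map u g (cone_map u (iv g) \<omega>) = \<omega>" by blast+
qed

lemma cone_map_mult: "u \<in> W \<Longrightarrow> f \<in> Bij C \<Longrightarrow> g \<in> Bij C \<Longrightarrow>
  cone_map u (f \<star> g) = cone_map u f \<star> cone_map u g"
  by (rule cone_map_eqI[symmetric], rule Bij_imp_extensional[OF mult_Bij])
    (simp_all add: cone_map_Bij cone_map_out Bij_C)

lemma cone_map_one: "u \<in> W \<Longrightarrow> cone_map u gone = gone"
  by (rule cone_map_eqI[symmetric]) (auto simp: BijGroup_def)

lemma cone_map_inv: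
  assumes "u \<in> W" "g \<in> Bij C" shows "cone_map u (iv g) = iv (cone_map u g)"
proof -
  have "cone_map u (iv g) \<star> cone_map u g = gone"
    using cone_map_mult[OF assms(1) inv_Bij[OF assms(2)] assms(2)] cone_map_one[OF assms(1)] assms
    by (simp add: group.l_inv[OF group_G])
  then show ?thesis
    using group.inv_equality[OF group_G] cone_map_Bij assms by simp
qed

lemma cone_map_append:
  assumes "u \<in> W" "w \<in> W" "g \<in> Bij C" shows "cone_map (u @ w) g = cone_map u (cone_map w g)"
proof (rule cone_map_eqI)
  show "cone_map (u @ w) g \<in> extensional C" by (simp add: cone_map_def)
  show "u \<in> W" by fact
  fix \<eta> assume e: "\<eta> \<in> C"
  from assms(2) e show "cone_map (u @ w) g (u \<frown> \<eta>) = u \<frown> cone_map w g \<eta>"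
  proof (rule cyl_cases)
    fix \<xi> assume "\<xi> \<in> C" "\<eta> = w \<frown> \<xi>"
    then show ?thesis using assms cone_map_in[of "u @ w" \<xi> g] by simp
  next
    assume "\<eta> \<notin> cylinder n w"
    moreover have "u \<frown> \<eta> \<notin> cylinder n (u @ w)"
    proof
      assume "u \<frown> \<eta> \<in> cylinder n (u @ w)"
      then obtain \<xi> where "\<xi> \<in> C" "u \<frown> \<eta> = u \<frown> (w \<frown> \<xi>)" by (auto simp: cylinder_iff)
      then show False using \<open>\<eta> \<notin> cylinder n w\<close> by (metis conc_inject cylinder_iff)
    qed
    ultimately show ?thesis using assms e by (simp add: cone_map_out)
  qed
next
  fix \<omega> assume "\<omega> \<in> C" "\<omega> \<notin> cylinder n u"
  moreover have "\<omega> \<notin> cylinder n (u @ w)"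
  proof
    assume "\<omega> \<in> cylinder n (u @ w)"
    then obtain \<xi> where "\<xi> \<in> C" "\<omega> = u \<frown> (w \<frown> \<xi>)" by (auto simp: cylinder_iff)
    then show False using \<open>\<omega> \<notin> cylinder n u\<close> assms by (metis conc_C cylinder_iff)
  qed
  ultimately show "cone_map (u @ w) g \<omega> = \<omega>" by (simp add: cone_map_out)
qed

text \<open>The first difference between a point outside the cylinder and a point inside lies within
  \<open>u\<close>, so it is the same for all inside points.\<close>

lemma cyl_convex:
  assumes "u \<in> W" "\<omega> \<in> C" "\<omega> \<notin> cylinder n u" "\<eta> \<in> C" "\<xi> \<in> C"
  shows "u \<frown> \<eta> \<sqsubset> \<omega> \<longleftrightarrow> u \<frown> \<xi> \<sqsubset> \<omega>"
proof -
  have "u \<frown> \<xi> \<sqsubset> \<omega>" if h: "u \<frown> \<eta> \<sqsubset> \<omega>" "\<eta> \<in> C" "\<xi> \<in> C" for \<eta> \<xi>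
  proof -
    obtain k where k: "(u \<frown> \<eta>) k < \<omega> k" "\<And>j. j < k \<Longrightarrow> (u \<frown> \<eta>) j = \<omega> j"
      using h(1) unfolding less_fun_def by blast
    have "k < length u"
    proof (rule ccontr)
      assume nk: "\<not> k < length u"
      have "pre (length u) \<omega> = u"
        by (rule nth_equalityI) (use k(2) nk in \<open>auto simp: subsequence_def simp flip: k(2)\<close>)
      then have "\<omega> = u \<frown> suf (length u) \<omega>" by (metis pre_suf)
      then show False using assms(2,3) suf_C cylinder_iff by blast
    qed
    moreover have "(u \<frown> \<xi>) j = (u \<frown> \<eta>) j" if "j < length u" for j using that by simp
    ultimately have "(u \<frown> \<xi>) k < \<omega> k" "\<And>j. j < k \<Longrightarrow> (u \<frown> \<xi>) j = \<omega> j"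
      using k less_trans by metis+
    then show ?thesis unfolding less_fun_def by blast
  qed
  then show ?thesis using assms by blast
qed

lemma cone_map_MonoBij:
  assumes u: "u \<in> W" and g: "g \<in> MonoBij" shows "cone_map u g \<in> MonoBij"
proof (rule MonoBij_I)
  have gB: "g \<in> Bij C" using g by (rule MonoBij_Bij)
  show "cone_map u g \<in> Bij C" using cone_map_Bij[OF u gB] .
  fix \<omega> \<eta> assume w: "\<omega> \<in> C" and e: "\<eta> \<in> C" and lt: "\<omega> \<sqsubset> \<eta>"
  from u w consider (a) x where "x \<in> C" "\<omega> = u \<frown> x" | (b) "\<omega> \<notin> cylinder n u" by (rule cyl_cases)
  then show "cone_map u g \<omega> \<sqsubset> cone_map u g \<eta>"
  proof cases
    case a
    from u e consider (c) y where "y \<in> C" "\<eta> = u \<frown> y" | (d) "\<eta> \<notin> cylinder n u" by (rule cyl_cases)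
    then show ?thesis
    proof cases
      case c
      then show ?thesis using a u lt MonoBij_lt[OF g a(1) c(1)] by simp
    next
      case d
      then show ?thesis using a u e lt cyl_convex[OF u e d a(1) Bij_C[OF gB a(1)]]
        by (simp add: cone_map_out)
    qed
  next
    case b
    from u e consider (c) y where "y \<in> C" "\<eta> = u \<frown> y" | (d) "\<eta> \<notin> cylinder n u" by (rule cyl_cases)
    then show ?thesis
    proof cases
      case c
      have "u \<frown> g y \<noteq> \<omega>" using b Bij_C[OF gB c(1)] by auto
      moreover have "\<not> u \<frown> g y \<sqsubset> \<omega>"
        using cyl_convex[OF u w b c(1) Bij_C[OF gB c(1)]] c lt less_fun_asym by blast
      ultimately have "\<omega> \<sqsubset> u \<frown> g y" using lt_total by blast
      then show ?thesis using b c u w by (simp add: cone_map_out)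
    next
      case d
      then show ?thesis using b w e lt by (simp add: cone_map_out)
    qed
  qed
qed

lemma cone_map_LocF:
  assumes u: "u \<in> W" and g: "g \<in> LocF" shows "cone_map u g \<in> LocF"
proof -
  have "\<exists>k v. acts (cone_map u g) (pre k \<omega>) v" if w: "\<omega> \<in> C" for \<omega>
    using u w
  proof (rule cyl_cases)
    fix x assume x: "x \<in> C" "\<omega> = u \<frown> x"
    obtain k v where k: "acts g (pre k x) v" using g x by (auto simp: LocF_def)
    have "acts (cone_map u g) (u @ pre k x) (u @ v)"
      unfolding acts_def
    proof
      fix y assume y: "y \<in> C"
      have "cone_map u g (u \<frown> (pre k x \<frown> y)) = u \<frown> g (pre k x \<frown> y)"
        by (rule cone_map_in[OF u]) (simp add: x y)
      then show "cone_map u g ((u @ pre k x) \<frown> y) = (u @ v) \<frown> y" using actsD[OF k y] by simp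
    qed
    moreover have "u @ pre k x = pre (length u + k) \<omega>" using x by (simp add: pre_conc_ge)
    ultimately show ?thesis by metis
  next
    assume o: "\<omega> \<notin> cylinder n u"
    have "acts (cone_map u g) (pre (length u) \<omega>) (pre (length u) \<omega>)"
      unfolding acts_def
    proof
      fix y assume y: "y \<in> C"
      have "pre (length u) \<omega> \<noteq> u" using o w by (metis cyl_conc pre_suf suf_C)
      then have "pre (length u) \<omega> \<frown> y \<notin> cylinder n u"
        by (metis conc_eq_iff cylinder_iff length_pre)
      then show "cone_map u g (pre (length u) \<omega> \<frown> y) = pre (length u) \<omega> \<frown> y" using w y
        by (simp add: cone_map_out)
    qed
    then show ?thesis by blast
  qed
  then show ?thesis using cone_map_MonoBij[OF u LocF_MonoBij[OF g]] by (simp add: LocF_def)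
qed

text \<open>Applied in two ways: to \<zeta>, which maps the cylinder of \<open>hat u\<close> to that
  of \<open>u\<close> through the map of a state, and to prefix replacements, where \<open>Z\<close>
  is the identity.\<close>

lemma cone_map_conj:
  assumes z: "z \<in> Bij C" and Z: "Z \<in> Bij C" and a: "a \<in> W" and b: "b \<in> W" and Y: "Y \<in> Bij C"
    and zab: "\<And>\<eta>. \<eta> \<in> C \<Longrightarrow> z (b \<frown> \<eta>) = a \<frown> Z \<eta>"
  shows "z \<star> cone_map b Y \<star> iv z = cone_map a (Z \<star> Y \<star> iv Z)"
proof (rule cone_map_eqI)
  note C = Bij_C[OF Y] Bij_C[OF Z] Bij_C[OF inv_Bij[OF Z]] Bij_C[OF z] Bij_C[OF inv_Bij[OF z]]
    Bij_C[OF cone_map_Bij[OF b Y]]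
  show "z \<star> cone_map b Y \<star> iv z \<in> extensional C"
    using z Y b by (intro Bij_imp_extensional) (simp add: cone_map_Bij)
  show "a \<in> W" by fact
  {
    fix \<eta> assume e: "\<eta> \<in> C"
    define \<xi> where "\<xi> = (iv Z) \<eta>"
    have x: "\<xi> \<in> C" "\<eta> = Z \<xi>" using e C Z by (auto simp: \<xi>_def)
    have "(iv z) (a \<frown> \<eta>) = b \<frown> \<xi>" using inv_app1[OF z, of "b \<frown> \<xi>"] zab[OF x(1)] x b by simp
    then show "(z \<star> cone_map b Y \<star> iv z) (a \<frown> \<eta>) = a \<frown> (Z \<star> Y \<star> iv Z) \<eta>"
      using a b e x z Y Z C zab by (simp add: cone_map_Bij \<xi>_def[symmetric])
  }
  fix \<omega> assume w: "\<omega> \<in> C" "\<omega> \<notin> cylinder n a"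
  have "(iv z) \<omega> \<notin> cylinder n b"
  proof
    assume "(iv z) \<omega> \<in> cylinder n b"
    then obtain \<xi> where "\<xi> \<in> C" "(iv z) \<omega> = b \<frown> \<xi>" by (auto simp: cylinder_iff)
    then have "\<omega> = a \<frown> Z \<xi>" using zab inv_app2[OF z w(1)] by metis
    then show False using w(2) C \<open>\<xi> \<in> C\<close> by auto
  qed
  then show "(z \<star> cone_map b Y \<star> iv z) \<omega> = \<omega>"
    using w z Y b C by (simp add: cone_map_Bij cone_map_out)
qed

lemma cone_map_conj_acts:
  assumes z: "z \<in> Bij C" and a: "a \<in> W" and b: "b \<in> W" and Y: "Y \<in> Bij C" and "acts z b a"
  shows "z \<star> cone_map b Y \<star> iv z = cone_map a Y"
proof -
  interpret group G by (rule group_G)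
  have "gone \<in> Bij C" using one_closed by simp
  from cone_map_conj[OF z this a b Y] show ?thesis using assms Y by (simp add: acts_def)
qed

section \<open>The transducer and its inverse\<close>

abbreviation "T \<equiv> T_zeta n"
abbreviation "T' \<equiv> T_inv n"
abbreviation "rt \<equiv> routing m"
abbreviation "E \<equiv> inf_output T"
abbreviation "E' \<equiv> inf_output T'"

lemma progressive_T: "progressive T"
  unfolding progressive_def
proof (intro allI impI)
  fix s d e assume "fst (T s d) = []"
  then show "fst (T (snd (T s d)) e) \<noteq> []"
    by (cases s) (auto simp: Let_def split: if_splits)
qed

lemma progressive_T': "progressive T'"
  unfolding progressive_def
proof (intro allI impI)
  fix s d e assume "fst (T' s d) = []"
  then show "fst (T' (snd (T' s d)) e) \<noteq> []"
    by (cases s) (auto split: if_splits)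
qed

lemmas E_conc = inf_output_conc[OF progressive_T]
lemmas E'_conc = inf_output_conc[OF progressive_T']

lemma rt_m [simp]: "rt m = St_R"
  by (simp add: routing_def)

lemma T_simps [simp]:
  "T St_L 0 = ([0], St_L)" "\<lbrakk>0 < d; d \<le> m\<rbrakk> \<Longrightarrow> T St_L d = ([d], rt d)"
  "T St_R 0 = ([0], St_A)" "\<lbrakk>0 < d; d \<le> m\<rbrakk> \<Longrightarrow> T St_R d = ([d], rt d)"
  "T St_A 0 = ([0, 0], St_A)" "\<lbrakk>0 < d; d < m\<rbrakk> \<Longrightarrow> T St_A d = ([0, d], rt d)"
  "T St_A m = ([], St_B)"
  "T St_B 0 = ([0, m], St_A)" "\<lbrakk>0 < d; d \<le> m\<rbrakk> \<Longrightarrow> T St_B d = ([d], rt d)"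
  "T (St_O s) d = ([d], rt (s + d))"
  using m_pos by (auto simp: Let_def)

declare T_zeta.simps [simp del]

lemma T'_simps [simp]:
  "T' St_L 0 = ([0], St_L)" "0 < d \<Longrightarrow> T' St_L d = ([d], rt d)"
  "T' St_R 0 = ([0], St_A)" "0 < d \<Longrightarrow> T' St_R d = ([d], rt d)"
  "T' St_A 0 = ([], St_B)" "0 < d \<Longrightarrow> T' St_A d = ([m, d], rt d)"
  "T' St_B 0 = ([0], St_A)" "\<lbrakk>0 < d; d < m\<rbrakk> \<Longrightarrow> T' St_B d = ([d], rt d)"
  "T' St_B m = ([m, 0], St_A)"
  "T' (St_O s) d = ([d], rt (s + d))"
  using m_pos by auto

declare T_inv.simps [simp del]

lemma E_build [simp]:
  "E St_L (0 ## \<omega>) = 0 ## E St_L \<omega>" "\<lbrakk>0 < d; d \<le> m\<rbrakk> \<Longrightarrow> E St_L (d ## \<omega>) = d ## E (rt d) \<omega>"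
  "E St_R (0 ## \<omega>) = 0 ## E St_A \<omega>" "\<lbrakk>0 < d; d \<le> m\<rbrakk> \<Longrightarrow> E St_R (d ## \<omega>) = d ## E (rt d) \<omega>"
  "E St_A (0 ## \<omega>) = 0 ## 0 ## E St_A \<omega>" "\<lbrakk>0 < d; d < m\<rbrakk> \<Longrightarrow> E St_A (d ## \<omega>) = 0 ## d ## E (rt d) \<omega>"
  "E St_A (m ## \<omega>) = E St_B \<omega>"
  "E St_B (0 ## \<omega>) = 0 ## m ## E St_A \<omega>" "\<lbrakk>0 < d; d \<le> m\<rbrakk> \<Longrightarrow> E St_B (d ## \<omega>) = d ## E (rt d) \<omega>"
  "E (St_O s) (d ## \<omega>) = d ## E (rt (s + d)) \<omega>"
  by (simp_all add: inf_output_build[OF progressive_T])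

lemma E'_build [simp]:
  "E' St_L (0 ## \<omega>) = 0 ## E' St_L \<omega>" "0 < d \<Longrightarrow> E' St_L (d ## \<omega>) = d ## E' (rt d) \<omega>"
  "E' St_R (0 ## \<omega>) = 0 ## E' St_A \<omega>" "0 < d \<Longrightarrow> E' St_R (d ## \<omega>) = d ## E' (rt d) \<omega>"
  "E' St_A (0 ## \<omega>) = E' St_B \<omega>" "0 < d \<Longrightarrow> E' St_A (d ## \<omega>) = m ## d ## E' (rt d) \<omega>"
  "E' St_B (0 ## \<omega>) = 0 ## E' St_A \<omega>" "\<lbrakk>0 < d; d < m\<rbrakk> \<Longrightarrow> E' St_B (d ## \<omega>) = d ## E' (rt d) \<omega>"
  "E' St_B (m ## \<omega>) = m ## 0 ## E' St_A \<omega>"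
  "E' (St_O s) (d ## \<omega>) = d ## E' (rt (s + d)) \<omega>"
  by (simp_all add: inf_output_build[OF progressive_T'])

lemma T_letters: "d < n \<Longrightarrow> set (fst (T s d)) \<subseteq> {..<n}"
  and T'_letters: "d < n \<Longrightarrow> set (fst (T' s d)) \<subseteq> {..<n}"
  by (cases s; auto simp: T_zeta.simps T_inv.simps Let_def)+

lemma out_word_W:
  assumes "\<And>s d. d < n \<Longrightarrow> set (fst (M s d)) \<subseteq> {..<n}" "u \<in> W"
  shows "out_word M s u \<in> W"
  using assms(2) by (induction u arbitrary: s) (auto
    simp: in_lists_conv_set dest: subsetD[OF assms(1)])

lemma out_W: "u \<in> W \<Longrightarrow> out_word T s u \<in> W"
  and out'_W: "u \<in> W \<Longrightarrow> out_word T' s u \<in> W"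
  by (rule out_word_W; simp add: T_letters T'_letters)+

lemma inf_output_C:
  assumes M: "progressive M" and letters: "\<And>s d. d < n \<Longrightarrow> set (fst (M s d)) \<subseteq> {..<n}" and w: "\<omega> \<in> C"
  shows "inf_output M s \<omega> \<in> C"
  unfolding cantor_def
proof (intro CollectI allI)
  fix j
  let ?u = "map \<omega> [0..<2 * Suc j]"
  have "?u \<in> W" using w by (auto simp: cantor_def in_lists_conv_set)
  then have "out_word M s ?u \<in> W" by (rule out_word_W[rotated]) (rule letters)
  moreover have j: "j < length (out_word M s ?u)"
    using progressive_length[OF M, of "Suc j" ?u s] by simp
  ultimately have "out_word M s ?u ! j < n" by (meson in_lists_conv_set lessThan_iff nth_mem)
  then show "inf_output M s \<omega> j < n" using inf_output_nth[OF j] by simp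
qed

lemma E_C: "\<omega> \<in> C \<Longrightarrow> E s \<omega> \<in> C" and E'_C: "\<omega> \<in> C \<Longrightarrow> E' s \<omega> \<in> C"
  by (rule inf_output_C; simp add: progressive_T progressive_T' T_letters T'_letters)+

text \<open>The state \<^const>\<open>St_B\<close> is excluded: neither its map for \<^const>\<open>T_zeta\<close> nor the one for
  \<^const>\<open>T_inv\<close> is onto.\<close>

definition onto_state :: "state \<Rightarrow> bool" where
  "onto_state s \<longleftrightarrow> s \<in> {St_L, St_R, St_A} \<or> (\<exists>k. 0 < k \<and> k < m \<and> s = St_O k)"

lemma onto_simps [simp]: "onto_state St_L" "onto_state St_R" "onto_state St_A" "\<not> onto_state St_B"
  by (auto simp: onto_state_def)

lemma rt_cases: obtains "k mod m = 0" "rt k = St_R" | "0 < k mod m" "k mod m < m" "rt k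
  = St_O (k mod m)"
  using m_pos by (cases "k mod m = 0") (auto simp: routing_def)

lemma onto_rt [simp]: "onto_state (rt k)"
  by (rule rt_cases[of k]) (auto simp: onto_state_def)

lemma letter_cases:
  assumes "d < n" obtains "d = 0" | "0 < d" "d < m" | "d = m"
  using assms by linarith

lemma E_E':
  assumes s: "onto_state s" and w: "\<omega> \<in> C" shows "E s (E' s \<omega>) = \<omega>"
proof (rule word_coinduct[where P = "\<lambda>\<alpha> \<beta>. \<exists>s \<omega>. onto_state s \<and> \<omega> \<in> C \<and> \<alpha> = E s (E' s \<omega>) \<and> \<beta> = \<omega>"])
  show "\<exists>s' \<omega>'. onto_state s' \<and> \<omega>' \<in> C \<and> E s (E' s \<omega>) = E s' (E' s' \<omega>') \<and> \<omega> = \<omega>'"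
    using s w by blast
  let ?Q = "\<lambda>s \<omega>. \<exists>w s' \<omega>'. w \<noteq> [] \<and> onto_state s' \<and> \<omega>' \<in> C \<and> E s (E' s \<omega>) = w \<frown> E s' (E' s' \<omega>') \<and>
    \<omega> = w \<frown> \<omega>'"
  fix \<alpha> \<beta> :: "nat word"
  assume "\<exists>s \<omega>. onto_state s \<and> \<omega> \<in> C \<and> \<alpha> = E s (E' s \<omega>) \<and> \<beta> = \<omega>"
  then obtain s where s: "onto_state s" "\<beta> \<in> C" "\<alpha> = E s (E' s \<beta>)" by blast
  obtain d \<eta> where d: "d < n" "\<eta> \<in> C" "\<beta> = d ## \<eta>" using C_cases[OF s(2)] .
  have QI: "?Q s \<beta>"
    if "w \<noteq> []" "onto_state s'" "\<omega>' \<in> C" "E s (E' s \<beta>) = w \<frown> E s' (E' s' \<omega>')" "\<beta> = w \<frown> \<omega>'"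
    for w s' \<omega>' using that by blast
  consider "s = St_L" | "s = St_R" | "s = St_A" | k where "s = St_O k" using s(1)
    by (auto simp: onto_state_def)
  then have "?Q s \<beta>"
  proof cases
    case 1
    show ?thesis
    proof (cases "d = 0")
      case True then show ?thesis using d 1 by (intro QI[of "[0]" St_L \<eta>]) auto
    next
      case False then show ?thesis using d 1 by (intro QI[of "[d]" "rt d" \<eta>]) auto
    qed
  next
    case 2
    show ?thesis
    proof (cases "d = 0")
      case True then show ?thesis using d 2 by (intro QI[of "[0]" St_A \<eta>]) auto
    next
      case False then show ?thesis using d 2 by (intro QI[of "[d]" "rt d" \<eta>]) auto
    qed
  next
    case 3
    show ?thesis
    proof (cases "d = 0")
      case True
      \<comment> \<open>The inverse transducer is silent here and enters \<open>St_B\<close>, which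
        is not an onto state; a second letter is read to return to the relation.\<close>
      obtain e \<xi> where e: "e < n" "\<xi> \<in> C" "\<eta> = e ## \<xi>" using C_cases[OF d(2)] .
      from e(1) show ?thesis
      proof (cases rule: letter_cases)
        case 1 then show ?thesis using d e True 3 by (intro QI[of "[0, 0]" St_A \<xi>]) auto
      next
        case 2 then show ?thesis using d e True 3 by (intro QI[of "[0, e]" "rt e" \<xi>]) auto
      next
        case m: 3 then show ?thesis using d e True 3 by (intro QI[of "[0, m]" St_A \<xi>]) auto
      qed
    next
      case False then show ?thesis using d 3 by (intro QI[of "[d]" "rt d" \<eta>]) auto
    qed
  next
    case (4 k)
    then show ?thesis using d by (intro QI[of "[d]" "rt (k + d)" \<eta>]) auto
  qed
  then show "\<exists>w \<alpha>' \<beta>'. w \<noteq> [] \<and> \<alpha> = w \<frown> \<alpha>' \<and> \<beta> = w \<frown> \<beta>' \<and>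
      (\<exists>s \<omega>. onto_state s \<and> \<omega> \<in> C \<and> \<alpha>' = E s (E' s \<omega>) \<and> \<beta>' = \<omega>)"
    using s(3) by metis
qed

subsection \<open>The basic generator\<close>

text \<open>The leaves \<open>00, ..., 0m, 1, ..., m\<close> go in order to
  \<open>0, ..., m-1, m0, ..., mm\<close>. For \<open>m = 1\<close> this is a standard generator of
  Thompson's group.\<close>

definition X :: "nat word \<Rightarrow> nat word" where
  "X = (\<lambda>\<omega>\<in>C. if \<omega> 0 = 0 then (if \<omega> 1 = m then m ## 0 ## suf 2 \<omega> else suf 1 \<omega>) else m ## \<omega>)"

definition Xi :: "nat word \<Rightarrow> nat word" where
  "Xi = (\<lambda>\<omega>\<in>C. if \<omega> 0 = m then (if \<omega> 1 = 0 then 0 ## m ## suf 2 \<omega> else suf 1 \<omega>) else 0 ## \<omega>)"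

lemma suf_build [simp]: "suf (Suc k) (d ## \<omega>) = suf k \<omega>" "suf 2 (d ## e ## \<omega>) = \<omega>"
  by (auto simp: fun_eq_iff Omega_Words_Fun.suffix_def numeral_2_eq_2)

lemma X_simps [simp]:
  "\<omega> \<in> C \<Longrightarrow> d < m \<Longrightarrow> X (0 ## d ## \<omega>) = d ## \<omega>"
  "\<omega> \<in> C \<Longrightarrow> X (0 ## m ## \<omega>) = m ## 0 ## \<omega>"
  "\<omega> \<in> C \<Longrightarrow> 0 < d \<Longrightarrow> d \<le> m \<Longrightarrow> X (d ## \<omega>) = m ## d ## \<omega>"
  by (auto simp: X_def)

lemma Xi_simps [simp]:
  "\<omega> \<in> C \<Longrightarrow> d < m \<Longrightarrow> Xi (d ## \<omega>) = 0 ## d ## \<omega>"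
  "\<omega> \<in> C \<Longrightarrow> Xi (m ## 0 ## \<omega>) = 0 ## m ## \<omega>"
  "\<omega> \<in> C \<Longrightarrow> 0 < d \<Longrightarrow> d \<le> m \<Longrightarrow> Xi (m ## d ## \<omega>) = d ## \<omega>"
  using m_pos by (auto simp: Xi_def)

lemma X_cases:
  assumes "\<omega> \<in> C"
  obtains d \<eta> where "d < m" "\<eta> \<in> C" "\<omega> = 0 ## d ## \<eta>" | \<eta> where "\<eta> \<in> C" "\<omega> = 0 ## m ## \<eta>"
    | d \<eta> where "0 < d" "d \<le> m" "\<eta> \<in> C" "\<omega> = d ## \<eta>"
proof -
  obtain d \<eta> where d: "d < n" "\<eta> \<in> C" "\<omega> = d ## \<eta>" using C_cases[OF assms] .
  obtain e \<xi> where e: "e < n" "\<xi> \<in> C" "\<eta> = e ## \<xi>" using C_cases[OF d(2)] .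
  show thesis
  proof (cases "d = 0")
    case True
    then show thesis using that(1)[of e \<xi>] that(2)[of \<xi>] d e by (cases "e = m") auto
  next
    case False
    then show thesis using that(3)[of d \<eta>] d by auto
  qed
qed

lemma Xi_cases:
  assumes "\<omega> \<in> C"
  obtains d \<eta> where "d < m" "\<eta> \<in> C" "\<omega> = d ## \<eta>" | \<eta> where "\<eta> \<in> C" "\<omega> = m ## 0 ## \<eta>"
    | d \<eta> where "0 < d" "d \<le> m" "\<eta> \<in> C" "\<omega> = m ## d ## \<eta>"
proof -
  obtain d \<eta> where d: "d < n" "\<eta> \<in> C" "\<omega> = d ## \<eta>" using C_cases[OF assms] .
  obtain e \<xi> where e: "e < n" "\<xi> \<in> C" "\<eta> = e ## \<xi>" using C_cases[OF d(2)] .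
  show thesis
  proof (cases "d = m")
    case True
    then show thesis using that(3)[of e \<xi>] that(2)[of \<xi>] d e by (cases "e = 0") auto
  next
    case False
    then show thesis using that(1)[of d \<eta>] d by auto
  qed
qed

lemma Xi_X: "\<omega> \<in> C \<Longrightarrow> Xi (X \<omega>) = \<omega> \<and> X \<omega> \<in> C"
  by (erule X_cases) auto

lemma X_Xi: "\<omega> \<in> C \<Longrightarrow> X (Xi \<omega>) = \<omega> \<and> Xi \<omega> \<in> C"
  by (erule Xi_cases) auto

lemma X_Bij: "X \<in> Bij C"
  by (rule BijI[where g = Xi]) (auto simp: X_Xi Xi_X, simp add: X_def)

lemma inv_X: "iv X = Xi"
proof (rule Bij_eqI)
  show "iv X \<in> Bij C" using X_Bij by simp
  show "Xi \<in> Bij C" by (rule BijI[where g = X]) (auto simp: X_Xi Xi_X, simp add: Xi_def)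
  fix \<omega> assume "\<omega> \<in> C"
  then show "(iv X) \<omega> = Xi \<omega>" using inv_app1[OF X_Bij, of "Xi \<omega>"] by (simp add: X_Xi)
qed

lemma Xi_Bij: "Xi \<in> Bij C"
  using inv_Bij[OF X_Bij] inv_X by simp

lemma X_MonoBij: "X \<in> MonoBij"
proof (rule MonoBij_I[OF X_Bij])
  fix \<omega> \<eta> assume w: "\<omega> \<in> C" and e: "\<eta> \<in> C" and lt: "\<omega> \<sqsubset> \<eta>"
  from w show "X \<omega> \<sqsubset> X \<eta>"
  proof (cases rule: X_cases)
    case (1 d x)
    from e show ?thesis by (cases rule: X_cases) (use 1 lt in auto)
  next
    case (2 x)
    from e show ?thesis by (cases rule: X_cases) (use 2 lt in auto)
  next
    case (3 d x)
    from e show ?thesis by (cases rule: X_cases) (use 3 lt in auto)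
  qed
qed

lemma Xi_MonoBij: "Xi \<in> MonoBij"
  using MonoBij_inv[OF X_MonoBij] inv_X by simp

text \<open>Unfolding at most two letters suffices: by then both sides have written the same word
  and continue with the same state.\<close>

lemma E_A: "\<omega> \<in> C \<Longrightarrow> E St_A \<omega> = Xi (E St_R \<omega>)"
proof (erule C_cases)
  fix d \<eta> assume d: "d < n" "\<eta> \<in> C" "\<omega> = d ## \<eta>"
  from d(1) show ?thesis
  proof (cases rule: letter_cases)
    case 3
    obtain e \<xi> where e: "e < n" "\<xi> \<in> C" "\<eta> = e ## \<xi>" using C_cases[OF d(2)] .
    then show ?thesis using d 3 m_pos by (cases "e = 0") (auto simp: E_C)
  qed (use d m_pos in \<open>auto simp: E_C\<close>)
qed

text \<open>Induction on the position of the first difference. \<open>St_A\<close> stays outside the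
  induction because of its delay and is reduced to \<open>St_R\<close> by \<open>E_A\<close>, as
  \<open>Xi\<close> is monotone.\<close>

lemma E_mono:
  assumes s: "onto_state s" and h: "\<omega> \<in> C" "\<eta> \<in> C" "\<omega> \<sqsubset> \<eta>"
  shows "E s \<omega> \<sqsubset> E s \<eta>"
proof -
  have *: "onto_state s \<Longrightarrow> s \<noteq> St_A \<Longrightarrow> E s \<omega> \<sqsubset> E s \<eta>"
    if "\<omega> \<in> C" "\<eta> \<in> C" "\<omega> k < \<eta> k" "\<forall>j<k. \<omega> j = \<eta> j" for s \<omega> \<eta> k
    using that
  proof (induction k arbitrary: s \<omega> \<eta>)
    case 0
    obtain d x where d: "d < n" "x \<in> C" "\<omega> = d ## x" using C_cases[OF 0(3)] .
    obtain e y where e: "e < n" "y \<in> C" "\<eta> = e ## y" using C_cases[OF 0(4)] .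
    have "d < e" using 0 d e by simp
    moreover have "s = St_L \<or> s = St_R \<or> (\<exists>k. s = St_O k)" using 0 by (auto simp: onto_state_def)
    ultimately show ?case using d e by (cases "d = 0") auto
  next
    case (Suc k)
    obtain d x where d: "d < n" "x \<in> C" "\<omega> = d ## x" using C_cases[OF Suc.prems(3)] .
    obtain e y where e: "e < n" "y \<in> C" "\<eta> = e ## y" using C_cases[OF Suc.prems(4)] .
    have de: "d = e" using Suc.prems(6) d e by auto
    have "x k < y k" using Suc.prems d e by simp
    moreover have "x j = y j" if "j < k" for j
      using Suc.prems(6)[rule_format, of "Suc j"] that d e by simp
    ultimately have IH: "onto_state s' \<Longrightarrow> s' \<noteq> St_A \<Longrightarrow> E s' x \<sqsubset> E s' y" for s'
      using Suc.IH[of s' x y] d e by blast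
    have A: "E St_A x \<sqsubset> E St_A y"
      using IH[of St_R] MonoBij_lt[OF Xi_MonoBij E_C E_C] d e by (simp add: E_A)
    have rt: "E (rt k) x \<sqsubset> E (rt k) y" for k
      by (rule IH[OF onto_rt]) (simp add: routing_def)
    have "s = St_L \<or> s = St_R \<or> (\<exists>k. s = St_O k)" using Suc.prems by (auto simp: onto_state_def)
    then show ?case using d e de A rt IH[of St_L] by (cases "d = 0") auto
  qed
  obtain k where k: "\<omega> k < \<eta> k" "\<forall>j<k. \<omega> j = \<eta> j" using h(3) unfolding less_fun_def by blast
  show ?thesis
  proof (cases "s = St_A")
    case True
    have "E St_R \<omega> \<sqsubset> E St_R \<eta>" using *[OF h(1,2) k] by simp
    then show ?thesis using True MonoBij_lt[OF Xi_MonoBij E_C E_C] h by (simp add: E_A)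
  qed (use *[OF h(1,2) k] s in blast)
qed

text \<open>No second bisimulation: \<open>E_E'\<close> provides a right inverse, and monotonicity
  makes \<open>E s\<close> injective.\<close>

lemma E'_E: "onto_state s \<Longrightarrow> \<omega> \<in> C \<Longrightarrow> E' s (E s \<omega>) = \<omega>"
  using E_mono[of s] E_E'[of s "E s \<omega>"] E_C[of \<omega> s] E'_C[of "E s \<omega>" s] lt_total less_fun_irrefl
    by metis

definition Er :: "state \<Rightarrow> nat word \<Rightarrow> nat word" where
  "Er s = restrict (E s) C"

lemma Er_app [simp]: "\<omega> \<in> C \<Longrightarrow> Er s \<omega> = E s \<omega>"
  by (simp add: Er_def)

lemma zeta_Er: "zeta n = Er St_L"
  by (simp add: zeta_def Er_def)

lemma Er_Bij: "onto_state s \<Longrightarrow> Er s \<in> Bij C"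
  by (rule BijI[where g = "E' s"]) (auto simp: Er_def E_C E'_C E'_E E_E')

lemma inv_Er: "onto_state s \<Longrightarrow> \<omega> \<in> C \<Longrightarrow> (iv (Er s)) \<omega> = E' s \<omega>"
  using inv_app1[OF Er_Bij, of s "E' s \<omega>"] by (simp add: E'_C E_E')

lemma Er_MonoBij: "onto_state s \<Longrightarrow> Er s \<in> MonoBij"
  by (rule MonoBij_I) (simp_all add: Er_Bij E_mono)

subsection \<open>States and images of finite words\<close>

abbreviation "Z \<equiv> zeta n"
abbreviation "state_of \<equiv> run T' St_L"
abbreviation "hat \<equiv> out_word T' St_L"

lemma Z_MonoBij: "Z \<in> MonoBij" by (simp add: zeta_Er Er_MonoBij)
lemma Z_Bij: "Z \<in> Bij C" using Z_MonoBij by (rule MonoBij_Bij)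
lemma Z_app: "\<omega> \<in> C \<Longrightarrow> Z \<omega> = E St_L \<omega>" by (simp add: zeta_Er)
lemma inv_Z: "\<omega> \<in> C \<Longrightarrow> (iv Z) \<omega> = E' St_L \<omega>" by (simp add: zeta_Er inv_Er)

text \<open>For \<open>s = St_L\<close> this gives \<open>hat\<close> and \<open>state_of\<close>
  their meaning: \<zeta> maps the cylinder of \<open>hat u\<close> onto that of \<open>u\<close> and
  acts on tails by the map of the state of \<open>u\<close>.\<close>

lemma E_out':
  assumes "onto_state s" "onto_state (run T' s u)" "u \<in> W" "\<omega> \<in> C"
  shows "E s (out_word T' s u \<frown> \<omega>) = u \<frown> E (run T' s u) \<omega>"
proof -
  have "E' s (u \<frown> E (run T' s u) \<omega>) = out_word T' s u \<frown> \<omega>"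
    using assms by (simp add: E'_conc E'_E)
  then show ?thesis using E_E'[OF assms(1), of "u \<frown> E (run T' s u) \<omega>"] assms by (simp add: E_C)
qed

text \<open>The invariant common to both transducers, with \<open>c\<close> the digit sum read so
  far: a routing state records its residue modulo \<open>m\<close>, every other state means residue
  0.\<close>

definition state_class :: "state \<Rightarrow> nat \<Rightarrow> bool" where
  "state_class s c \<longleftrightarrow> (case s of St_O k \<Rightarrow> 0 < k \<and> k < m \<and> c mod m = k | _ \<Rightarrow> c mod m = 0)"

lemma state_class_simps [simp]:
  "state_class St_L c \<longleftrightarrow> m dvd c" "state_class St_R c \<longleftrightarrow> m dvd c" "state_class St_A c \<longleftrightarrow>
    m dvd c" "state_class St_B c \<longleftrightarrow> m dvd c"
  "state_class (St_O k) c \<longleftrightarrow> 0 < k \<and> k < m \<and> c mod m = k"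
  by (auto simp: state_class_def)

lemma state_class_rt: "c mod m = d mod m \<Longrightarrow> state_class (rt d) c"
  by (rule rt_cases[of d]) auto

lemma state_class_onto: "state_class s c \<Longrightarrow> s \<noteq> St_B \<Longrightarrow> onto_state s"
  by (cases s) (auto simp: onto_state_def)

lemma mod_add0: "m dvd c \<Longrightarrow> (c + d) mod m = d mod m"
  by (metis add_0 dvd_imp_mod_0 mod_add_left_eq)

lemma state_class_step_T:
  assumes "state_class s c" "d < n" shows "state_class (snd (T s d)) (c + d)"
  using assms(2)
  by (cases s; cases rule: letter_cases[of d])
    (use assms(1) m_pos in \<open>auto simp: mod_add0 mod_simps intro!: state_class_rt\<close>)

lemma state_class_step_T':
  assumes "state_class s c" "d < n" shows "state_class (snd (T' s d)) (c + d)"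
  using assms(2)
  by (cases s; cases rule: letter_cases[of d])
    (use assms(1) m_pos in \<open>auto simp: mod_add0 mod_simps intro!: state_class_rt\<close>)

lemma state_class_T: "state_class s c \<Longrightarrow> u \<in> W \<Longrightarrow> state_class (run T s u) (c + sum_list u)"
  by (induction u arbitrary: s c) (auto simp: add.assoc[symmetric] intro: state_class_step_T)

lemma state_class_T': "state_class s c \<Longrightarrow> u \<in> W \<Longrightarrow> state_class (run T' s u) (c + sum_list u)"
  by (induction u arbitrary: s c) (auto simp: add.assoc[symmetric] intro: state_class_step_T')

lemma state_class_state_of: "u \<in> W \<Longrightarrow> state_class (state_of u) (sum_list u)"
  using state_class_T'[of St_L 0 u] by simp

lemma rt_not [simp]: "rt k \<noteq> St_L" "rt k \<noteq> St_A" "rt k \<noteq> St_B"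
  by (auto simp: routing_def)

lemma step_not_L: "s \<noteq> St_L \<Longrightarrow> d < n \<Longrightarrow> snd (T s d) \<noteq> St_L" "s \<noteq> St_L \<Longrightarrow> d < n \<Longrightarrow> snd (T' s d) \<noteq> St_L"
  by (cases s; cases rule: letter_cases[of d]; use m_pos in auto)+

lemma run_not_L: "s \<noteq> St_L \<Longrightarrow> u \<in> W \<Longrightarrow> run T s u \<noteq> St_L" "s \<noteq> St_L \<Longrightarrow> u \<in> W \<Longrightarrow> run T' s u \<noteq> St_L"
  by (induction u arbitrary: s) (auto simp: step_not_L)

lemma run_L: "u \<in> W \<Longrightarrow> run T St_L u = St_L \<longleftrightarrow> set u \<subseteq> {0}"
proof (induction u)
  case (Cons d u)
  show ?case
  proof (cases "d = 0")
    case True then show ?thesis using Cons by simp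
  next
    case False then show ?thesis using Cons run_not_L(1)[of "rt d" u] by auto
  qed
qed simp

lemma run'_L: "u \<in> W \<Longrightarrow> state_of u = St_L \<longleftrightarrow> set u \<subseteq> {0}"
proof (induction u)
  case (Cons d u)
  show ?case
  proof (cases "d = 0")
    case True then show ?thesis using Cons by simp
  next
    case False then show ?thesis using Cons run_not_L(2)[of "rt d" u] by auto
  qed
qed simp

text \<open>Both transducers satisfy the hypothesis, since the letters that they add, swallow or
  delay are only \<open>0\<close> and \<open>m\<close>.\<close>

lemma out_word_sum:
  assumes "\<And>s d. d < n \<Longrightarrow> sum_list (fst (M s d)) mod m = d mod m" "u \<in> W"
  shows "sum_list (out_word M s u) mod m = sum_list u mod m"
  using assms(2)
proof (induction u arbitrary: s)
  case (Cons d u)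
  then have "(sum_list (fst (M s d)) + sum_list (out_word M (snd (M s d)) u)) mod m
    = (d + sum_list u) mod m"
    using assms(1) by (intro mod_add_cong) auto
  then show ?case by simp
qed simp

lemma T_sum: "d < n \<Longrightarrow> sum_list (fst (T s d)) mod m = d mod m"
  and T'_sum: "d < n \<Longrightarrow> sum_list (fst (T' s d)) mod m = d mod m"
  by (cases s; cases rule: letter_cases[of d]; use m_pos in auto)+

lemma sum_out: "u \<in> W \<Longrightarrow> sum_list (out_word T s u) mod m = sum_list u mod m"
  and sum_out': "u \<in> W \<Longrightarrow> sum_list (out_word T' s u) mod m = sum_list u mod m"
  by (rule out_word_sum; simp add: T_sum T'_sum)+

lemma inner_out':
  assumes s: "onto_state s" "onto_state (run T' s u)" and u: "inner u"
  shows "inner (out_word T' s u)"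
proof -
  have W: "u \<in> W" using u by (simp add: inner_def)
  have E0: "E s' zeros = zeros" "E s' tops = tops" if "onto_state s'" for s'
    using MonoBij_bot[OF Er_MonoBij[OF that]] MonoBij_top[OF Er_MonoBij[OF that]] by simp_all
  have "\<not> set (out_word T' s u) \<subseteq> {0}"
  proof
    assume "set (out_word T' s u) \<subseteq> {0}"
    then have "u \<frown> E (run T' s u) zeros = zeros"
      using E_out'[OF s W bot_C] E0[OF s(1)] by (simp add: bot_conc)
    then show False using u bot_conc_iff by (auto simp: inner_def)
  qed
  moreover have "\<not> set (out_word T' s u) \<subseteq> {m}"
  proof
    assume "set (out_word T' s u) \<subseteq> {m}"
    then have "u \<frown> E (run T' s u) tops = tops"
      using E_out'[OF s W top_C] E0[OF s(1)] by (simp add: top_conc)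
    then show False using u top_conc_iff by (auto simp: inner_def)
  qed
  ultimately show ?thesis using out'_W[OF W] by (simp add: inner_def)
qed

text \<open>How the state of a word determines that of its preimage under \<open>\<zeta>\<close>.\<close>

definition state_rel :: "state \<Rightarrow> state \<Rightarrow> bool" where
  "state_rel s t \<longleftrightarrow> (s = t \<and> s \<noteq> St_A \<and> s \<noteq> St_B) \<or> (s \<in> {St_A, St_B} \<and> t \<in> {St_A, St_B})"

text \<open>The phase between \<open>St_A\<close> and \<open>St_B\<close> is lost because
  \<open>St_A\<close> reads \<open>0\<close> silently, which leaves the second run where it is; any
  other letter written from \<open>St_A\<close> brings the two runs together again.\<close>

lemma state_rel_step: "state_rel s t \<Longrightarrow> d < n \<Longrightarrow> state_rel (snd (T' s d)) (run T' t (fst (T' s d)))"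
  by (cases s; cases t; cases rule: letter_cases[of d]) (use m_pos in \<open>auto simp: state_rel_def\<close>)

lemma state_rel_run: "state_rel s t \<Longrightarrow> u \<in> W \<Longrightarrow> state_rel (run T' s u) (run T' t (out_word T' s u))"
  by (induction u arbitrary: s t) (auto simp: state_rel_step)

subsection \<open>Conjugating by \<open>\<zeta>\<close>\<close>

text \<open>If \<open>z\<close> has the same tail map \<open>Y\<close> on the source and target
  cylinders, then \<open>Y\<close> cancels in the conjugate. Surjectivity of \<open>Y\<close> makes
  the image of a cylinder a whole cylinder.\<close>

lemma LocF_conj:
  assumes z: "z \<in> MonoBij" and f: "f \<in> LocF"
    and loc: "\<And>\<eta>. \<eta> \<in> C \<Longrightarrow> \<exists>k v a b Y. acts f (pre k \<eta>) v \<and> (\<forall>\<omega>\<in>C. z (pre k \<eta> \<frown> \<omega>) = a \<frown> Y \<omega>) \<and>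
      (\<forall>\<omega>\<in>C. z (v \<frown> \<omega>) = b \<frown> Y \<omega>) \<and> (\<forall>\<omega>\<in>C. \<exists>\<xi>\<in>C. Y \<xi> = \<omega>)"
  shows "z \<star> f \<star> iv z \<in> LocF"
proof -
  have zB: "z \<in> Bij C" and fB: "f \<in> Bij C" using z f by (auto simp: MonoBij_Bij LocF_Bij)
  have "\<exists>k v. acts (z \<star> f \<star> iv z) (pre k \<omega>) v" if w: "\<omega> \<in> C" for \<omega>
  proof -
    define \<eta> where "\<eta> = (iv z) \<omega>"
    have e: "\<eta> \<in> C" "z \<eta> = \<omega>" using w zB Bij_C[OF inv_Bij[OF zB]] by (auto simp: \<eta>_def)
    obtain k v a b Y where h: "acts f (pre k \<eta>) v" "\<And>\<omega>. \<omega> \<in> C \<Longrightarrow> z (pre k \<eta> \<frown> \<omega>) = a \<frown> Y \<omega>"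
      "\<And>\<omega>. \<omega> \<in> C \<Longrightarrow> z (v \<frown> \<omega>) = b \<frown> Y \<omega>" "\<And>\<omega>. \<omega> \<in> C \<Longrightarrow> \<exists>\<xi>\<in>C. Y \<xi> = \<omega>"
      using loc[OF e(1)] by blast
    have "\<omega> = a \<frown> Y (suf k \<eta>)" using h(2)[OF suf_C[OF e(1)], of k] e(2) by simp
    then have a: "pre (length a) \<omega> = a" and aW: "a \<in> W" using w by (auto simp: pre_conc_length)
    have "acts (z \<star> f \<star> iv z) a b"
      unfolding acts_def
    proof
      fix x assume "x \<in> C"
      then obtain \<xi> where x: "\<xi> \<in> C" "Y \<xi> = x" "x \<in> C" using h(4) by blast
      have p: "pre k \<eta> \<frown> \<xi> \<in> C" using x e by simp
      have i: "(iv z) (a \<frown> x) = pre k \<eta> \<frown> \<xi>" using inv_app1[OF zB p] h(2)[OF x(1)] x(2) by simp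
      have c: "a \<frown> x \<in> C" using aW x by simp
      show "(z \<star> f \<star> iv z) (a \<frown> x) = b \<frown> x"
        using c zB fB i p actsD[OF h(1) x(1)] h(3)[OF x(1)] x(2) by (simp del: conc_C)
    qed
    then show ?thesis using a by metis
  qed
  then show ?thesis using MonoBij_mult[OF MonoBij_mult[OF z LocF_MonoBij[OF f]] MonoBij_inv[OF z]]
    by (simp add: LocF_def)
qed

text \<open>From \<open>St_R\<close>, \<open>St_A\<close> and \<open>St_B\<close> a letter other
  than \<open>m\<close> leads to one common state; after \<open>m\<close> only \<open>St_R\<close>
  and \<open>St_B\<close> remain, and these agree on every second letter.\<close>

lemma sync_T:
  assumes "state_class s c" "state_class s' c" "s \<noteq> St_L" "s' \<noteq> St_L" and w: "\<omega> \<in> C"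
  shows "\<exists>k. run T s (pre k \<omega>) = run T s' (pre k \<omega>) \<and> run T s (pre k \<omega>) \<noteq> St_B"
proof (cases "\<exists>k. s = St_O k")
  case True
  then have "s' = s" using assms(1,2) by (auto simp: state_class_def split: state.splits)
  then show ?thesis using True by (intro exI[of _ 0]) (auto simp: subsequence_def)
next
  case False
  then have s: "s \<in> {St_R, St_A, St_B}" "s' \<in> {St_R, St_A, St_B}"
    using assms by (cases s; cases s'; auto simp: state_class_def)+
  obtain d \<eta> where d: "d < n" "\<eta> \<in> C" "\<omega> = d ## \<eta>" using C_cases[OF w] .
  obtain e \<xi> where e: "e < n" "\<xi> \<in> C" "\<eta> = e ## \<xi>" using C_cases[OF d(2)] .
  have p: "pre 1 \<omega> = [d]" "pre 2 \<omega> = [d, e]" using d e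
    by (auto simp: subsequence_def numeral_2_eq_2)
  from d(1) show ?thesis
  proof (cases rule: letter_cases)
    case 1
    show ?thesis by (rule exI[of _ 1]) (use s p 1 in auto)
  next
    case 2
    show ?thesis by (rule exI[of _ 1]) (use s p 2 in auto)
  next
    case 3
    then have p': "pre 2 \<omega> = [m, e]" using p by simp
    show ?thesis
      by (rule exI[of _ 2], cases "e = 0") (use s p' e(1) m_pos in auto)
  qed
qed

text \<open>Source and target prefix have congruent digit sums by \<open>acts_sum\<close>, so
  \<open>sync_T\<close> merges their runs. A run still in \<open>St_L\<close> has read only zeros,
  and then so has the other one. The case \<open>St_R\<close> describes \<zeta> inside a cylinder
  with that state.\<close>

lemma Er_conj_LocF:
  assumes s0: "s0 \<in> {St_L, St_R}" and f: "f \<in> LocF"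
  shows "Er s0 \<star> f \<star> iv (Er s0) \<in> LocF"
proof (rule LocF_conj[OF _ f])
  have fM: "f \<in> MonoBij" and fB: "f \<in> Bij C" using f by (auto simp: LocF_MonoBij LocF_Bij)
  show "Er s0 \<in> MonoBij" using s0 by (auto intro: Er_MonoBij)
  fix \<eta> assume e: "\<eta> \<in> C"
  obtain k v where k: "acts f (pre k \<eta>) v" using f e by (auto simp: LocF_def)
  have vW: "v \<in> W" using acts_W[OF fB k] e by simp
  have sm: "sum_list v mod m = sum_list (pre k \<eta>) mod m" using acts_sum[OF f _ k] e by simp
  let ?s = "run T s0 (pre k \<eta>)" and ?s' = "run T s0 v"
  have c: "state_class ?s (sum_list v)" "state_class ?s' (sum_list v)"
    using state_class_T[of s0 0 "pre k \<eta>"] state_class_T[of s0 0 v] s0 e vW sm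
      by (auto simp: state_class_def split: state.splits)
  have "\<exists>j. run T ?s (pre j (suf k \<eta>)) = run T ?s' (pre j (suf k \<eta>)) \<and>
    run T ?s (pre j (suf k \<eta>)) \<noteq> St_B"
  proof (cases "?s = St_L")
    case True
    then have "s0 = St_L" using s0 run_not_L(1)[of St_R "pre k \<eta>"] e by auto
    then have "set (pre k \<eta>) \<subseteq> {0}" using True run_L[of "pre k \<eta>"] e by simp
    then have "set v \<subseteq> {0}" using acts_bot[OF fM k] by simp
    then have "?s' = St_L" using run_L[OF vW] \<open>s0 = St_L\<close> by simp
    then show ?thesis using True by (intro exI[of _ 0]) (simp add: subsequence_def)
  next
    case False
    have "?s' \<noteq> St_L"
    proof
      assume L: "?s' = St_L"
      then have "s0 = St_L" using s0 run_not_L(1)[of St_R v] vW by auto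
      then have "set v \<subseteq> {0}" using L run_L[OF vW] by simp
      then have "set (pre k \<eta>) \<subseteq> {0}" using acts_bot[OF MonoBij_inv[OF fM] acts_inv[OF fB k]] e
        by simp
      then show False using False run_L[of "pre k \<eta>"] e \<open>s0 = St_L\<close> by simp
    qed
    then show ?thesis using sync_T[OF c False _ suf_C[OF e]] by blast
  qed
  then obtain j where j: "run T ?s (pre j (suf k \<eta>)) = run T ?s' (pre j (suf k \<eta>))"
    "run T ?s (pre j (suf k \<eta>)) \<noteq> St_B" by blast
  define w where "w = pre j (suf k \<eta>)"
  define \<sigma> where "\<sigma> = run T ?s w"
  have wW: "w \<in> W" unfolding w_def by (rule pre_W[OF suf_C[OF e]])
  have \<sigma>: "run T s0 (pre k \<eta> @ w) = \<sigma>" "run T s0 (v @ w) = \<sigma>" "onto_state \<sigma>"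
    using j state_class_onto[OF state_class_T[OF c(1) wW]] by (auto simp: \<sigma>_def w_def)
  have pw: "pre (k + j) \<eta> = pre k \<eta> @ w" unfolding w_def
    by (metis add_diff_cancel_left' le_add1 pre_ge)
  show "\<exists>k v a b Y. acts f (pre k \<eta>) v \<and> (\<forall>\<omega>\<in>C. Er s0 (pre k \<eta> \<frown> \<omega>) = a \<frown> Y \<omega>) \<and>
      (\<forall>\<omega>\<in>C. Er s0 (v \<frown> \<omega>) = b \<frown> Y \<omega>) \<and> (\<forall>\<omega>\<in>C. \<exists>\<xi>\<in>C. Y \<xi> = \<omega>)"
  proof (intro exI conjI ballI)
    show "acts f (pre (k + j) \<eta>) (v @ w)" unfolding pw by (rule acts_append[OF k wW])
    fix \<omega> assume w': "\<omega> \<in> C"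
    have c: "(pre k \<eta> @ w) \<frown> \<omega> \<in> C" "(v @ w) \<frown> \<omega> \<in> C" using e wW vW w' by simp_all
    show "Er s0 (pre (k + j) \<eta> \<frown> \<omega>) = out_word T s0 (pre k \<eta> @ w) \<frown> E \<sigma> \<omega>"
      unfolding pw using c(1) E_conc[of s0 "pre k \<eta> @ w" \<omega>] \<sigma> by (simp only: Er_app)
    show "Er s0 ((v @ w) \<frown> \<omega>) = out_word T s0 (v @ w) \<frown> E \<sigma> \<omega>"
      using c(2) E_conc[of s0 "v @ w" \<omega>] \<sigma> by (simp only: Er_app)
    show "\<exists>\<xi>\<in>C. E \<sigma> \<xi> = \<omega>" using E_E'[OF \<sigma>(3) w'] E'_C[OF w'] by blast
  qed
qed

abbreviation zconj :: "(nat word \<Rightarrow> nat word) \<Rightarrow> nat word \<Rightarrow> nat word" where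
  "zconj f \<equiv> Z \<star> f \<star> iv Z"

abbreviation zunconj :: "(nat word \<Rightarrow> nat word) \<Rightarrow> nat word \<Rightarrow> nat word" where
  "zunconj f \<equiv> iv Z \<star> f \<star> Z"

lemma zconj_LocF: "f \<in> LocF \<Longrightarrow> zconj f \<in> LocF"
  using Er_conj_LocF[of St_L f] by (simp add: zeta_Er)

text \<open>Where the two prefixes have the same state, the inverse of \<zeta> has the same tail map
  on both, and the conjugate locally replaces \<open>hat\<close> of one by \<open>hat\<close> of the
  other. \<open>St_B\<close> is excluded because its tail map is not onto.\<close>

lemma zunconj_LocF:
  assumes f: "f \<in> LocF"
    and loc: "\<And>\<eta>. \<eta> \<in> C \<Longrightarrow>
      \<exists>k v. acts f (pre k \<eta>) v \<and> state_of (pre k \<eta>) = state_of v \<and> state_of v \<noteq> St_B"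
  shows "zunconj f \<in> LocF"
proof -
  interpret group G by (rule group_G)
  have fB: "f \<in> Bij C" using f by (rule LocF_Bij)
  have "iv Z \<star> f \<star> iv (iv Z) \<in> LocF"
  proof (rule LocF_conj[OF MonoBij_inv[OF Z_MonoBij] f])
    fix \<eta> assume e: "\<eta> \<in> C"
    obtain k v where k: "acts f (pre k \<eta>) v" "state_of (pre k \<eta>) = state_of v" "state_of v \<noteq> St_B"
      using loc[OF e] by blast
    have vW: "v \<in> W" using acts_W[OF fB k(1)] e by simp
    have o: "onto_state (state_of v)" using state_class_onto[OF state_class_state_of[OF vW] k(3)] .
    show "\<exists>k v a b Y. acts f (pre k \<eta>) v \<and> (\<forall>\<omega>\<in>C. (iv Z) (pre k \<eta> \<frown> \<omega>) = a \<frown> Y \<omega>) \<and>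
      (\<forall>\<omega>\<in>C. (iv Z) (v \<frown> \<omega>) = b \<frown> Y \<omega>) \<and> (\<forall>\<omega>\<in>C. \<exists>\<xi>\<in>C. Y \<xi> = \<omega>)"
    proof (intro exI conjI ballI)
      show "acts f (pre k \<eta>) v" by fact
      fix \<omega> assume w: "\<omega> \<in> C"
      show "(iv Z) (pre k \<eta> \<frown> \<omega>) = hat (pre k \<eta>) \<frown> E' (state_of v) \<omega>"
        using w e k(2) by (simp add: inv_Z E'_conc)
      show "(iv Z) (v \<frown> \<omega>) = hat v \<frown> E' (state_of v) \<omega>"
        using w vW by (simp add: inv_Z E'_conc)
      show "\<exists>\<xi>\<in>C. E' (state_of v) \<xi> = \<omega>" using E'_E[OF o w] E_C[OF w] by blast
    qed
  qed
  then show ?thesis using Z_Bij by simp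
qed

lemma zconj_hat:
  assumes f: "f \<in> Bij C" and a: "acts f (hat u) (hat v)" and W: "u \<in> W" "v \<in> W"
    and o: "onto_state (state_of u)" "onto_state (state_of v)" and w: "\<omega> \<in> C"
  shows "zconj f (u \<frown> E (state_of u) \<omega>) = v \<frown> E (state_of v) \<omega>"
proof -
  have c: "u \<frown> E (state_of u) \<omega> \<in> C" using W w by (simp add: E_C)
  have "(iv Z) (u \<frown> E (state_of u) \<omega>) = hat u \<frown> \<omega>"
    using c w o by (simp add: inv_Z E'_conc E'_E)
  moreover have "Z (hat v \<frown> \<omega>) = v \<frown> E (state_of v) \<omega>"
    using E_out'[of St_L v \<omega>] o W w out'_W[OF W(2)] by (simp add: Z_app)
  moreover have "hat u \<frown> \<omega> \<in> C" using out'_W[OF W(1)] w by simp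
  ultimately show ?thesis using c f Z_Bij actsD[OF a w] by (simp del: conc_C)
qed

subsection \<open>The groups \<open>S n i\<close>\<close>

lemma S_0: "S n 0 = LocF"
proof -
  interpret group G by (rule group_G)
  have e: "gone \<star> f \<star> iv gone = f" if "f \<in> LocF" for f using LocF_Bij[OF that] by simp
  have "S n 0 = (\<lambda>f. gone \<star> f \<star> iv gone) ` LocF"
    by (simp add: S_def Let_def F_eq_LocF Setcompr_eq_image)
  also have "\<dots> = (\<lambda>f. f) ` LocF" using e by (rule image_cong[OF refl])
  finally show ?thesis by simp
qed

lemma S_Suc: "S n (Suc i) = zconj ` S n i"
proof -
  interpret group G by (rule group_G)
  let ?p = "Z [^]\<^bsub>G\<^esub> i"
  have Zc: "Z \<in> carrier G" using Z_Bij by simp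
  have pc: "?p \<in> carrier G" using Zc by (rule nat_pow_closed)
  have e: "(Z [^]\<^bsub>G\<^esub> Suc i) \<star> f \<star> iv (Z [^]\<^bsub>G\<^esub> Suc i) = zconj (?p \<star> f \<star> iv ?p)" if "f \<in> LocF" for f
  proof -
    have fc: "f \<in> carrier G" using LocF_Bij[OF that] by simp
    have "Z [^]\<^bsub>G\<^esub> Suc i = Z \<star> ?p" using Zc by (rule nat_pow_Suc2)
    moreover have "iv (Z \<star> ?p) = iv ?p \<star> iv Z" using Zc pc by (rule inv_mult_group)
    ultimately show ?thesis using Zc pc fc by (simp only: m_assoc m_closed inv_closed)
  qed
  have "S n (Suc i) = (\<lambda>f. (Z [^]\<^bsub>G\<^esub> Suc i) \<star> f \<star> iv (Z [^]\<^bsub>G\<^esub> Suc i)) ` LocF"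
    by (simp add: S_def Let_def F_eq_LocF Setcompr_eq_image)
  also have "\<dots> = (\<lambda>f. zconj (?p \<star> f \<star> iv ?p)) ` LocF" using e by (rule image_cong[OF refl])
  also have "\<dots> = zconj ` S n i" by (simp add: S_def Let_def F_eq_LocF Setcompr_eq_image image_image)
  finally show ?thesis .
qed

lemma S_LocF: "S n i \<subseteq> LocF"
  by (induction i) (auto simp: S_0 S_Suc zconj_LocF)

lemma zconj_zunconj: "f \<in> Bij C \<Longrightarrow> zconj (zunconj f) = f" and zunconj_zconj: "f \<in> Bij C \<Longrightarrow>
  zunconj (zconj f) = f"
proof -
  assume f: "f \<in> Bij C"
  show "zconj (zunconj f) = f"
    by (rule Bij_eqI) (simp_all add: f Z_Bij Bij_C[OF inv_Bij[OF Z_Bij]] Bij_C[OF f])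
  show "zunconj (zconj f) = f" by (rule Bij_eqI) (simp_all add: f Z_Bij Bij_C[OF Z_Bij] Bij_C[OF f])
qed

lemma zconj_Bij: "f \<in> Bij C \<Longrightarrow> zconj f \<in> Bij C"
  using Z_Bij by simp

lemma S_Suc_iff: "f \<in> Bij C \<Longrightarrow> f \<in> S n (Suc i) \<longleftrightarrow> zunconj f \<in> S n i"
proof
  assume f: "f \<in> Bij C"
  show "zunconj f \<in> S n i" if h: "f \<in> S n (Suc i)"
  proof -
    obtain g where g: "g \<in> S n i" "f = zconj g" using h by (auto simp: S_Suc)
    then have "g \<in> Bij C" using S_LocF LocF_Bij by blast
    then show ?thesis using g zunconj_zconj by simp
  qed
  show "f \<in> S n (Suc i)" if "zunconj f \<in> S n i"
    unfolding S_Suc using imageI[OF that, of zconj] zconj_zunconj[OF f] by (simp only:)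
qed

subsection \<open>A parity obstruction\<close>

lemma E_A_zeros: "E St_A (replicate k 0 \<frown> \<omega>) = replicate (2 * k) 0 \<frown> E St_A \<omega>"
  by (induction k) auto

lemma replicate_top_inj:
  assumes "replicate i 0 \<frown> tops = replicate j 0 \<frown> tops" shows "i = j"
  using assms
proof (induction i arbitrary: j)
  case 0
  then show ?case using m_pos by (cases j) (auto dest: fun_cong[of _ _ 0])
next
  case (Suc i)
  then show ?case using m_pos by (cases j) (auto dest: fun_cong[of _ _ 0])
qed

text \<open>Near \<open>hat a 000...\<close> the conjugate acts on tails by \<open>E_A\<close>
  followed by the inverse of \<open>E_R\<close>. Applied to \<open>0...0 mmm...\<close>, the map
  \<open>E_A\<close> produces an even number of zeros, whereas \<open>E_R\<close> produces an odd
  number once there is a zero at all. A prefix replacement would have to match the two.\<close>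

lemma zunconj_not_LocF:
  assumes g: "g \<in> Bij C" and ab: "acts g a b" and W: "a \<in> W" "b \<in> W"
    and s: "state_of a = St_A" "state_of b = St_R"
  shows "zunconj g \<notin> LocF"
proof
  assume F: "zunconj g \<in> LocF"
  define \<rho> where "\<rho> \<omega> = E' St_R (E St_A \<omega>)" for \<omega>
  have E\<rho>: "E St_R (\<rho> \<omega>) = E St_A \<omega>" "\<rho> \<omega> \<in> C" if "\<omega> \<in> C" for \<omega>
    using that by (simp_all add: \<rho>_def E_E' E_C E'_C)
  have top: "E St_A tops = tops" "E St_A zeros = zeros" "E St_R zeros = zeros"
    using MonoBij_top[OF Er_MonoBij, of St_A] MonoBij_bot[OF Er_MonoBij, of St_A]
      MonoBij_bot[OF Er_MonoBij, of St_R] by simp_all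
  have \<phi>: "zunconj g (hat a \<frown> \<omega>) = hat b \<frown> \<rho> \<omega>" if w: "\<omega> \<in> C" for \<omega>
  proof -
    have c: "hat a \<frown> \<omega> \<in> C" using out'_W[OF W(1)] w by simp
    have "Z (hat a \<frown> \<omega>) = a \<frown> E St_A \<omega>"
      using E_out'[of St_L a \<omega>] s W w c by (simp add: Z_app del: conc_C)
    then show ?thesis
      using c g Z_Bij W w actsD[OF ab E_C[OF w]] E_C[OF w] s
      by (simp add: inv_Z E'_conc \<rho>_def del: conc_C)
        (simp add: inv_Z E'_conc)
  qed
  have aC: "hat a \<frown> zeros \<in> C" using out'_W[OF W(1)] by simp
  obtain k v0 where kv: "acts (zunconj g) (pre k (hat a \<frown> zeros)) v0" using F aC unfolding LocF_def
    by blast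
  have le: "k \<le> length (hat a) + Suc k + length (hat b)" by simp
  obtain v where v: "acts (zunconj g) (pre (length (hat a) + Suc k + length (hat b)) (hat a \<frown> zeros)) v"
    using acts_prefix_mono[OF kv le aC] by blast
  define K where "K = Suc k + length (hat b)"
  have "pre (length (hat a) + K) (hat a \<frown> zeros) = hat a @ replicate K 0"
    unfolding pre_conc_ge by (simp add: subsequence_def map_replicate_const)
  then have v: "acts (zunconj g) (hat a @ replicate K 0) v" using v by (simp add: K_def add.assoc)
  have vK: "v \<frown> \<omega> = hat b \<frown> \<rho> (replicate K 0 \<frown> \<omega>)" if w: "\<omega> \<in> C" for \<omega>
    using actsD[OF v w] \<phi>[of "replicate K 0 \<frown> \<omega>"] w by simp
  have \<rho>0: "\<rho> zeros = zeros"
    using top E'_E[of St_R zeros] by (simp add: \<rho>_def)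
  \<comment> \<open>Additional zeros make \<open>V\<close> longer than \<open>hat b\<close>. As
    \<open>zeros\<close> is fixed by \<rho>, this forces \<open>V\<close> to be \<open>hat b\<close>
    followed by \<open>j > 0\<close> zeros.\<close>
  define V where "V = v @ replicate (Suc (length (hat b))) 0"
  define M where "M = K + Suc (length (hat b))"
  have VM: "V \<frown> \<omega> = hat b \<frown> \<rho> (replicate M 0 \<frown> \<omega>)" if w: "\<omega> \<in> C" for \<omega>
  proof -
    have e: "replicate K 0 @ replicate (Suc (length (hat b))) 0 = replicate M (0::nat)"
      by (simp only: M_def replicate_add)
    have "replicate (Suc (length (hat b))) 0 \<frown> \<omega> \<in> C" using w by simp
    from vK[OF this] show ?thesis by (simp only: V_def conc_conc e)
  qed
  have l: "length (hat b) < length V" by (simp add: V_def)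
  have V0: "V \<frown> zeros = hat b \<frown> zeros"
    using VM[OF bot_C] \<rho>0 by (simp add: replicate_bot)
  define j where "j = length V - length (hat b)"
  have "V = hat b @ replicate j 0"
  proof -
    have "pre (length V) (V \<frown> zeros) = V" by (rule pre_conc_length)
    moreover have "pre (length (hat b) + j) (hat b \<frown> zeros) = hat b @ replicate j 0"
      unfolding pre_conc_ge by (simp add: subsequence_def map_replicate_const)
    ultimately show ?thesis using V0 l by (simp add: j_def)
  qed
  then have "\<rho> (replicate M 0 \<frown> tops) = replicate j 0 \<frown> tops"
    using VM[OF top_C] by (simp flip: conc_conc del: conc_conc)
  then have "E St_R (replicate j 0 \<frown> tops) = replicate (2 * M) 0 \<frown> tops"
    using E\<rho>(1)[of "replicate M 0 \<frown> tops"] top by (simp add: E_A_zeros)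
  moreover obtain i where i: "j = Suc i" using l by (cases j) (auto simp: j_def)
  moreover have "E St_R (replicate (Suc i) 0 \<frown> tops) = replicate (Suc (2 * i)) 0 \<frown> tops"
    using top by (simp add: E_A_zeros)
  ultimately have "Suc (2 * i) = 2 * M" using replicate_top_inj by metis
  then show False by presburger
qed

subsection \<open>Overgroups not contained in \<open>S n 1\<close>\<close>

text \<open>One \<open>g\<close> serves all words \<open>u\<close> in \<open>St_R\<close>
  simultaneously. This is what lets the induction pass through \<open>Er St_R\<close>: the word
  \<open>hat u\<close> is again in \<open>St_R\<close>, so the copy for the previous level sits in
  its cylinder.\<close>

lemma R_words_transitive:
  "inner w \<Longrightarrow> inner w' \<Longrightarrow> run T' St_R w = St_R \<Longrightarrow> run T' St_R w' = St_R \<Longrightarrow>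
    \<exists>g\<in>LocF. acts g w w' \<and> (\<forall>u\<in>W. state_of u = St_R \<longrightarrow> cone_map u g \<in> S n i)"
proof (induction i arbitrary: w w')
  case 0
  then have W: "w \<in> W" "w' \<in> W" by (auto simp: inner_def)
  have "sum_list w mod m = sum_list w' mod m"
    using state_class_T'[of St_R 0 w] state_class_T'[of St_R 0 w'] 0 W by simp
  then obtain g where "g \<in> LocF" "acts g w w'" using LocF_transitive[OF 0(1,2)] by blast
  then show ?case by (auto simp: S_0 cone_map_LocF)
next
  case (Suc i)
  let ?o = "out_word T' St_R"
  have W: "w \<in> W" "w' \<in> W" using Suc.prems by (auto simp: inner_def)
  have rel: "state_rel St_R St_R" by (simp add: state_rel_def)
  have h: "inner (?o w)" "inner (?o w')" using inner_out'[of St_R] Suc.prems by auto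
  have "run T' St_R (?o w) = St_R" "run T' St_R (?o w') = St_R"
    using state_rel_run[OF rel W(1)] state_rel_run[OF rel W(2)] Suc.prems
      by (auto simp: state_rel_def)
  from Suc.IH[OF h this] obtain g' where g': "g' \<in> LocF" "acts g' (?o w) (?o w')"
    "\<And>u. u \<in> W \<Longrightarrow> state_of u = St_R \<Longrightarrow> cone_map u g' \<in> S n i" by blast
  let ?R = "Er St_R"
  define g where "g = ?R \<star> g' \<star> iv ?R"
  have RB: "?R \<in> Bij C" and gB: "g' \<in> Bij C" using Er_Bij g' LocF_Bij by auto
  have "g \<in> LocF" unfolding g_def by (rule Er_conj_LocF) (use g' in auto)
  moreover have "acts g w w'"
    unfolding acts_def
  proof
    fix \<eta> assume e: "\<eta> \<in> C"
    have c: "w \<frown> \<eta> \<in> C" "?o w \<frown> E' St_R \<eta> \<in> C" "?o w' \<frown> E' St_R \<eta> \<in> C"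
      using W e out'_W by (auto simp: E'_C)
    have "(iv ?R) (w \<frown> \<eta>) = ?o w \<frown> E' St_R \<eta>"
      using inv_Er[OF _ c(1), of St_R] Suc.prems(3) by (simp add: E'_conc del: conc_C)
    moreover have "?R (?o w' \<frown> E' St_R \<eta>) = w' \<frown> \<eta>"
      using c(3) E_out'[of St_R w' "E' St_R \<eta>"] Suc.prems(4) W(2) E'_C[OF e] E_E'[of St_R \<eta>] e
      by (simp del: conc_C)
    ultimately show "g (w \<frown> \<eta>) = w' \<frown> \<eta>"
      using c RB gB actsD[OF g'(2) E'_C[OF e], of St_R] by (simp add: g_def del: conc_C)
  qed
  moreover have "cone_map u g \<in> S n (Suc i)" if u: "u \<in> W" "state_of u = St_R" for u
  proof -
    have hu: "hat u \<in> W" using out'_W[OF u(1)] .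
    have "state_of (hat u) = St_R" using state_rel_run[of St_L St_L u] u
      by (auto simp: state_rel_def)
    then have "zconj (cone_map (hat u) g') \<in> S n (Suc i)" using g'(3)[OF hu] by (auto simp: S_Suc)
    moreover have "zconj (cone_map (hat u) g') = cone_map u g"
      unfolding g_def
    proof (rule cone_map_conj[OF Z_Bij RB u(1) hu gB])
      fix \<eta> assume e: "\<eta> \<in> C"
      have "hat u \<frown> \<eta> \<in> C" using hu e by simp
      then show "Z (hat u \<frown> \<eta>) = u \<frown> ?R \<eta>"
        using E_out'[of St_L u \<eta>] u e by (simp add: Z_app del: conc_C)
    qed
    ultimately show ?thesis by simp
  qed
  ultimately show ?case by blast
qed

lemma zconj_cone_map:
  assumes u: "u \<in> W" and o: "onto_state (state_of u)" and Y: "Y \<in> Bij C"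
  shows "zconj (cone_map (hat u) Y) = cone_map u (Er (state_of u) \<star> Y \<star> iv (Er (state_of u)))"
proof (rule cone_map_conj[OF Z_Bij Er_Bij[OF o] u out'_W[OF u] Y])
  fix \<eta> assume e: "\<eta> \<in> C"
  have "hat u \<frown> \<eta> \<in> C" using out'_W[OF u] e by simp
  then show "Z (hat u \<frown> \<eta>) = u \<frown> Er (state_of u) \<eta>"
    using E_out'[of St_L u \<eta>] u o e by (simp add: Z_app del: conc_C)
qed

text \<open>The element found lies in \<open>K\<close> and \<open>S n 1\<close> but not in
  \<open>S n 2\<close>. It is a copy of one map \<open>Y\<close> which belongs to
  \<open>S n i\<close> on a word in \<open>St_A\<close> but violates the parity obstruction on a
  word in \<open>St_B\<close>; \<open>K\<close> cannot tell the two words apart one level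
  higher.\<close>

lemma not_below_S1_step:
  assumes K: "subgroup K G" and SK: "S n (Suc i) \<subseteq> K" and f: "f \<in> K" and uv: "acts f u v"
    and uW: "u \<in> W" and s: "state_of u = St_R" "state_of v = St_A"
  shows "\<exists>g\<in>K. zunconj g \<in> LocF \<and> zunconj (zunconj g) \<notin> LocF"
proof -
  interpret K: subgroup K G by (rule K)
  have KB: "k \<in> Bij C" if "k \<in> K" for k using K.mem_carrier[OF that] by simp
  have fB: "f \<in> Bij C" using KB[OF f] .
  have vW: "v \<in> W" using acts_W[OF fB uv uW] .
  \<comment> \<open>All three words lead from \<open>St_R\<close> to \<open>St_R\<close>. From
    \<open>St_A\<close>, both \<open>?a\<close> and \<open>?b\<close> lead to \<open>St_A\<close>,
    but they write \<open>m 0\<close> and \<open>0 m 0\<close>, which puts the next level out of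
    phase. From \<open>St_A\<close>, the word \<open>?c\<close> leads to \<open>St_R\<close>
    instead, so the pair \<open>?a\<close>, \<open>?c\<close> detects a mismatch.\<close>
  let ?a = "[0, m]" and ?b = "[0, 0, 0, m]" and ?c = "[0, m, m]"
  have inn: "inner ?a" "inner ?b" "inner ?c" using m_pos by (auto simp: inner_def)
  have r: "run T' St_R ?a = St_R" "run T' St_R ?b = St_R" "run T' St_R ?c = St_R" using m_pos
    by simp_all
  obtain h0 where h0: "acts h0 ?a ?b" "cone_map u h0 \<in> S n (Suc i)" "h0 \<in> LocF"
    using R_words_transitive[OF inn(1,2) r(1,2), of "Suc i"] uW s by blast
  define h where "h = cone_map u h0"
  have hK: "h \<in> K" using h0 SK by (auto simp: h_def)
  have ah: "acts h (u @ ?a) (u @ ?b)"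
    unfolding acts_def
  proof
    fix \<omega> assume w: "\<omega> \<in> C"
    have c: "?a \<frown> \<omega> \<in> C" using w by simp
    have "h (u \<frown> (?a \<frown> \<omega>)) = u \<frown> (?b \<frown> \<omega>)"
      unfolding h_def using cone_map_in[OF uW c, of h0] actsD[OF h0(1) w] by (simp only:)
    then show "h ((u @ ?a) \<frown> \<omega>) = (u @ ?b) \<frown> \<omega>" by (simp only: conc_conc)
  qed
  define k where "k = f \<star> h \<star> iv f"
  have kK: "k \<in> K" unfolding k_def using f hK by (intro K.m_closed K.m_inv_closed)
  let ?p = "v @ ?a" and ?q = "v @ ?b"
  have W: "?a \<in> W" "?b \<in> W" "?p \<in> W" "?q \<in> W" "u @ ?a \<in> W" "u @ ?b \<in> W" using vW uW by auto
  have ak: "acts k ?p ?q"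
    unfolding k_def
  proof (rule acts_mult[OF _ _ _ _ W(3)])
    show "acts (iv f) ?p (u @ ?a)" by (rule acts_inv[OF fB acts_append[OF uv W(1)] W(5)])
    show "acts (f \<star> h) (u @ ?a) ?q"
      by (rule acts_mult[OF fB KB[OF hK] ah acts_append[OF uv W(2)] W(5)])
  qed (simp_all add: fB KB[OF hK])
  define t where "t = state_of (hat v)"
  have t: "t = St_A \<or> t = St_B" using state_rel_run[of St_L St_L v] vW s
    by (auto simp: state_rel_def t_def)
  have dp: "state_of ?p = St_A" "state_of ?q = St_A" using s m_pos by simp_all
  have hp: "state_of (hat ?p) = run T' t [m, 0]" "state_of (hat ?q) = run T' t [0, m, 0]"
    using s m_pos by (simp_all add: t_def)
  \<comment> \<open>Since \<open>state_rel\<close> leaves open which of \<open>St_A\<close> and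
    \<open>St_B\<close> the state \<open>t\<close> is, the direction of \<open>k\<close> is chosen
    accordingly.\<close>
  obtain b b' \<kappa> where \<kappa>: "\<kappa> \<in> K" "acts \<kappa> b b'" "b \<in> W" "b' \<in> W" "state_of b = St_A" "state_of b'
    = St_A"
    "state_of (hat b) = St_A" "state_of (hat b') = St_B"
  proof (cases "t = St_A")
    case True
    show thesis
      by (rule that[of k ?p ?q]) (use kK ak W dp hp True m_pos in auto)
  next
    case False
    show thesis
      by (rule that[of "iv k" ?q ?p])
        (use kK acts_inv[OF KB[OF kK] ak W(3)] W dp hp False t m_pos in auto)
  qed
  obtain g0 where g0: "g0 \<in> LocF" "acts g0 ?a ?c" "\<And>u. u \<in> W \<Longrightarrow> state_of u = St_R \<Longrightarrow>
    cone_map u g0 \<in> S n i"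
    using R_words_transitive[OF inn(1,3) r(1,3), of i] by blast
  have hbW: "hat b \<in> W" "hat b' \<in> W" using out'_W \<kappa> by auto
  \<comment> \<open>The letter \<open>m\<close> leads \<open>hat b\<close> from \<open>St_A\<close>
    to \<open>St_R\<close>, where copies of \<open>g0\<close> lie in \<open>S n i\<close>, but
    \<open>hat b'\<close> from \<open>St_B\<close> to \<open>St_A\<close>.\<close>
  define Y where "Y = cone_map [m] g0"
  have YF: "Y \<in> LocF" unfolding Y_def by (rule cone_map_LocF) (use g0 in auto)
  then have YB: "Y \<in> Bij C" by (rule LocF_Bij)
  define V where "V = Er St_A \<star> Y \<star> iv (Er St_A)"
  have VB: "V \<in> Bij C" using YB Er_Bij[of St_A] by (simp add: V_def)
  have "cone_map (hat b @ [m]) g0 \<in> S n i"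
    using g0(3)[of "hat b @ [m]"] hbW \<kappa>(7) m_pos by simp
  then have "cone_map (hat b) Y \<in> S n i"
    unfolding Y_def using cone_map_append[OF hbW(1) _ LocF_Bij[OF g0(1)], of "[m]"] by simp
  then have "zconj (cone_map (hat b) Y) \<in> K" using SK by (auto simp: S_Suc)
  then have bK: "cone_map b V \<in> K" using zconj_cone_map[OF \<kappa>(3) _ YB] \<kappa>(5) by (simp add: V_def)
  have "\<kappa> \<star> cone_map b V \<star> iv \<kappa> = cone_map b' V"
    by (rule cone_map_conj_acts[OF KB[OF \<kappa>(1)] \<kappa>(4,3) VB \<kappa>(2)])
  then have gK: "cone_map b' V \<in> K" using \<kappa>(1) bK K.m_closed K.m_inv_closed by metis
  have g: "cone_map b' V = zconj (cone_map (hat b') Y)" using zconj_cone_map[OF \<kappa>(4) _ YB] \<kappa>(6)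
    by (simp add: V_def)
  have uF: "cone_map (hat b') Y \<in> LocF" by (rule cone_map_LocF[OF hbW(2) YF])
  then have ug: "zunconj (cone_map b' V) = cone_map (hat b') Y"
    using zunconj_zconj[OF LocF_Bij[OF uF]] g by simp
  have "acts (cone_map (hat b') Y) (hat b' @ [m] @ ?a) (hat b' @ [m] @ ?c)"
    unfolding acts_def
  proof
    fix \<omega> assume w: "\<omega> \<in> C"
    have c: "?a \<frown> \<omega> \<in> C" "[m] \<frown> (?a \<frown> \<omega>) \<in> C" using w by simp_all
    have "Y ([m] \<frown> (?a \<frown> \<omega>)) = [m] \<frown> (?c \<frown> \<omega>)"
      unfolding Y_def using cone_map_in[of "[m]", OF _ c(1), of g0] actsD[OF g0(2) w]
        by (simp only: lists.intros lessThan_iff lessI)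
    then have "cone_map (hat b') Y (hat b' \<frown> ([m] \<frown> (?a \<frown> \<omega>))) = hat b' \<frown> ([m] \<frown> (?c \<frown> \<omega>))"
      using cone_map_in[OF hbW(2) c(2), of Y] by (simp only:)
    then show "cone_map (hat b') Y ((hat b' @ [m] @ ?a) \<frown> \<omega>) = (hat b' @ [m] @ ?c) \<frown> \<omega>"
      by (simp only: conc_conc)
  qed
  \<comment> \<open>After \<open>hat b' m\<close> the state is \<open>St_A\<close>; from there
    \<open>?a\<close> ends in \<open>St_A\<close> and \<open>?c\<close> in
    \<open>St_R\<close>.\<close>
  then have "zunconj (cone_map (hat b') Y) \<notin> LocF"
    by (rule zunconj_not_LocF[OF LocF_Bij[OF uF]]) (use hbW \<kappa>(8) m_pos in auto)
  then have "zunconj (cone_map b' V) \<in> LocF \<and> zunconj (zunconj (cone_map b' V)) \<notin> LocF" using uF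
    by (simp only: ug simp_thms)
  then show ?thesis using gK by blast
qed

section \<open>Membership in \<open>S n 1\<close> and mismatched states\<close>

lemma S1_iff: "f \<in> Bij C \<Longrightarrow> f \<in> S n 1 \<longleftrightarrow> zunconj f \<in> LocF"
  using S_Suc_iff[of f 0] by (simp add: S_0)

lemma zconj_S1: "f \<in> LocF \<Longrightarrow> zconj f \<in> S n 1"
  using S_Suc[of 0] by (simp add: S_0)

lemma state_of_top: "set u \<subseteq> {m} \<Longrightarrow> u \<noteq> [] \<Longrightarrow> state_of u = St_R"
proof -
  assume u: "set u \<subseteq> {m}" "u \<noteq> []"
  have R: "set w \<subseteq> {m} \<Longrightarrow> run T' St_R w = St_R" for w
    using m_pos by (induction w) auto
  obtain w where "u = m # w" using u by (cases u) auto
  then show ?thesis using R[of w] u m_pos by simp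
qed

lemma state_class_zero: "state_class s c \<Longrightarrow> m dvd c \<Longrightarrow> s \<noteq> St_L \<Longrightarrow> s \<in> {St_R, St_A, St_B}"
  by (cases s) auto

lemma state_class_nonzero: "state_class s c \<Longrightarrow> state_class s' c \<Longrightarrow> \<not> m dvd c \<Longrightarrow> s = s' \<and> s' \<noteq> St_B"
  by (cases s; cases s') auto

lemma state_class_cong: "state_class s c \<Longrightarrow> c mod m = c' mod m \<Longrightarrow> state_class s c'"
  by (cases s) (auto simp: dvd_eq_mod_eq_0)

lemma run_B: assumes "d < n" shows "run T' St_B [d] \<noteq> St_B"
  using assms by (cases rule: letter_cases) (use m_pos in auto)

lemma inner_append: "inner u \<Longrightarrow> w \<in> W \<Longrightarrow> inner (u @ w)"
  by (auto simp: inner_def)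

lemma S1_transitive:
  assumes a: "inner a" and b: "inner b" and s: "state_of a = \<sigma>" "state_of b = \<sigma>" "onto_state \<sigma>"
  obtains g where "g \<in> S n 1" "acts g a b"
proof -
  have W: "a \<in> W" "b \<in> W" using a b by (auto simp: inner_def)
  have "sum_list a mod m = sum_list b mod m"
    using state_class_state_of[OF W(1)] state_class_state_of[OF W(2)] s by (cases \<sigma>) auto
  then have "sum_list (hat a) mod m = sum_list (hat b) mod m" using sum_out' W by simp
  then obtain f where f: "f \<in> LocF" "acts f (hat a) (hat b)"
    using LocF_transitive[of "hat a" "hat b"] inner_out'[of St_L] a b s by auto
  have "acts (zconj f) a b"
    unfolding acts_def
  proof
    fix \<omega> assume w: "\<omega> \<in> C"
    show "zconj f (a \<frown> \<omega>) = b \<frown> \<omega>"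
      using zconj_hat[OF LocF_Bij[OF f(1)] f(2) W _ _ E'_C[OF w], of \<sigma>] s E_E'[OF s(3) w] by simp
  qed
  then show thesis using that zconj_S1[OF f(1)] by blast
qed

text \<open>Digit sums and fixed end points leave only mismatches among \<open>St_R\<close>,
  \<open>St_A\<close> and \<open>St_B\<close> on inner words; those with \<open>St_B\<close> are
  refined by one letter, and inverting \<open>f\<close> gives the direction from \<open>St_R\<close>
  to \<open>St_A\<close>.\<close>

lemma state_mismatch:
  assumes f: "f \<in> LocF" and nf: "zunconj f \<notin> LocF"
  obtains g u v where "g = f \<or> g = iv f" "acts g u v" "inner u" "state_of u = St_R" "state_of v
    = St_A"
proof -
  have fM: "f \<in> MonoBij" and fB: "f \<in> Bij C" using f by (auto simp: LocF_MonoBij LocF_Bij)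
  obtain \<eta> where e: "\<eta> \<in> C" and no: "\<And>k v. acts f (pre k \<eta>) v \<Longrightarrow> state_of (pre k \<eta>) = state_of v \<Longrightarrow>
    state_of v = St_B"
    using zunconj_LocF[OF f] nf by blast
  obtain k v where k: "acts f (pre k \<eta>) v" using f e by (auto simp: LocF_def)
  define u where "u = pre k \<eta>"
  have uW: "u \<in> W" using e by (simp add: u_def)
  have uv: "acts f u v" using k by (simp add: u_def)
  have vW: "v \<in> W" using acts_W[OF fB uv uW] .
  have vu: "acts (iv f) v u" using acts_inv[OF fB uv uW] .
  have sm: "sum_list v mod m = sum_list u mod m" using acts_sum[OF f uW uv] .
  have c: "state_class (state_of u) (sum_list u)" "state_class (state_of v) (sum_list u)"
    using state_class_state_of[OF uW] state_class_cong[OF state_class_state_of[OF vW] sm] by blast+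
  have ne: "state_of u \<noteq> state_of v"
  proof
    assume eq: "state_of u = state_of v"
    then have B: "state_of v = St_B" using no[OF k] by (simp add: u_def)
    \<comment> \<open>Two words both in \<open>St_B\<close> do not contradict the choice of \<eta>
      yet; one more letter leaves \<open>St_B\<close> and keeps the states equal.\<close>
    define w where "w = pre 1 (suf k \<eta>)"
    have w: "w = [\<eta> k]" "\<eta> k < n" using e by (auto simp: w_def subsequence_def cantor_def)
    have p: "pre (k + 1) \<eta> = u @ w" unfolding w_def u_def
      by (metis add_diff_cancel_left' le_add1 pre_ge)
    have "acts f (pre (k + 1) \<eta>) (v @ w)" unfolding p by (rule acts_append[OF uv]) (use w in simp)
    moreover have "state_of (pre (k + 1) \<eta>) = state_of (v @ w)" unfolding p
      by (simp only: run_append eq)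
    ultimately have "state_of (v @ w) = St_B" by (rule no)
    then show False using B w run_B by simp
  qed
  have L: "state_of u = St_L \<longleftrightarrow> state_of v = St_L"
    using run'_L[OF uW] run'_L[OF vW] acts_bot[OF fM uv] acts_bot[OF MonoBij_inv[OF fM] vu] by blast
  have d: "m dvd sum_list u" using state_class_nonzero[OF c] ne by blast
  have s: "state_of u \<in> {St_R, St_A, St_B}" "state_of v \<in> {St_R, St_A, St_B}"
    using state_class_zero[OF c(1) d] state_class_zero[OF c(2) d] L ne by metis+
  have iu: "inner u"
  proof -
    have "\<not> set u \<subseteq> {0}" using run'_L[OF uW] s by auto
    moreover have "\<not> set u \<subseteq> {m}"
    proof
      assume u: "set u \<subseteq> {m}"
      then have "set v \<subseteq> {m}" using acts_top[OF fM uv] by simp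
      moreover have "u \<noteq> []" "v \<noteq> []" using s by auto
      ultimately show False using ne state_of_top u by metis
    qed
    ultimately show ?thesis using uW by (simp add: inner_def)
  qed
  have iv: "inner v" using acts_inner[OF fM uv iu] .
  have mW: "[m] \<in> W" by simp
  \<comment> \<open>Appending \<open>m\<close> turns \<open>St_B\<close> into \<open>St_A\<close>
    and both other states into \<open>St_R\<close>, so a mismatch involving \<open>St_B\<close>
    becomes one of \<open>St_A\<close> with \<open>St_R\<close>.\<close>
  have st: "state_of (x @ [m]) = St_R" if "state_of x = St_R \<or> state_of x = St_A" for x
    using that m_pos by auto
  have stB: "state_of (x @ [m]) = St_A" if "state_of x = St_B" for x using that by simp
  have up: "acts f (u @ [m]) (v @ [m])" "acts (iv f) (v @ [m]) (u @ [m])"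
    using acts_append[OF uv mW] acts_append[OF vu mW] .
  have ip: "inner (u @ [m])" "inner (v @ [m])" using inner_append mW iu iv by auto
  consider "state_of u = St_R" "state_of v = St_A" | "state_of u = St_A" "state_of v
    = St_R" | "state_of v = St_B" | "state_of u = St_B"
    using s ne by auto
  then show thesis
  proof cases
    case 1 then show thesis using that uv iu by blast
  next
    case 2 then show thesis using that vu iv by blast
  next
    case 3 then show thesis using that[OF _ up(1) ip(1)] st[of u] stB[of v] s ne by auto
  next
    case 4 then show thesis using that[OF _ up(2) ip(2)] st[of v] stB[of u] s ne by auto
  qed
qed

subsection \<open>The pentagon relation\<close>

text \<open>Rearranged: applying \<open>X\<close> twice equals applying its copy at
  \<open>0\<close>, then \<open>X\<close>, then its copy at \<open>m\<close>. For
  \<open>m = 1\<close> these are the two ways from \<open>((ab)c)d\<close> to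
  \<open>a(b(cd))\<close>.\<close>

lemma pentagon: "\<eta> \<in> C \<Longrightarrow> Xi (cone_map [m] Xi (X (X \<eta>))) = cone_map [0] X \<eta>"
proof -
  assume e: "\<eta> \<in> C"
  have m_in: "cone_map [m] g (m ## \<omega>) = m ## g \<omega>" if "\<omega> \<in> C" for g \<omega>
    using cone_map_in[of "[m]" \<omega> g] that by simp
  have z_in: "cone_map [0] g (0 ## \<omega>) = 0 ## g \<omega>" if "\<omega> \<in> C" for g \<omega>
    using cone_map_in[of "[0]" \<omega> g] that by simp
  have m_out: "cone_map [m] g (d ## \<omega>) = d ## \<omega>" if "\<omega> \<in> C" "d < m" for g d \<omega>
    using that by (intro cone_map_out) (auto simp: cylinder_iff)
  have z_out: "cone_map [0] g (d ## \<omega>) = d ## \<omega>" if "\<omega> \<in> C" "0 < d" "d \<le> m" for g d \<omega>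
    using that by (intro cone_map_out) (auto simp: cylinder_iff)
  obtain d \<xi> where d: "d < n" "\<xi> \<in> C" "\<eta> = d ## \<xi>" using C_cases[OF e] .
  show ?thesis
  proof (cases "d = 0")
    case False
    then show ?thesis using d m_pos by (simp add: m_in z_out)
  next
    case True
    obtain b x where b: "b < n" "x \<in> C" "\<xi> = b ## x" using C_cases[OF d(2)] .
    from b(1) show ?thesis
    proof (cases rule: letter_cases)
      case 1
      obtain a y where a: "a < n" "y \<in> C" "x = a ## y" using C_cases[OF b(2)] .
      show ?thesis using d True b 1 a m_pos by (cases "a = m") (simp_all add: m_in z_in m_out)
    next
      case 2
      then show ?thesis using d True b m_pos by (simp add: m_in z_in)
    next
      case 3
      then show ?thesis using d True b m_pos by (simp add: m_in z_in)
    qed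
  qed
qed

subsection \<open>Twists\<close>

text \<open>On the cylinder of a word \<open>u\<close> in state \<open>s\<close>, the map \<open>u \<omega> \<mapsto> u (twist s \<omega>)\<close> makes \<open>u\<close> behave
  like a word in state \<^const>\<open>St_R\<close>; for \<^const>\<open>St_A\<close> this is the relation \<open>E\<^sub>A = x\<^sup>-\<^sup>1 \<circ> E\<^sub>R\<close>.\<close>

definition twist :: "state \<Rightarrow> nat word \<Rightarrow> nat word" where
  "twist s = (case s of St_A \<Rightarrow> Xi | St_B \<Rightarrow> cone_map [m] Xi | _ \<Rightarrow> gone)"

lemma one_Bij: "gone \<in> Bij C"
  using group.is_monoid[OF group_G] monoid.one_closed by fastforce

lemma twist_Bij: "twist s \<in> Bij C"
  by (auto simp: twist_def Xi_Bij one_Bij cone_map_Bij split: state.splits)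

text \<open>After both sides are twisted, a replacement between words in different states preserves
  states on small enough cylinders. This is what makes the correction by twists land in
  \<open>S n 1\<close>.\<close>

lemma twist_sync:
  assumes s: "s \<in> {St_R, St_A, St_B}" "s' \<in> {St_R, St_A, St_B}" and w: "\<xi> \<in> C"
  obtains x q q' \<xi>' where "\<xi>' \<in> C" "\<xi> = x \<frown> \<xi>'" "q \<in> W" "x \<in> W"
    "\<And>\<omega>. \<omega> \<in> C \<Longrightarrow> twist s (x \<frown> \<omega>) = q \<frown> \<omega>" "\<And>\<omega>. \<omega> \<in> C \<Longrightarrow> twist s' (x \<frown> \<omega>) = q' \<frown> \<omega>"
    "run T' s q = run T' s' q'" "run T' s' q' \<noteq> St_B"
proof -
  have m_in: "cone_map [m] Xi (m ## \<omega>) = m ## Xi \<omega>" if "\<omega> \<in> C" for \<omega>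
    using cone_map_in[of "[m]" \<omega> Xi] that by simp
  have m_out: "cone_map [m] Xi (d ## \<omega>) = d ## \<omega>" if "\<omega> \<in> C" "d < m" for d \<omega>
    using that by (intro cone_map_out) (auto simp: cylinder_iff)
  \<comment> \<open>Here \<open>x\<close> is good if all three twists are prefix replacements on its
    cylinder and the resulting words lead from their respective states to one common state \<sigma>.
    The words \<open>0\<close>, \<open>d\<close>, \<open>m0\<close>, \<open>md\<close>,
    \<open>mm0\<close> and \<open>mmd\<close> reach every point.\<close>
  define good where "good x \<sigma> \<longleftrightarrow> (\<forall>s\<in>{St_R, St_A, St_B}. \<exists>q\<in>W. (\<forall>\<omega>\<in>C. twist s (x \<frown> \<omega>) = q \<frown> \<omega>) \<and>
    run T' s q = \<sigma>)" for x \<sigma>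
  have goodI: "good x \<sigma>" if "q1 \<in> W" "q2 \<in> W" "q3 \<in> W"
    "\<And>\<omega>. \<omega> \<in> C \<Longrightarrow> x \<frown> \<omega> = q1 \<frown> \<omega>" "run T' St_R q1 = \<sigma>"
    "\<And>\<omega>. \<omega> \<in> C \<Longrightarrow> Xi (x \<frown> \<omega>) = q2 \<frown> \<omega>" "run T' St_A q2 = \<sigma>"
    "\<And>\<omega>. \<omega> \<in> C \<Longrightarrow> cone_map [m] Xi (x \<frown> \<omega>) = q3 \<frown> \<omega>" "run T' St_B q3 = \<sigma>" "x \<in> W" for x \<sigma> q1 q2 q3
    unfolding good_def using that
    by (auto simp: twist_def intro: bexI[of _ q1] bexI[of _ q2] bexI[of _ q3])
  have good0: "good [0] St_A"
    by (rule goodI[of "[0]" "[0, 0]" "[0]"]) (use m_pos in \<open>auto simp: m_out\<close>)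
  have goodd: "good [d] (rt d)" if "0 < d" "d < m" for d
    by (rule goodI[of "[d]" "[0, d]" "[d]"]) (use m_pos that in \<open>auto simp: m_out\<close>)
  have goodm0: "good [m, 0] St_A"
    by (rule goodI[of "[m, 0]" "[0, m]" "[m, 0, 0]"]) (use m_pos in \<open>auto simp: m_in\<close>)
  have goodmd: "good [m, d] (rt d)" if "0 < d" "d < m" for d
    by (rule goodI[of "[m, d]" "[d]" "[m, 0, d]"]) (use m_pos that in \<open>auto simp: m_in\<close>)
  have goodmm0: "good [m, m, 0] St_A"
    by (rule goodI[of "[m, m, 0]" "[m, 0]" "[m, 0, m]"]) (use m_pos in \<open>auto simp: m_in\<close>)
  have goodmmd: "good [m, m, d] (rt d)" if "0 < d" "d \<le> m" for d
    by (rule goodI[of "[m, m, d]" "[m, d]" "[m, d]"]) (use m_pos that in \<open>auto simp: m_in\<close>)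
  have "\<exists>x \<sigma> \<xi>'. good x \<sigma> \<and> \<sigma> \<noteq> St_B \<and> x \<in> W \<and> \<xi>' \<in> C \<and> \<xi> = x \<frown> \<xi>'"
  proof -
    obtain d y where d: "d < n" "y \<in> C" "\<xi> = d ## y" using C_cases[OF w] .
    obtain e z where e: "e < n" "z \<in> C" "y = e ## z" using C_cases[OF d(2)] .
    obtain b a where b: "b < n" "a \<in> C" "z = b ## a" using C_cases[OF e(2)] .
    consider "d = 0" | "0 < d" "d < m" | "d = m" "e = 0" | "d = m" "0 < e" "e < m"
      | "d = m" "e = m" "b = 0" | "d = m" "e = m" "0 < b" using d e by linarith
    then show ?thesis
    proof cases
      case 1 then show ?thesis using good0 d
        by (intro exI[of _ "[0]"] exI[of _ St_A] exI[of _ y]) auto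
    next
      case 2 then show ?thesis using goodd d
        by (intro exI[of _ "[d]"] exI[of _ "rt d"] exI[of _ y]) auto
    next
      case 3 then show ?thesis using goodm0 d e
        by (intro exI[of _ "[m, 0]"] exI[of _ St_A] exI[of _ z]) auto
    next
      case 4 then show ?thesis using goodmd d e
        by (intro exI[of _ "[m, e]"] exI[of _ "rt e"] exI[of _ z]) auto
    next
      case 5 then show ?thesis using goodmm0 d e b
        by (intro exI[of _ "[m, m, 0]"] exI[of _ St_A] exI[of _ a]) auto
    next
      case 6 then show ?thesis using goodmmd d e b
        by (intro exI[of _ "[m, m, b]"] exI[of _ "rt b"] exI[of _ a]) auto
    qed
  qed
  then obtain x \<sigma> \<xi>' where x: "good x \<sigma>" "\<sigma> \<noteq> St_B" "x \<in> W" "\<xi>' \<in> C" "\<xi> = x \<frown> \<xi>'" by blast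
  obtain q where q: "q \<in> W" "\<forall>\<omega>\<in>C. twist s (x \<frown> \<omega>) = q \<frown> \<omega>" "run T' s q = \<sigma>"
    using x(1) s(1) unfolding good_def by blast
  obtain q' where q': "\<forall>\<omega>\<in>C. twist s' (x \<frown> \<omega>) = q' \<frown> \<omega>" "run T' s' q' = \<sigma>"
    using x(1) s(2) unfolding good_def by blast
  show thesis using that[of \<xi>' x q q'] x q q' by simp
qed

text \<open>Cylinders of distinct words of equal length are disjoint, so the factors of the product
  act independently.\<close>

lemma patch:
  assumes K: "subgroup K G" and U: "finite U" "U \<subseteq> {u \<in> W. length u = N}"
    and t: "\<And>u. u \<in> U \<Longrightarrow> \<tau> u \<in> Bij C \<and> cone_map u (\<tau> u) \<in> K"
  shows "\<exists>g\<in>K. \<forall>u\<in>W. length u = N \<longrightarrow> (\<forall>\<eta>\<in>C. g (u \<frown> \<eta>) = u \<frown> (if u \<in> U then \<tau> u \<eta> else \<eta>))"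
  using U t
proof (induction U)
  case empty
  have "gone \<in> K" using K by (rule subgroup.one_closed)
  then show ?case by (intro bexI[of _ "gone"]) auto
next
  case (insert a U)
  interpret K: subgroup K G by (rule K)
  have "\<exists>g\<in>K. \<forall>u\<in>W. length u = N \<longrightarrow> (\<forall>\<eta>\<in>C. g (u \<frown> \<eta>) = u \<frown> (if u \<in> U then \<tau> u \<eta> else \<eta>))"
    by (rule insert.IH) (use insert.prems in blast)+
  then obtain g where g: "g \<in> K" "\<And>u \<eta>. u \<in> W \<Longrightarrow> length u = N \<Longrightarrow> \<eta> \<in> C \<Longrightarrow>
    g (u \<frown> \<eta>) = u \<frown> (if u \<in> U then \<tau> u \<eta> else \<eta>)"
    by blast
  have a: "a \<in> W" "length a = N" "\<tau> a \<in> Bij C" "cone_map a (\<tau> a) \<in> K" using insert.prems by auto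
  let ?g = "cone_map a (\<tau> a) \<star> g"
  have gB: "g \<in> Bij C" using K.mem_carrier[OF g(1)] by simp
  have "?g (u \<frown> \<eta>) = u \<frown> (if u \<in> insert a U then \<tau> u \<eta> else \<eta>)"
    if u: "u \<in> W" "length u = N" and e: "\<eta> \<in> C" for u \<eta>
  proof -
    have c: "u \<frown> \<eta> \<in> C" using u e by simp
    have app: "?g (u \<frown> \<eta>) = cone_map a (\<tau> a) (g (u \<frown> \<eta>))"
      using cone_map_Bij[OF a(1,3)] gB c by (simp del: conc_C)
    show ?thesis
    proof (cases "u = a")
      case True
      then show ?thesis using app g(2)[OF u e] insert.hyps(2) cone_map_in[OF a(1) e] by simp
    next
      case False
      define \<xi> where "\<xi> = (if u \<in> U then \<tau> u \<eta> else \<eta>)"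
      have x: "\<xi> \<in> C" using insert.prems(2)[of u] Bij_C[of "\<tau> u" \<eta>] e by (auto simp: \<xi>_def)
      have "u \<frown> \<xi> \<notin> cylinder n a"
        using False conc_eq_iff[of u a] u a by (auto simp: cylinder_iff)
      then have "cone_map a (\<tau> a) (u \<frown> \<xi>) = u \<frown> \<xi>" using u x by (intro cone_map_out) auto
      then show ?thesis using app g(2)[OF u e] False by (simp add: \<xi>_def)
    qed
  qed
  moreover have "?g \<in> K" using a g by (intro K.m_closed)
  ultimately show ?case by blast
qed

lemma all_of_LocF:
  assumes K: "subgroup K G" and SK: "S n 1 \<subseteq> K" and KF: "K \<subseteq> LocF"
    and gen: "\<And>z. inner z \<Longrightarrow> m dvd sum_list z \<Longrightarrow> cone_map z X \<in> K"
  shows "LocF \<subseteq> K"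
proof
  interpret K: subgroup K G by (rule K)
  interpret group G by (rule group_G)
  fix f assume f: "f \<in> LocF"
  have fM: "f \<in> MonoBij" and fB: "f \<in> Bij C" using f by (auto simp: LocF_MonoBij LocF_Bij)
  obtain N where N: "\<And>u. u \<in> W \<Longrightarrow> N \<le> length u \<Longrightarrow> \<exists>v. acts f u v" using LocF_uniform[OF f] by blast
  then obtain im where im: "\<And>u. u \<in> W \<Longrightarrow> length u = N \<Longrightarrow> acts f u (im u)" by (metis le_refl)
  have genXi: "cone_map z Xi \<in> K" if "inner z" "m dvd sum_list z" for z
  proof -
    have "z \<in> W" using that by (simp add: inner_def)
    then show ?thesis using K.m_inv_closed[OF gen[OF that]] cone_map_inv[OF _ X_Bij] inv_X by metis
  qed
  have twistK: "cone_map z (twist s) \<in> K" if z: "inner z" "m dvd sum_list z" for z s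
  proof -
    have zW: "z \<in> W" using z by (simp add: inner_def)
    have "cone_map z (cone_map [m] Xi) \<in> K"
      using genXi[of "z @ [m]"] z inner_append[OF z(1), of "[m]"]
        cone_map_append[OF zW _ Xi_Bij, of "[m]"] by simp
    moreover have "cone_map z gone \<in> K" using cone_map_one[OF zW] K.one_closed by simp
    ultimately show ?thesis using genXi[OF z] by (auto simp: twist_def split: state.splits)
  qed
  \<comment> \<open>Outside \<open>?U\<close> the states of \<open>u\<close> and \<open>im u\<close>
    agree already: a nonzero residue determines a routing state, and words of zeros or of letters
    \<open>m\<close> go to words of the same kind.\<close>
  let ?U = "{u \<in> W. length u = N \<and> inner u \<and> m dvd sum_list u}"
  define \<tau> where "\<tau> u = twist (state_of (im u)) \<star> iv (twist (state_of u))" for u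
  have tB: "\<tau> u \<in> Bij C" for u by (simp add: \<tau>_def twist_Bij)
  have "cone_map u (\<tau> u) \<in> K" if u: "u \<in> ?U" for u
  proof -
    have "u \<in> W" using u by simp
    then have "cone_map u (\<tau> u)
      = cone_map u (twist (state_of (im u))) \<star> iv (cone_map u (twist (state_of u)))"
      using cone_map_mult[OF _ twist_Bij inv_Bij[OF twist_Bij]] cone_map_inv[OF _ twist_Bij]
        by (simp add: \<tau>_def)
    then show ?thesis using twistK u
      by (metis (no_types, lifting) K.m_closed K.m_inv_closed mem_Collect_eq)
  qed
  moreover have "finite ?U"
    by (rule finite_subset[OF _ finite_lists_length_eq[of "{..<n}" N]]) (auto
      simp: in_lists_conv_set)
  ultimately obtain g where g: "g \<in> K"
    "\<And>u \<eta>. u \<in> W \<Longrightarrow> length u = N \<Longrightarrow> \<eta> \<in> C \<Longrightarrow> g (u \<frown> \<eta>) = u \<frown> (if u \<in> ?U then \<tau> u \<eta> else \<eta>)"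
    using patch[OF K, of ?U N \<tau>] tB by blast
  have gF: "g \<in> LocF" and gB: "g \<in> Bij C" using g(1) KF LocF_Bij by auto
  define f' where "f' = f \<star> g"
  have f'F: "f' \<in> LocF" unfolding f'_def by (rule LocF_mult[OF f gF])
  have f'B: "f' \<in> Bij C" using f'F by (rule LocF_Bij)
  have f'_app: "f' (u \<frown> \<eta>) = im u \<frown> (if u \<in> ?U then \<tau> u \<eta> else \<eta>)"
    if u: "u \<in> W" "length u = N" "\<eta> \<in> C" for u \<eta>
  proof -
    have "(if u \<in> ?U then \<tau> u \<eta> else \<eta>) \<in> C" using Bij_C[OF tB u(3)] u by simp
    then show ?thesis
      using u g(2)[OF u] actsD[OF im[OF u(1,2)]] fB gB by (simp add: f'_def)
  qed
  have "zunconj f' \<in> LocF"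
  proof (rule zunconj_LocF[OF f'F])
    fix \<omega> assume w: "\<omega> \<in> C"
    define u where "u = pre N \<omega>"
    define \<eta> where "\<eta> = suf N \<omega>"
    define v where "v = im u"
    have u: "u \<in> W" "length u = N" "\<omega> = u \<frown> \<eta>" and e: "\<eta> \<in> C" using w by (auto simp: u_def \<eta>_def)
    have uv: "acts f u v" unfolding v_def by (rule im[OF u(1,2)])
    have vW: "v \<in> W" using acts_W[OF fB uv u(1)] .
    have sm: "sum_list v mod m = sum_list u mod m" using acts_sum[OF f u(1) uv] .
    have c: "state_class (state_of u) (sum_list u)" "state_class (state_of v) (sum_list u)"
      using state_class_state_of[OF u(1)] state_class_cong[OF state_class_state_of[OF vW] sm]
        by blast+
    have L: "state_of u = St_L \<longleftrightarrow> state_of v = St_L"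
      using run'_L[OF u(1)] run'_L[OF vW] acts_bot[OF fM uv]
        acts_bot[OF MonoBij_inv[OF fM] acts_inv[OF fB uv u(1)]] by blast
    show "\<exists>k v. acts f' (pre k \<omega>) v \<and> state_of (pre k \<omega>) = state_of v \<and> state_of v \<noteq> St_B"
    proof (cases "u \<in> ?U")
      case True
      have d: "m dvd sum_list u" and "inner u" using True by simp_all
      then have "state_of u \<noteq> St_L" using run'_L[OF u(1)] by (simp add: inner_def)
      then have s: "state_of u \<in> {St_R, St_A, St_B}" "state_of v \<in> {St_R, St_A, St_B}"
        using state_class_zero[OF c(1) d] state_class_zero[OF c(2) d] L by blast+
      \<comment> \<open>In this coordinate \<open>f'\<close> sends \<open>u\<close> followed by the
        twist of \<xi> for the state of \<open>u\<close> to \<open>v\<close> followed by the twist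
        of \<xi> for the state of \<open>v\<close>, as \<open>twist_sync\<close> requires.\<close>
      define \<xi> where "\<xi> = (iv (twist (state_of u))) \<eta>"
      have x: "\<xi> \<in> C" "twist (state_of u) \<xi> = \<eta>"
        using e twist_Bij Bij_C[OF inv_Bij[OF twist_Bij]] by (auto simp: \<xi>_def)
      obtain x q q' \<xi>' where q: "\<xi>' \<in> C" "\<xi> = x \<frown> \<xi>'" "q \<in> W" "x \<in> W"
        "\<And>\<omega>. \<omega> \<in> C \<Longrightarrow> twist (state_of u) (x \<frown> \<omega>) = q \<frown> \<omega>" "\<And>\<omega>. \<omega> \<in> C \<Longrightarrow>
          twist (state_of v) (x \<frown> \<omega>) = q' \<frown> \<omega>"
        "run T' (state_of u) q = run T' (state_of v) q'" "run T' (state_of v) q' \<noteq> St_B"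
        by (rule twist_sync[OF s x(1)], rule that)
      have qx: "q \<frown> \<xi>' = \<eta>" using x(2) q(2) q(5)[OF q(1)] by simp
      have "\<omega> = (u @ q) \<frown> \<xi>'" using u(3) unfolding qx[symmetric] by simp
      then have p: "pre (length (u @ q)) \<omega> = u @ q" by (metis pre_conc_length)
      have "acts f' (u @ q) (v @ q')"
        unfolding acts_def
      proof
        fix y assume y: "y \<in> C"
        have xy: "x \<frown> y \<in> C" and qy: "q \<frown> y \<in> C" using y q by auto
        have "(iv (twist (state_of u))) (q \<frown> y) = x \<frown> y"
          using inv_app1[OF twist_Bij xy, of "state_of u"] q(5)[OF y] by simp
        then have "\<tau> u (q \<frown> y) = q' \<frown> y"
          using qy q(6)[OF y] twist_Bij by (simp add: \<tau>_def v_def del: conc_C)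
        then have "f' (u \<frown> (q \<frown> y)) = v \<frown> (q' \<frown> y)"
          using f'_app[OF u(1,2) qy] True by (simp add: v_def del: conc_conc)
        then show "f' ((u @ q) \<frown> y) = (v @ q') \<frown> y" by simp
      qed
      moreover have "state_of (u @ q) = state_of (v @ q')" "state_of (v @ q') \<noteq> St_B" using q(7,8)
        by simp_all
      ultimately show ?thesis using p by metis
    next
      case False
      have "f' (u \<frown> y) = v \<frown> y" if "y \<in> C" for y
        using f'_app[OF u(1,2) that] unfolding if_not_P[OF False] v_def .
      then have "acts f' u v" by (simp add: acts_def)
      moreover have "state_of u = state_of v \<and> state_of v \<noteq> St_B"
      proof (cases "m dvd sum_list u")
        case True
        then have "set u \<subseteq> {0} \<or> set u \<subseteq> {m}" using False u by (auto simp: inner_def)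
        then show ?thesis
        proof
          assume "set u \<subseteq> {0}" then show ?thesis using run'_L[OF u(1)] L by simp
        next
          assume t: "set u \<subseteq> {m}"
          show ?thesis
          proof (cases "state_of u = St_L")
            case False
            then have "u \<noteq> []" "v \<noteq> []" using L by auto
            then show ?thesis using state_of_top t acts_top[OF fM uv t] by simp
          qed (use L in simp)
        qed
      next
        case False
        then show ?thesis using state_class_nonzero[OF c] by simp
      qed
      ultimately show ?thesis unfolding u_def by blast
    qed
  qed
  then have "f' \<in> K" using S1_iff[OF f'B] SK by blast
  moreover have "f = f' \<star> iv g"
    using fB gB by (simp add: f'_def m_assoc)
  ultimately show "f \<in> K" using g(1) K.m_closed K.m_inv_closed by metis
qed

section \<open>Left neighbours and a copy of \<open>X\<close> in a single cylinder\<close>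

lemma last_nonzero:
  "w \<in> W \<Longrightarrow> \<not> set w \<subseteq> {0} \<Longrightarrow> \<exists>p d b. w = p @ [Suc d] @ replicate b 0 \<and> d < m \<and> p \<in> W"
proof (induction w rule: rev_induct)
  case (snoc x w)
  show ?case
  proof (cases "x = 0")
    case True
    then obtain p d b where "w = p @ [Suc d] @ replicate b 0" "d < m" "p \<in> W" using snoc by auto
    then show ?thesis using True
      by (intro exI[of _ p] exI[of _ d] exI[of _ "Suc b"]) (simp add: replicate_append_same)
  next
    case False
    then obtain d where "x = Suc d" by (cases x) auto
    then show ?thesis using snoc by (intro exI[of _ w] exI[of _ d] exI[of _ 0]) auto
  qed
qed simp

text \<open>Two letters \<open>m\<close> lead every state with residue 0 to \<open>St_R\<close>, in
  both transducers, and fix the routing states, so that only the residue of the digit sum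
  survives.\<close>

lemma run_mm:
  assumes "state_class s c" "Suc c mod m = 0"
  shows "run T s [m, m] = rt c" "run T' s [m, m] = rt c"
proof -
  have "run T s [m, m] = rt c \<and> run T' s [m, m] = rt c"
  proof (cases "m dvd c")
    case True
    then have "m dvd 1" using assms(2) by (metis dvd_add_right_iff dvd_eq_mod_eq_0 Suc_eq_plus1)
    then have m1: "m = 1" by simp
    then have "rt c = St_R" by (simp add: routing_def)
    moreover have "s \<noteq> St_O k" for k
    proof
      assume "s = St_O k"
      then have "0 < k \<and> k < m" using assms(1) by simp
      then show False using m1 by linarith
    qed
    ultimately show ?thesis using m_pos by (cases s) auto
  next
    case False
    then obtain k where k: "s = St_O k" "0 < k" "k < m" "c mod m = k"
      using assms(1) by (cases s) (auto simp: dvd_eq_mod_eq_0)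
    then have "rt c = St_O k" "rt (k + m) = St_O k" by (auto simp: routing_def)
    then show ?thesis using k by simp
  qed
  then show "run T s [m, m] = rt c" "run T' s [m, m] = rt c" by auto
qed

lemma rt_top:
  assumes "Suc c mod m = 0"
  shows "run T (rt c) (replicate j m) = rt c \<and> out_word T (rt c) (replicate j m) = replicate j m"
proof (induction j)
  case (Suc j)
  have "T (rt c) m = ([m], rt c)"
    by (rule rt_cases[of c]) (use m_pos in \<open>auto simp: routing_def\<close>)
  then show ?case using Suc by simp
qed simp

text \<open>The cylinder of \<open>e\<close> is adjacent to that of \<open>u\<close> on the left. The word \<open>e\<close> is taken long
  enough to end in \<open>m m\<close>, because reading \<open>m m\<close> makes the state depend only on the digit sum.\<close>

lemma left_neighbour:
  assumes f: "f \<in> LocF" and iu: "inner u" and s: "state_of u = St_R"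
  obtains p d b k e y \<tau> where "hat u = p @ [Suc d] @ replicate b 0" "d < m" "p \<in> W"
    "inner (p @ [d] @ replicate k m)" "inner e" "inner y" "acts f e y" "onto_state \<tau>" "state_of e
      = \<tau>" "state_of y = \<tau>"
    "sum_list (hat y) mod m = sum_list (p @ [d] @ replicate k m) mod m"
    "\<And>\<omega>. \<omega> \<in> C \<Longrightarrow> Z ((p @ [d] @ replicate k m) \<frown> \<omega>) = e \<frown> E \<tau> \<omega>"
proof -
  have fM: "f \<in> MonoBij" and fB: "f \<in> Bij C" using f by (auto simp: LocF_MonoBij LocF_Bij)
  have uW: "u \<in> W" using iu by (simp add: inner_def)
  have "inner (hat u)" using inner_out'[of St_L] iu s by simp
  then have "hat u \<in> W" "\<not> set (hat u) \<subseteq> {0}" by (auto simp: inner_def)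
  then obtain p d b where pd: "hat u = p @ [Suc d] @ replicate b 0" "d < m" "p \<in> W"
    using last_nonzero by blast
  have su: "m dvd sum_list (hat u)"
    using sum_out'[OF uW, of St_L] state_class_state_of[OF uW] s by (auto simp: dvd_eq_mod_eq_0)
  define c where "c = sum_list (p @ [d])"
  \<comment> \<open>The digit sum of \<open>hat u\<close> is 0 modulo \<open>m\<close> and its last
    nonzero letter is \<open>Suc d\<close>, so \<open>p d\<close> has residue -1.\<close>
  have c1: "Suc c mod m = 0"
    using su pd(1) by (simp add: c_def sum_list_replicate dvd_eq_mod_eq_0)
  define \<tau> where "\<tau> = rt c"
  have o\<tau>: "onto_state \<tau>" by (simp add: \<tau>_def)
  have topE: "E \<tau> tops = tops" "E St_L tops = tops"
    using MonoBij_top[OF Er_MonoBij[OF o\<tau>]] MonoBij_top[OF Er_MonoBij[of St_L]] by simp_all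
  define e0 where "e0 = out_word T St_L (p @ [d, m, m])"
  have pdW: "p @ [d] \<in> W" "p @ [d, m, m] \<in> W" using pd by auto
  have run0: "run T St_L (p @ [d, m, m]) = \<tau>"
  proof -
    have "state_class (run T St_L (p @ [d])) c" using state_class_T[of St_L 0, OF _ pdW(1)]
      by (simp add: c_def)
    from run_mm(1)[OF this c1] show ?thesis by (simp add: \<tau>_def)
  qed
  have e0W: "e0 \<in> W" unfolding e0_def by (rule out_W[OF pdW(2)])
  have e0sum: "sum_list e0 mod m = c mod m"
    using sum_out[OF pdW(2), of St_L] by (simp add: e0_def c_def flip: add.assoc)
  have "e0 \<frown> tops \<in> C" using e0W by simp
  then obtain k1 y1 where "acts f (pre k1 (e0 \<frown> tops)) y1" using f unfolding LocF_def by blast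
  moreover have "k1 \<le> length e0 + k1" by simp
  ultimately obtain y0 where "acts f (pre (length e0 + k1) (e0 \<frown> tops)) y0"
    using acts_prefix_mono \<open>e0 \<frown> tops \<in> C\<close> by blast
  moreover have "pre (length e0 + k1) (e0 \<frown> tops) = e0 @ replicate k1 m"
    unfolding pre_conc_ge by (simp add: subsequence_def map_replicate_const)
  ultimately have y0: "acts f (e0 @ replicate k1 m) y0" by simp
  \<comment> \<open>The \<open>k1\<close> letters make \<open>f\<close> a prefix replacement at the
    right end of the cylinder of \<open>e0\<close>; the last two make the states of \<open>e\<close>
    and \<open>y\<close> equal by \<open>run_mm\<close>.\<close>
  define e where "e = e0 @ replicate k1 m @ [m, m]"
  define y where "y = y0 @ [m, m]"
  have eW: "e \<in> W" using e0W by (simp add: e_def)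
  have ey: "acts f e y" using acts_append[OF y0, of "[m, m]"] by (simp add: e_def y_def)
  have yW: "y \<in> W" using acts_W[OF fB ey eW] .
  have e1W: "e0 @ replicate k1 m \<in> W" using e0W by simp
  have e1sum: "sum_list (e0 @ replicate k1 m) mod m = c mod m"
    using e0sum by (simp add: sum_list_replicate)
  have y0W: "y0 \<in> W" using acts_W[OF fB y0 e1W] .
  have y0sum: "sum_list y0 mod m = c mod m" using acts_sum[OF f e1W y0] e1sum by simp
  have de: "state_of e = \<tau>"
  proof -
    have "state_class (state_of (e0 @ replicate k1 m)) c"
      by (rule state_class_cong[OF state_class_state_of[OF e1W] e1sum])
    from run_mm(2)[OF this c1] show ?thesis by (simp add: \<tau>_def e_def)
  qed
  have dy: "state_of y = \<tau>"
  proof -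
    have "state_class (state_of y0) c"
      by (rule state_class_cong[OF state_class_state_of[OF y0W] y0sum])
    from run_mm(2)[OF this c1] show ?thesis by (simp add: \<tau>_def y_def)
  qed
  \<comment> \<open>Of the \<open>k1 + 4\<close> letters \<open>m\<close>, two are read while
    producing \<open>e0\<close>; the other \<open>k1 + 2\<close> are copied unchanged and complete
    \<open>e\<close>.\<close>
  define ee where "ee = p @ [d] @ replicate (k1 + 4) m"
  have ee: "ee = (p @ [d, m, m]) @ replicate (k1 + 2) m" by (simp add: ee_def numeral_eq_Suc)
  have eeW: "ee \<in> W" using pd by (simp add: ee_def)
  have out_ee: "out_word T St_L ee = e" "run T St_L ee = \<tau>"
  proof -
    have "replicate k1 m @ [m, m] = replicate (k1 + 2) m" unfolding replicate_add
      by (simp add: numeral_2_eq_2)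
    then show "out_word T St_L ee = e"
      using rt_top[OF c1, of "k1 + 2"]
      by (simp only: ee out_word_append[of T St_L "p @ [d, m, m]"] run0 e0_def[symmetric] \<tau>_def[symmetric] e_def)
    show "run T St_L ee = \<tau>"
      using rt_top[OF c1, of "k1 + 2"]
        by (simp only: ee run_append[of T St_L "p @ [d, m, m]"] run0 \<tau>_def[symmetric])
  qed
  have Z_ee: "Z (ee \<frown> \<omega>) = e \<frown> E \<tau> \<omega>" if "\<omega> \<in> C" for \<omega>
  proof -
    have "ee \<frown> \<omega> \<in> C" using eeW that by simp
    then show ?thesis using E_conc[of St_L ee \<omega>] out_ee by (simp add: Z_app del: conc_C)
  qed
  have ee_top: "\<not> set ee \<subseteq> {m}" using pd(2) by (auto simp: ee_def)
  have iee: "inner ee" using eeW ee_top m_pos by (auto simp: inner_def ee_def numeral_eq_Suc)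
  have ie: "inner e"
  proof -
    have "\<not> set e \<subseteq> {m}"
    proof
      assume "set e \<subseteq> {m}"
      then have "Z (ee \<frown> tops) = Z tops"
        using Z_ee[OF top_C] topE top_conc[of e] by (simp add: Z_app)
      then have "ee \<frown> tops = tops" using Bij_inj[OF Z_Bij, of "ee \<frown> tops" tops] eeW by simp
      then show False using ee_top top_conc_iff by blast
    qed
    then show ?thesis using eW m_pos by (auto simp: inner_def e_def)
  qed
  have iy: "inner y" using acts_inner[OF fM ey ie] .
  have sy: "sum_list (hat y) mod m = sum_list ee mod m"
    using sum_out'[OF yW, of St_L] y0sum
      by (simp add: y_def ee_def c_def sum_list_replicate flip: add.assoc)
  show thesis
    by (rule that[OF pd iee[unfolded ee_def] ie iy ey o\<tau> de dy sy[unfolded ee_def]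
      Z_ee[unfolded ee_def]])
qed

text \<open>With \<open>a\<close> for the copy of \<^const>\<open>X\<close> on \<open>u\<close>, the pentagon relation expresses its copy on \<open>u 0\<close> as
  \<open>a\<^sup>-\<^sup>1 (h a h\<^sup>-\<^sup>1)\<^sup>-\<^sup>1 a a = (a\<^sup>-\<^sup>1 h a) (a\<^sup>-\<^sup>2 h\<^sup>-\<^sup>1 a\<^sup>2)\<close>. Since \<open>h\<close> is supported where \<open>t\<close> and
  \<open>a\<close> agree, \<open>a\<close> may be replaced by \<open>t\<close> here.\<close>

lemma X_copy_from_commutators:
  assumes K: "subgroup K G" and uW: "u \<in> W" and eW: "e \<in> W" and tK: "t \<in> K" and hK: "h \<in> K"
    and t_e: "\<And>\<omega>. \<omega> \<in> C \<Longrightarrow> t (e \<frown> \<omega>) = e \<frown> \<omega>"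
    and t_u: "\<And>\<omega>. \<omega> \<in> C \<Longrightarrow> t (u \<frown> \<omega>) = u \<frown> X \<omega>"
    and h_u: "\<And>\<omega>. \<omega> \<in> C \<Longrightarrow> h (u \<frown> \<omega>) = u \<frown> (m ## \<omega>)"
    and h_out: "\<And>\<omega>. \<omega> \<in> C \<Longrightarrow> \<omega> \<notin> cylinder n e \<Longrightarrow> \<omega> \<notin> cylinder n u \<Longrightarrow> h \<omega> = \<omega>"
    and disj: "\<And>\<omega> \<eta>. \<omega> \<in> C \<Longrightarrow> \<eta> \<in> C \<Longrightarrow> e \<frown> \<omega> \<noteq> u \<frown> \<eta>"
  shows "cone_map (u @ [0]) X \<in> K"
proof -
  interpret K: subgroup K G by (rule K)
  have KB: "k \<in> Bij C" if "k \<in> K" for k using K.mem_carrier[OF that] by simp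
  have tB: "t \<in> Bij C" and hB: "h \<in> Bij C" using KB tK hK by auto
  \<comment> \<open>\<open>D\<close> contains the support of \<open>h\<close>. Outside it
    \<open>t\<close> is unknown but preserves the complement, so the factors \<open>h\<close> of
    \<open>q\<close> act trivially there and the factors \<open>t\<close> cancel.\<close>
  define D where "D \<omega> \<longleftrightarrow> \<omega> \<in> cylinder n e \<or> \<omega> \<in> cylinder n u" for \<omega>
  have inv_t_e: "(iv t) (e \<frown> \<omega>) = e \<frown> \<omega>" if w: "\<omega> \<in> C" for \<omega>
    using inv_app1[OF tB, of "e \<frown> \<omega>"] t_e[OF w] eW w by simp
  have inv_t_u: "(iv t) (u \<frown> \<omega>) = u \<frown> Xi \<omega>" if w: "\<omega> \<in> C" for \<omega>
    using inv_app1[OF tB, of "u \<frown> Xi \<omega>"] t_u[of "Xi \<omega>"] X_Xi[OF w] uW w by simp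
  have t_D: "\<not> D (t \<omega>)" if w: "\<omega> \<in> C" "\<not> D \<omega>" for \<omega>
  proof
    assume "D (t \<omega>)"
    then consider x where "x \<in> C" "t \<omega> = e \<frown> x" | x where "x \<in> C" "t \<omega> = u \<frown> x"
      by (auto simp: D_def cylinder_iff)
    then show False
    proof cases
      case 1
      then have "\<omega> = e \<frown> x" using inv_app1[OF tB w(1)] inv_t_e[OF 1(1)] by simp
      then show False using w(2) 1 by (simp add: D_def)
    next
      case 2
      then have "\<omega> = u \<frown> Xi x" using inv_app1[OF tB w(1)] inv_t_u[OF 2(1)] by simp
      then show False using w(2) X_Xi[OF 2(1)] by (simp add: D_def)
    qed
  qed
  have inv_h_out: "(iv h) \<omega> = \<omega>" if w: "\<omega> \<in> C" "\<not> D \<omega>" for \<omega>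
    using inv_app1[OF hB w(1)] h_out w by (simp add: D_def)
  have inv_h_um: "(iv h) (u \<frown> (m ## \<omega>)) = u \<frown> \<omega>" if w: "\<omega> \<in> C" for \<omega>
    using inv_app1[OF hB, of "u \<frown> \<omega>"] h_u[OF w] uW w by simp
  have inv_h_e: "\<exists>x\<in>C. (iv h) \<omega> = e \<frown> x" if w: "\<omega> \<in> C" "D \<omega>" "\<And>x. x \<in> C \<Longrightarrow> \<omega> \<noteq> u \<frown> (m ## x)" for \<omega>
  proof -
    define z where "z = (iv h) \<omega>"
    have z: "z \<in> C" "h z = \<omega>" using w hB Bij_C[OF inv_Bij[OF hB]] by (auto simp: z_def)
    have "D z"
    proof (rule ccontr)
      assume "\<not> D z"
      then have "h z = z" using h_out z by (simp add: D_def)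
      then show False using z w \<open>\<not> D z\<close> by simp
    qed
    moreover have "z \<notin> cylinder n u"
    proof
      assume "z \<in> cylinder n u"
      then obtain x where "x \<in> C" "z = u \<frown> x" by (auto simp: cylinder_iff)
      then show False using h_u w(3) z by metis
    qed
    ultimately show ?thesis by (auto simp: D_def cylinder_iff z_def[symmetric])
  qed
  define q where "q = iv t \<star> (h \<star> (iv t \<star> (iv h \<star> (t \<star> t))))"
  have qK: "q \<in> K" unfolding q_def using tK hK by (intro K.m_closed K.m_inv_closed)
  have q_app: "q \<omega> = (iv t) (h ((iv t) ((iv h) (t (t \<omega>)))))" if "\<omega> \<in> C" for \<omega>
    using that tB hB Bij_C[OF tB] Bij_C[OF inv_Bij[OF tB]] Bij_C[OF inv_Bij[OF hB]]
      by (simp add: q_def)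
  have "q = cone_map u (cone_map [0] X)"
  proof (rule cone_map_eqI[OF _ uW])
    show "q \<in> extensional C" using KB[OF qK] by (rule Bij_imp_extensional)
    fix \<eta> assume w: "\<eta> \<in> C"
    have XC: "X \<eta> \<in> C" "X (X \<eta>) \<in> C" using Xi_X w by blast+
    have tt: "t (t (u \<frown> \<eta>)) = u \<frown> X (X \<eta>)" using t_u w XC by simp
    have uC: "u \<frown> \<eta> \<in> C" using uW w by simp
    obtain d' \<eta>' where d': "d' < n" "\<eta>' \<in> C" "X (X \<eta>) = d' ## \<eta>'" using C_cases[OF XC(2)] .
    \<comment> \<open>If \<open>X (X \<eta>)\<close> starts with \<open>m\<close>, the inverse of
      \<open>h\<close> deletes this letter and all factors stay inside \<open>u\<close>. Otherwise
      it leads into \<open>e\<close>, where \<open>t\<close> is trivial, so that \<open>h\<close>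
      undoes it.\<close>
    show "q (u \<frown> \<eta>) = u \<frown> cone_map [0] X \<eta>"
    proof (cases "d' = m")
      case True
      have XiC: "Xi \<eta>' \<in> C" using X_Xi d' by blast
      have "q (u \<frown> \<eta>) = u \<frown> Xi (m ## Xi \<eta>')"
        using q_app[OF uC] tt d' True inv_h_um[OF d'(2)] inv_t_u[OF d'(2)] h_u[OF XiC]
          inv_t_u[of "m ## Xi \<eta>'"] XiC
        by simp
      moreover have "cone_map [m] Xi (m ## \<eta>') = m ## Xi \<eta>'" using cone_map_in[of "[m]" \<eta>' Xi] d'
        by simp
      ultimately show ?thesis using pentagon[OF w] d' True by simp
    next
      case False
      have o: "cone_map [m] Xi (d' ## \<eta>') = d' ## \<eta>'" using d' False
        by (intro cone_map_out) (auto simp: cylinder_iff)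
      define z where "z = u \<frown> X (X \<eta>)"
      have zC: "z \<in> C" "D z" using uW XC by (simp_all add: z_def D_def)
      have "z \<noteq> u \<frown> (m ## x)" for x using d' False by (simp add: z_def)
      then obtain x where x: "x \<in> C" "(iv h) z = e \<frown> x" using inv_h_e zC by blast
      have "h (e \<frown> x) = z" using inv_app2[OF hB zC(1)] x by simp
      then have "q (u \<frown> \<eta>) = (iv t) z"
        using q_app[OF uC] tt x inv_t_e by (simp add: z_def)
      also have "\<dots> = u \<frown> X \<eta>" using inv_t_u[OF XC(2)] Xi_X[OF XC(1)] by (simp add: z_def)
      finally show ?thesis using pentagon[OF w] o d' Xi_X[OF XC(1)] by simp
    qed
  next
    fix \<omega> assume w: "\<omega> \<in> C" "\<omega> \<notin> cylinder n u"
    show "q \<omega> = \<omega>"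
    proof (cases "\<omega> \<in> cylinder n e")
      case True
      then obtain a where a: "a \<in> C" "\<omega> = e \<frown> a" by (auto simp: cylinder_iff)
      have "\<omega> \<noteq> u \<frown> (m ## x)" if "x \<in> C" for x using disj[OF a(1), of "m ## x"] that a by simp
      moreover have "D \<omega>" using True by (simp add: D_def)
      ultimately obtain x where x: "x \<in> C" "(iv h) \<omega> = e \<frown> x" using inv_h_e w by blast
      have "h (e \<frown> x) = \<omega>" using inv_app2[OF hB w(1)] x by simp
      then show ?thesis using q_app[OF w(1)] a t_e[OF a(1)] x inv_t_e by simp
    next
      case False
      then have nD: "\<not> D \<omega>" using w by (simp add: D_def)
      have tC: "t \<omega> \<in> C" "t (t \<omega>) \<in> C" using Bij_C[OF tB] w by blast+
      have nD2: "\<not> D (t \<omega>)" "\<not> D (t (t \<omega>))" using t_D w nD tC by blast+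
      then show ?thesis
        using q_app[OF w(1)] inv_h_out[OF tC(2)] h_out[OF tC(1)] inv_app1[OF tB] tC w
          by (simp add: D_def)
    qed
  qed
  then show ?thesis using qK cone_map_append[OF uW _ X_Bij, of "[0]"] by simp
qed

text \<open>An element of \<open>S n 1\<close> carrying \<open>v\<close> back to \<open>u\<close>
  passes from \<open>St_A\<close> to \<open>St_R\<close> and therefore acts on tails as
  \<open>X\<close>. The same element is made to carry \<open>y\<close> back to \<open>e\<close>,
  where the states agree, so composing with \<open>f\<close> gives \<open>X\<close> on
  \<open>u\<close> and the identity on \<open>e\<close>.\<close>

lemma mismatch_gives_X:
  assumes K: "subgroup K G" and SK: "S n 1 \<subseteq> K" and KF: "K \<subseteq> LocF"
    and fK: "f \<in> K" and uv: "acts f u v" and iu: "inner u" and s: "state_of u = St_R" "state_of v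
      = St_A"
  shows "cone_map (u @ [0]) X \<in> K"
proof -
  interpret K: subgroup K G by (rule K)
  have KB: "k \<in> Bij C" if "k \<in> K" for k using K.mem_carrier[OF that] by simp
  have f: "f \<in> LocF" and fM: "f \<in> MonoBij" and fB: "f \<in> Bij C" using fK KF
    by (auto simp: LocF_MonoBij LocF_Bij)
  have uW: "u \<in> W" using iu by (simp add: inner_def)
  have vW: "v \<in> W" using acts_W[OF fB uv uW] .
  have iv: "inner v" using acts_inner[OF fM uv iu] .
  have ihu: "inner (hat u)" "inner (hat v)" using inner_out'[of St_L] iu iv s by auto
  then have huW: "hat u \<in> W" "hat v \<in> W" by (auto simp: inner_def)
  have su: "m dvd sum_list (hat u)" "m dvd sum_list (hat v)"
    using sum_out'[OF uW, of St_L] sum_out'[OF vW, of St_L] state_class_state_of[OF uW]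
      state_class_state_of[OF vW] s
    by (auto simp: dvd_eq_mod_eq_0)
  obtain p d b k e y \<tau> where pd: "hat u = p @ [Suc d] @ replicate b 0" "d < m" "p \<in> W"
    and iee': "inner (p @ [d] @ replicate k m)" and ie: "inner e" and iy: "inner y"
    and ey: "acts f e y" and o\<tau>: "onto_state \<tau>" and de: "state_of e = \<tau>" and dy: "state_of y = \<tau>"
    and sy': "sum_list (hat y) mod m = sum_list (p @ [d] @ replicate k m) mod m"
    and Z_ee': "\<And>\<omega>. \<omega> \<in> C \<Longrightarrow> Z ((p @ [d] @ replicate k m) \<frown> \<omega>) = e \<frown> E \<tau> \<omega>"
    by (rule left_neighbour[OF f iu s(1)], rule that)
  define ee where "ee = p @ [d] @ replicate k m"
  note iee = iee'[folded ee_def] and sy = sy'[folded ee_def] and Z_ee = Z_ee'[folded ee_def]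
  have topE: "E \<tau> tops = tops"
    using MonoBij_top[OF Er_MonoBij[OF o\<tau>]] by simp
  have eeW: "ee \<in> W" and eW: "e \<in> W" and yW: "y \<in> W" using iee ie iy by (simp_all add: inner_def)
  have ihy: "inner (hat y)" using inner_out'[of St_L] iy dy o\<tau> by auto
  then have hyW: "hat y \<in> W" by (simp add: inner_def)
  have Z_uu: "Z (hat u \<frown> \<omega>) = u \<frown> E St_R \<omega>" if "\<omega> \<in> C" for \<omega>
  proof -
    have "hat u \<frown> \<omega> \<in> C" using huW that by simp
    then show ?thesis using E_out'[of St_L u \<omega>] s uW that by (simp add: Z_app del: conc_C)
  qed
  obtain f1 where f1: "f1 \<in> LocF" "acts f1 (hat y) ee" using LocF_transitive[OF ihy iee sy] by blast
  have "sum_list (hat v) mod m = sum_list (hat u) mod m" using su by (simp add: dvd_eq_mod_eq_0)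
  then obtain f2 where f2: "f2 \<in> LocF" "acts f2 (hat v) (hat u)" using LocF_transitive[OF ihu(2,1)]
    by blast
  have adj1: "adj (ee \<frown> tops) (hat u \<frown> zeros)"
  proof -
    have "ee \<frown> tops = p \<frown> (d ## tops)"
      unfolding ee_def by (simp only: conc_conc[symmetric] replicate_top) simp
    moreover have "hat u \<frown> zeros = p \<frown> (Suc d ## zeros)"
      unfolding pd(1) by (simp only: conc_conc[symmetric] replicate_bot) simp
    ultimately show ?thesis using adj_conc[OF pd(3)] adj_step[OF pd(2)] by metis
  qed
  \<comment> \<open>The conjugate of \<open>f\<close> need not be local, but it is order-preserving.
    It therefore maps the jump between \<open>ee\<close> and \<open>hat u\<close> to one between
    \<open>hat y\<close> and \<open>hat v\<close>, which is where the pieces are glued.\<close>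
  have ucM: "zunconj f \<in> MonoBij" by (intro MonoBij_mult MonoBij_inv Z_MonoBij fM)
  have ucf: "zunconj f \<omega> = (iv Z) (f (Z \<omega>))" if "\<omega> \<in> C" for \<omega>
    using that fB Z_Bij Bij_C[OF Z_Bij] by simp
  have "zunconj f (ee \<frown> tops) = hat y \<frown> tops"
  proof -
    have "zunconj f (ee \<frown> tops) = (iv Z) (f (e \<frown> tops))"
      using ucf[of "ee \<frown> tops"] Z_ee[OF top_C] topE eeW by simp
    also have "\<dots> = hat y \<frown> E' \<tau> tops"
      using actsD[OF ey top_C] yW dy by (simp add: inv_Z E'_conc)
    also have "E' \<tau> tops = tops" using E'_E[OF o\<tau> top_C] topE by simp
    finally show ?thesis .
  qed
  moreover have "zunconj f (hat u \<frown> zeros) = hat v \<frown> zeros"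
  proof -
    have b: "E St_R zeros = zeros" "E St_A zeros = zeros"
      using MonoBij_bot[OF Er_MonoBij[of St_R]] MonoBij_bot[OF Er_MonoBij[of St_A]] by simp_all
    have "zunconj f (hat u \<frown> zeros) = (iv Z) (f (u \<frown> zeros))"
      using ucf[of "hat u \<frown> zeros"] Z_uu[OF bot_C] b huW by simp
    also have "\<dots> = hat v \<frown> E' St_A zeros"
      using actsD[OF uv bot_C] vW s by (simp add: inv_Z E'_conc)
    also have "E' St_A zeros = zeros" using E'_E[of St_A zeros] b by simp
    finally show ?thesis .
  qed
  ultimately have adj2: "adj (hat y \<frown> tops) (hat v \<frown> zeros)" using adj_MonoBij[OF ucM adj1] by simp
  have adj3: "adj (f1 (hat y \<frown> tops)) (f2 (hat v \<frown> zeros))"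
    using adj1 actsD[OF f1(2) top_C] actsD[OF f2(2) bot_C] by simp
  obtain s1 where s1: "s1 \<in> LocF" "\<And>\<omega>. \<omega> \<in> C \<Longrightarrow> \<not> hat y \<frown> tops \<sqsubset> \<omega> \<Longrightarrow> s1 \<omega> = f1 \<omega>"
    "\<And>\<omega>. \<omega> \<in> C \<Longrightarrow> \<not> \<omega> \<sqsubset> hat v \<frown> zeros \<Longrightarrow> s1 \<omega> = f2 \<omega>"
    using LocF_glue[OF f1(1) f2(1) hyW huW(2) adj2 adj3] by blast
  have s1y: "acts s1 (hat y) ee"
    unfolding acts_def
  proof
    fix \<omega> assume w: "\<omega> \<in> C"
    have "hat y \<frown> \<omega> \<in> C" using hyW w by simp
    then show "s1 (hat y \<frown> \<omega>) = ee \<frown> \<omega>"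
      using s1(2)[of "hat y \<frown> \<omega>"] not_top_lt[OF w] actsD[OF f1(2) w] by simp
  qed
  have s1v: "acts s1 (hat v) (hat u)"
    unfolding acts_def
  proof
    fix \<omega> assume w: "\<omega> \<in> C"
    have "hat v \<frown> \<omega> \<in> C" using huW w by simp
    then show "s1 (hat v \<frown> \<omega>) = hat u \<frown> \<omega>"
      using s1(3)[of "hat v \<frown> \<omega>"] not_lt_bot[of \<omega>] actsD[OF f2(2) w] by simp
  qed
  have s1B: "s1 \<in> Bij C" using LocF_Bij[OF s1(1)] .
  \<comment> \<open>Of \<open>t\<close> only its action on the cylinders of \<open>e\<close> and
    \<open>u\<close> is known.\<close>
  define t where "t = zconj s1 \<star> f"
  have cjK: "zconj s1 \<in> K" using zconj_S1[OF s1(1)] SK by blast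
  have tK: "t \<in> K" unfolding t_def using cjK fK by (rule K.m_closed)
  have tB: "t \<in> Bij C" using KB[OF tK] .
  have t_e: "t (e \<frown> \<omega>) = e \<frown> \<omega>" if w: "\<omega> \<in> C" for \<omega>
  proof -
    define \<xi> where "\<xi> = E' \<tau> \<omega>"
    have x: "\<xi> \<in> C" "E \<tau> \<xi> = \<omega>" using w o\<tau> by (auto simp: \<xi>_def E'_C E_E')
    have "(iv Z) (y \<frown> \<omega>) = hat y \<frown> \<xi>" using yW w dy by (simp add: inv_Z E'_conc \<xi>_def)
    moreover have "y \<frown> \<omega> \<in> C" "hat y \<frown> \<xi> \<in> C" "e \<frown> \<omega> \<in> C" using yW w hyW x eW by simp_all
    ultimately have "zconj s1 (y \<frown> \<omega>) = e \<frown> \<omega>"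
      using s1B Z_Bij actsD[OF s1y x(1)] Z_ee[OF x(1)] x(2) by (simp del: conc_C)
    then show ?thesis
      using actsD[OF ey w] zconj_Bij[OF s1B] fB \<open>e \<frown> \<omega> \<in> C\<close> by (simp add: t_def del: conc_C)
  qed
  have t_u: "t (u \<frown> \<eta>) = u \<frown> X \<eta>" if w: "\<eta> \<in> C" for \<eta>
  proof -
    define \<omega> where "\<omega> = E' St_A \<eta>"
    have x: "\<omega> \<in> C" "E St_A \<omega> = \<eta>" using w by (auto simp: \<omega>_def E'_C E_E')
    have "zconj s1 (v \<frown> E St_A \<omega>) = u \<frown> E St_R \<omega>"
      using zconj_hat[OF s1B s1v vW uW _ _ x(1)] s by simp
    moreover have "X \<eta> = E St_R \<omega>" using E_A[OF x(1)] x X_Xi[OF E_C[OF x(1)]] by simp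
    ultimately show ?thesis
      using actsD[OF uv w] zconj_Bij[OF s1B] fB uW w x(2) by (simp add: t_def)
  qed
  have "hat (u @ [m]) = hat u @ [m]" "state_of (u @ [m]) = St_R" using s m_pos by simp_all
  note hum = this
  \<comment> \<open>Both \<open>hat u\<close> and \<open>hat u m\<close> belong to words in
    \<open>St_R\<close>, so conjugation by \<zeta> turns this shift into an exact replacement of
    \<open>u\<close> by \<open>u m\<close>.\<close>
  obtain h1 where h1: "h1 \<in> LocF" "acts h1 (hat u) (hat u @ [m])"
    "\<And>\<omega>. \<omega> \<in> C \<Longrightarrow> \<omega> \<notin> cylinder n ee \<Longrightarrow> \<omega> \<notin> cylinder n (hat u) \<Longrightarrow> h1 \<omega> = \<omega>"
    using LocF_shift_right[OF pd(3,2) ee_def pd(1)] by blast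
  define h where "h = zconj h1"
  have h1B: "h1 \<in> Bij C" using LocF_Bij[OF h1(1)] .
  have hK: "h \<in> K" using zconj_S1[OF h1(1)] SK by (auto simp: h_def)
  have hB: "h \<in> Bij C" using KB[OF hK] .
  have h_u: "h (u \<frown> \<eta>) = u \<frown> (m ## \<eta>)" if w: "\<eta> \<in> C" for \<eta>
  proof -
    have umW: "u @ [m] \<in> W" using uW by simp
    have "h (u \<frown> E St_R (E' St_R \<eta>)) = (u @ [m]) \<frown> E St_R (E' St_R \<eta>)"
      using zconj_hat[OF h1B _ uW umW _ _ E'_C[OF w]] h1(2) hum s
        by (simp add: h_def del: build_append)
    then show ?thesis using E_E'[of St_R \<eta>] w by simp
  qed
  have h_out: "h \<omega> = \<omega>" if w: "\<omega> \<in> C" "\<omega> \<notin> cylinder n e" "\<omega> \<notin> cylinder n u" for \<omega>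
  proof -
    define \<xi> where "\<xi> = (iv Z) \<omega>"
    have x: "\<xi> \<in> C" "Z \<xi> = \<omega>" using w Z_Bij Bij_C[OF inv_Bij[OF Z_Bij]] by (auto simp: \<xi>_def)
    have "\<xi> \<notin> cylinder n ee"
    proof
      assume "\<xi> \<in> cylinder n ee"
      then obtain x' where x': "x' \<in> C" "\<xi> = ee \<frown> x'" by (auto simp: cylinder_iff)
      then have "\<omega> = e \<frown> E \<tau> x'" using Z_ee[OF x'(1)] x(2) by simp
      then show False using w(2) E_C[OF x'(1)] cyl_conc by metis
    qed
    moreover have "\<xi> \<notin> cylinder n (hat u)"
    proof
      assume "\<xi> \<in> cylinder n (hat u)"
      then obtain x' where x': "x' \<in> C" "\<xi> = hat u \<frown> x'" by (auto simp: cylinder_iff)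
      then have "\<omega> = u \<frown> E St_R x'" using Z_uu[OF x'(1)] x(2) by simp
      then show False using w(3) E_C[OF x'(1)] cyl_conc by metis
    qed
    ultimately have "h1 \<xi> = \<xi>" using h1(3) x by blast
    then show ?thesis using w h1B Z_Bij x by (simp add: h_def \<xi>_def[symmetric])
  qed
  have disj: "e \<frown> a \<noteq> u \<frown> r" if ab: "a \<in> C" "r \<in> C" for a r
  proof
    assume eq: "e \<frown> a = u \<frown> r"
    define a' where "a' = E' \<tau> a"
    define r' where "r' = E' St_R r"
    have C: "a' \<in> C" "r' \<in> C" and E: "E \<tau> a' = a" "E St_R r' = r"
      using ab o\<tau> by (auto simp: a'_def r'_def E'_C E_E')
    have "Z (ee \<frown> a') = Z (hat u \<frown> r')" using Z_ee[OF C(1)] Z_uu[OF C(2)] E eq by simp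
    then have "ee \<frown> a' = hat u \<frown> r'"
      using Bij_inj[OF Z_Bij, of "ee \<frown> a'" "hat u \<frown> r'"] C eeW huW by simp
    moreover have "ee \<frown> a' = p \<frown> (d ## (replicate k m \<frown> a'))"
      by (simp add: ee_def del: replicate_add)
    moreover have "hat u \<frown> r' = p \<frown> (Suc d ## (replicate b 0 \<frown> r'))" by (simp add: pd(1))
    ultimately show False by simp
  qed
  show ?thesis
    by (rule X_copy_from_commutators[OF K uW eW tK hK t_e t_u h_u h_out disj])
qed

section \<open>Maximality of \<open>S n 1\<close>\<close>

lemma state_of_B:
  assumes "state_of z = St_B" "z \<in> W" obtains p where "z = p @ [0]" "state_of p = St_A"
proof (cases z rule: rev_cases)
  case Nil
  then show thesis using assms by simp
next
  case (snoc p d)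
  then have d: "d < n" and st: "snd (T' (state_of p) d) = St_B" using assms by auto
  from d have "d = 0 \<and> state_of p = St_A"
    by (cases rule: letter_cases) (use st m_pos in \<open>cases "state_of p"; simp\<close>)+
  then show thesis using that snoc by blast
qed

text \<open>The first copy of \<open>X\<close> sits on \<open>u 0\<close>, a word in
  \<open>St_A\<close>. Conjugation by \<open>S n 1\<close> spreads it to all inner words in
  \<open>St_A\<close>; the mismatch of \<open>f\<close> carries it from \<open>v\<close> to
  \<open>u\<close>, hence to \<open>St_R\<close>; the pentagon reaches \<open>St_B\<close>. These
  are all the words with residue 0 that \<open>all_of_LocF\<close> asks for.\<close>

lemma S1_maximal:
  assumes K: "subgroup K G" and SK: "S n 1 \<subseteq> K" and KF: "K \<subseteq> LocF" and not: "\<not> K \<subseteq> S n 1"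
  shows "K = LocF"
proof -
  interpret K: subgroup K G by (rule K)
  interpret group G by (rule group_G)
  have KB: "k \<in> Bij C" if "k \<in> K" for k using K.mem_carrier[OF that] by simp
  obtain f0 where f0: "f0 \<in> K" "f0 \<notin> S n 1" using not by blast
  then have "f0 \<in> LocF" "zunconj f0 \<notin> LocF" using KF S1_iff[OF KB] by auto
  from state_mismatch[OF this] obtain f u v where "f = f0 \<or> f = iv f0" and
    uv: "acts f u v" and iu: "inner u" and s: "state_of u = St_R" "state_of v = St_A" by blast
  then have fK: "f \<in> K" using f0 by auto
  have uW: "u \<in> W" using iu by (simp add: inner_def)
  have vW: "v \<in> W" using acts_W[OF KB[OF fK] uv uW] .
  have iv: "inner v" using acts_inner[OF LocF_MonoBij uv iu] fK KF by blast
  have u0: "cone_map (u @ [0]) X \<in> K" by (rule mismatch_gives_X[OF K SK KF fK uv iu s])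
  have move: "cone_map b X \<in> K"
    if a: "inner a" "cone_map a X \<in> K" and b: "inner b" "state_of a
    = state_of b" "state_of b \<noteq> St_B" for a b
  proof -
    have W: "a \<in> W" "b \<in> W" using a b by (auto simp: inner_def)
    have "onto_state (state_of b)" using state_class_onto[OF state_class_state_of[OF W(2)] b(3)] .
    then obtain g where g: "g \<in> S n 1" "acts g a b" using S1_transitive[OF a(1) b(1)] b(2) by blast
    have gK: "g \<in> K" using g SK by blast
    have "g \<star> cone_map a X \<star> iv g = cone_map b X"
      by (rule cone_map_conj_acts[OF KB[OF gK] W(2,1) X_Bij g(2)])
    then show ?thesis using gK a(2) K.m_closed K.m_inv_closed by metis
  qed
  have A: "cone_map z X \<in> K" if "inner z" "state_of z = St_A" for z
    by (rule move[of "u @ [0]" z]) (use u0 that s inner_append[OF iu, of "[0]"] in auto)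
  have "iv f \<star> cone_map v X \<star> iv (iv f) = cone_map u X"
    by (rule cone_map_conj_acts[OF _ uW vW X_Bij acts_inv[OF KB[OF fK] uv uW]]) (simp add: KB[OF fK])
  then have "cone_map u X \<in> K" using fK A[OF iv s(2)] K.m_closed K.m_inv_closed by metis
  then have R: "cone_map z X \<in> K" if "inner z" "state_of z = St_R" for z
    by (rule move[rotated]) (use that s iu in auto)
  \<comment> \<open>\<open>S1_transitive\<close> does not reach \<open>St_B\<close>. But such a word
    is \<open>p 0\<close> with \<open>p\<close> in \<open>St_A\<close>, and the pentagon builds the
    copy on \<open>p 0\<close> from those on \<open>p\<close> and \<open>p m\<close>, whose states
    are \<open>St_A\<close> and \<open>St_R\<close>.\<close>
  have B: "cone_map z X \<in> K" if z: "inner z" "state_of z = St_B" for z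
  proof -
    have zW: "z \<in> W" using z by (simp add: inner_def)
    obtain p where p: "z = p @ [0]" "state_of p = St_A" using state_of_B[OF z(2) zW] .
    have pW: "p \<in> W" using zW p by simp
    have "\<not> set p \<subseteq> {m}"
    proof
      assume t: "set p \<subseteq> {m}"
      have "p \<noteq> []" using p by auto
      then show False using state_of_top[OF t] p by simp
    qed
    moreover have "\<not> set p \<subseteq> {0}" using z p by (auto simp: inner_def)
    ultimately have ip: "inner p" using pW by (simp add: inner_def)
    have a: "cone_map p X \<in> K" using A[OF ip p(2)] .
    have pm: "inner (p @ [m])" "state_of (p @ [m]) = St_R"
      using inner_append[OF ip, of "[m]"] p m_pos by auto
    have am: "cone_map p (cone_map [m] X) \<in> K"
      using R[OF pm] cone_map_append[OF pW _ X_Bij, of "[m]"] by simp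
    have mB: "cone_map [m] X \<in> Bij C" by (rule cone_map_Bij) (auto simp: X_Bij)
    have iX: "iv (cone_map [m] X) = cone_map [m] Xi" using cone_map_inv[of "[m]" X] X_Bij inv_X
      by simp
    have "iv X \<star> (iv (cone_map [m] X) \<star> (X \<star> X)) = cone_map [0] X"
    proof (rule Bij_eqI)
      show "iv X \<star> (iv (cone_map [m] X) \<star> (X \<star> X)) \<in> Bij C" using X_Bij mB by simp
      show "cone_map [0] X \<in> Bij C" by (rule cone_map_Bij) (auto simp: X_Bij)
      fix \<omega> assume w: "\<omega> \<in> C"
      have "cone_map [m] Xi \<in> Bij C" using iX mB by (metis inv_Bij)
      then show "(iv X \<star> (iv (cone_map [m] X) \<star> (X \<star> X))) \<omega> = cone_map [0] X \<omega>"
        using pentagon[OF w] w X_Bij Xi_Bij Bij_C[OF X_Bij] by (simp add: iX inv_X)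
    qed
    then have "cone_map p (cone_map [0] X)
      = iv (cone_map p X) \<star> (iv (cone_map p (cone_map [m] X)) \<star> (cone_map p X \<star> cone_map p X))"
      using pW X_Bij mB by (simp add: cone_map_mult cone_map_inv flip: \<open>_ = cone_map [0] X\<close>)
    moreover have "cone_map z X = cone_map p (cone_map [0] X)"
      using p cone_map_append[OF pW _ X_Bij, of "[0]"] by simp
    ultimately show ?thesis using a am by (simp add: K.m_closed K.m_inv_closed)
  qed
  have "LocF \<subseteq> K"
  proof (rule all_of_LocF[OF K SK KF])
    fix z assume z: "inner z" "m dvd sum_list z"
    then have zW: "z \<in> W" and "\<not> set z \<subseteq> {0}" by (auto simp: inner_def)
    then have "state_of z \<in> {St_R, St_A, St_B}"
      using state_class_zero[OF state_class_state_of[OF zW] z(2)] run'_L[OF zW] by blast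
    then show "cone_map z X \<in> K" using z A R B by auto
  qed
  then show ?thesis using KF by blast
qed

section \<open>Induction along the chain\<close>

lemma conj_subgroup:
  assumes H: "subgroup H G" and z: "z \<in> Bij C"
  shows "subgroup ((\<lambda>f. z \<star> f \<star> iv z) ` H) G"
proof -
  interpret group G by (rule group_G)
  let ?c = "\<lambda>f. z \<star> f \<star> iv z"
  have "group_hom G G ?c"
  proof (unfold_locales, rule homI)
    fix x y assume xy: "x \<in> carrier G" "y \<in> carrier G"
    then show "?c x \<in> carrier G" using z by simp
    show "?c (x \<star> y) = ?c x \<star> ?c y"
      by (rule Bij_eqI) (use xy z Bij_C[of x] Bij_C[of y] Bij_C[OF inv_Bij[OF z]]
        Bij_C[OF z] in auto)
  qed
  from group_hom.subgroup_img_is_subgroup[OF this H] show ?thesis .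
qed

theorem overgroups_of_S:
  "subgroup K G \<Longrightarrow> S n i \<subseteq> K \<Longrightarrow> K \<subseteq> LocF \<Longrightarrow> \<exists>j\<le>i. K = S n j"
proof (induction i arbitrary: K)
  case 0
  then show ?case by (auto simp: S_0)
next
  case (Suc i)
  interpret group G by (rule group_G)
  have KB: "k \<in> Bij C" if "k \<in> K" for k using that Suc.prems(3) LocF_Bij by blast
  have iZ: "iv Z \<in> Bij C" using Z_Bij by simp
  have zunconj_sub: "subgroup (zunconj ` H) G" if "subgroup H G" for H
    using conj_subgroup[OF that iZ] Z_Bij by simp
  have S1: "subgroup (S n 1) G"
    using conj_subgroup[OF LocF_subgroup Z_Bij] S_Suc[of 0] by (simp add: S_0)
  have ucS: "S n i \<subseteq> zunconj ` H" if "S n (Suc i) \<subseteq> H" for H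
  proof
    fix g assume g: "g \<in> S n i"
    then have "g \<in> Bij C" using S_LocF LocF_Bij by blast
    then have "g = zunconj (zconj g)" by (simp only: zunconj_zconj)
    moreover have "zconj g \<in> H" using g that by (auto simp: S_Suc)
    ultimately show "g \<in> zunconj ` H" by blast
  qed
  have S1F: "zunconj ` H \<subseteq> LocF" if "H \<subseteq> S n 1" for H
    using that S_LocF[of 1] LocF_Bij S1_iff by blast
  have SS1: "S n (Suc i) \<subseteq> S n 1" using S_LocF[of i] S_Suc[of i] S_Suc[of 0] by (auto simp: S_0)
  have pull: "H = S n (Suc j)" if h: "zunconj ` H = S n j" "H \<subseteq> Bij C" for H j
  proof -
    have "zconj ` zunconj ` H = (\<lambda>f. f) ` H"
      unfolding image_image using h(2) zconj_zunconj by (intro image_cong refl) blast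
    then show ?thesis using h(1) by (simp add: S_Suc)
  qed
  show ?case
  proof (cases "K \<subseteq> S n 1")
    case True
    obtain j where "j \<le> i" "zunconj ` K = S n j"
      using Suc.IH[OF zunconj_sub[OF Suc.prems(1)] ucS[OF Suc.prems(2)] S1F[OF True]] by blast
    then show ?thesis using pull[of K j] KB by blast
  next
    case False
    \<comment> \<open>Conjugating \<open>H\<close> by the inverse of \<zeta> gives a subgroup of
      \<open>LocF\<close> containing \<open>S n i\<close>, so the induction hypothesis places
      \<open>H\<close> in the chain although \<open>K\<close> itself is not below
      \<open>S n 1\<close>.\<close>
    define H where "H = K \<inter> S n 1"
    have H: "subgroup H G" unfolding H_def by (rule subgroups_Inter_pair[OF Suc.prems(1) S1])
    have "S n (Suc i) \<subseteq> H" using Suc.prems(2) SS1 by (simp add: H_def)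
    then obtain j where j: "j \<le> i" "zunconj ` H = S n j"
      using Suc.IH[OF zunconj_sub[OF H] ucS S1F[of H]] by (auto simp: H_def)
    obtain f0 where f0: "f0 \<in> K" "f0 \<notin> S n 1" using False by blast
    then have "f0 \<in> LocF" "zunconj f0 \<notin> LocF" using Suc.prems(3) S1_iff[OF KB] by auto
    from state_mismatch[OF this] obtain f u v where "f = f0 \<or> f = iv f0" and
      uv: "acts f u v" and iu: "inner u" and s: "state_of u = St_R" "state_of v = St_A" by blast
    then have fK: "f \<in> K" using f0 subgroup.m_inv_closed[OF Suc.prems(1)] by auto
    have uW: "u \<in> W" using iu by (simp add: inner_def)
    obtain g where g: "g \<in> K" "zunconj g \<in> LocF" "zunconj (zunconj g) \<notin> LocF"
      using not_below_S1_step[OF Suc.prems(1,2) fK uv uW s] by blast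
    have "g \<in> H" using g S1_iff[OF KB[OF g(1)]] by (simp add: H_def)
    then have "zunconj g \<in> S n j" using j(2) by blast
    \<comment> \<open>For \<open>j > 0\<close> the group \<open>S n j\<close> lies in
      \<open>S n 1\<close>, which this excludes; so \<open>H\<close> is \<open>S n 1\<close>, and
      maximality applies to \<open>K\<close>.\<close>
    moreover have "zunconj g \<notin> S n 1" using S1_iff[OF LocF_Bij[OF g(2)]] g(3) by simp
    ultimately have "j = 0"
      using S_LocF[of "j - 1"] S_Suc[of "j - 1"] S_Suc[of 0] by (cases j) (auto simp: S_0)
    then have "H = S n 1" using pull[of H 0] j(2) KB by (auto simp: H_def)
    then have "S n 1 \<subseteq> K" by (auto simp: H_def)
    then have "K = LocF" using S1_maximal[OF Suc.prems(1) _ Suc.prems(3) False] by blast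
    then show ?thesis using S_0 by blast
  qed
qed

end

theorem theorem7p26:
  fixes n i :: nat and K :: "(nat word \<Rightarrow> nat word) set"
  assumes "n \<ge> 2"
    and "subgroup K (BijGroup (cantor n))"
    and "S n i \<subset> K" and "K \<subseteq> F n"
  shows "\<exists>j < i. K = S n j"
proof -
  obtain m where m: "n = Suc m" "0 < m" using assms(1) by (cases n) auto
  interpret alphabet m by unfold_locales (rule m(2))
  obtain j where "j \<le> i" "K = S n j"
    using overgroups_of_S[of K i] assms m(1) F_eq_LocF by auto
  moreover have "j \<noteq> i" using calculation assms(3) by blast
  ultimately show ?thesis by (metis le_neq_implies_less)
qed

end
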